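(* The unitary model structure on $\mathsf{C}_1^*\mathsf{cat}$ is cofibrantly generated, with finite sets of generating cofibrations and generating trivial cofibrations $$I=\{U\colon\emptyset\to\mathbb F,\; V\colon\mathbb F\sqcup\mathbb F\to\mathbf 1,\; W\colon P\to\mathbf 1\}\quad\text{and}\quad J=\{0\colon\mathbb F\to\mathbf I\},$$ respectively.
   Context: Let $\mathbb F$ be $\mathbb R$ or $\mathbb C$. All categories have identities and all functors preserve them. An $\mathbb F$-category is a category enriched over $\mathbb F$-vector spaces. A $*$-category is an $\mathbb F$-category with an involution: maps $A(x,y)\to A(y,x)$, $a\mapsto a^*$, which are antilinear, with $(ba)^*=a^*b^*$ and $(a^* )^*=a$. A $*$-functor is an $\mathbb F$-linear functor with $F(a^* )=F(a)^*$. A $\mathrm{C}^*$-category is a $*$-category whose Hom spaces are Banach spaces, with $\|ba\|\le\|b\|\|a\|$, $\|a^*a\|=\|a\|^2$, and such that for each $a\in A(x,y)$ the element $a^*a$ of $A(x,x)$ is positive (its spectrum $\{z\in\mathbb F\mid a^*a-z1_x \text{ not invertible}\}$ lies in $[0,\infty)$). $\mathsf{C}_1^*\mathsf{cat}$ is the category of small $\mathrm{C}^*$-categories and $*$-functors. An arrow $a\in A(x,y)$ is unitary if $a^*a=1_x$ and $aa^*=1_y$. A $*$-functor $F\colon A\to B$ is a unitary equivalence if there are a $*$-functor $G\colon B\to A$ and natural isomorphisms $GF\simeq\mathrm{id}_A$, $FG\simeq\mathrm{id}_B$ with unitary components. The unitary model structure on $\mathsf{C}_1^*\mathsf{cat}$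 has: weak equivalences the unitary equivalences; cofibrations the $*$-functors injective on objects; fibrations the $*$-functors $F\colon A\to B$ such that every unitary $v\colon Fx\to y$ in $B$ equals $Fu$ for some unitary $u\colon x\to x'$ in $A$. $\emptyset$ is the empty (initial) $\mathrm{C}^*$-category. $\mathbb F$ is the $\mathrm{C}^*$-category with one object and endomorphism algebra $\mathbb F$; $*$-functors $\mathbb F\to A$ correspond to objects of $A$. $\mathbf 1$ is the universal $\mathrm{C}^*$-category generated by two distinct objects $0,1$ and an arrow $a\colon 0\to1$ with $\|a\|\le1$; $*$-functors $\mathbf 1\to A$ correspond bijectively to arrows of $A$ of norm at most $1$. $U$ is the unique $*$-functor; $V$ sends the first copy of $\mathbb F$ to the object $0$ and the second to the object $1$. $P$ is the pushout in $\mathsf{C}_1^*\mathsf{cat}$ of $V$ along $V$ (equivalently, the universal $\mathrm{C}^*$-category generated by two parallel arrows $0\rightrightarrows1$ of norm at most $1$), and $W$ has both components equal to $\mathrm{id}_{\mathbf 1}$. $\mathbf I$ is the universal $\mathrm{C}^*$-category with two objects $0,1$ and a unitary $u\colon0\to1$ ($*$-functors $\mathbf I\to A$ correspond to unitaries of $A$), and $0\colon\mathbb F\to\mathbf I$ picks the object $0$. Cofibrantly generated is meant in the sense of Hovey's "Model Categories", Def. 2.1.17: the fibrations (resp. trivial fibrations) are the maps with the right lifting property with respect to $J$ (resp. $I$), and the domains of the maps in $I$ (resp. $J$) are small relative to $I$-cell (resp. $J$-cell). *)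

theory Defs
  imports Complex_Main "HOL-Library.FuncSet"
begin

section \<open>Categories\<close>

text \<open>Every arrow carries its source and target, so distinct Hom sets are disjoint.
  \<open>cmp C g f\<close> is the composite of \<open>f\<close> followed by \<open>g\<close>.\<close>

record ('o, 'a) cat =
  obj :: "'o set"
  arr :: "'a set"
  src :: "'a \<Rightarrow> 'o"
  tgt :: "'a \<Rightarrow> 'o"
  ide :: "'o \<Rightarrow> 'a"
  cmp :: "'a \<Rightarrow> 'a \<Rightarrow> 'a"

definition hom :: "('o, 'a, 'm) cat_scheme \<Rightarrow> 'o \<Rightarrow> 'o \<Rightarrow> 'a set" where
  "hom C x y = {f \<in> arr C. src C f = x \<and> tgt C f = y}"

locale category =
  fixes C :: "('o, 'a, 'm) cat_scheme"
  assumes src_obj: "f \<in> arr C \<Longrightarrow> src C f \<in> obj C"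
    and tgt_obj: "f \<in> arr C \<Longrightarrow> tgt C f \<in> obj C"
    and ide_hom: "x \<in> obj C \<Longrightarrow> ide C x \<in> hom C x x"
    and cmp_hom: "f \<in> hom C x y \<Longrightarrow> g \<in> hom C y z \<Longrightarrow> cmp C g f \<in> hom C x z"
    and cmp_ide: "f \<in> hom C x y \<Longrightarrow> cmp C f (ide C x) = f"
    and ide_cmp: "f \<in> hom C x y \<Longrightarrow> cmp C (ide C y) f = f"
    and cmp_assoc: "f \<in> hom C w x \<Longrightarrow> g \<in> hom C x y \<Longrightarrow> h \<in> hom C y z \<Longrightarrow>
      cmp C h (cmp C g f) = cmp C (cmp C h g) f"

definition invertible_in :: "('o, 'a, 'm) cat_scheme \<Rightarrow> 'o \<Rightarrow> 'a \<Rightarrow> bool" where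
  "invertible_in C x f \<longleftrightarrow>
     f \<in> hom C x x \<and> (\<exists>g \<in> hom C x x. cmp C g f = ide C x \<and> cmp C f g = ide C x)"

definition is_coproduct ::
  "('o, 'a, 'm) cat_scheme \<Rightarrow> 'o \<Rightarrow> 'o \<Rightarrow> 'o \<Rightarrow> 'a \<Rightarrow> 'a \<Rightarrow> bool" where
  "is_coproduct C x y s i j \<longleftrightarrow>
     i \<in> hom C x s \<and> j \<in> hom C y s \<and>
     (\<forall>z \<in> obj C. \<forall>f \<in> hom C x z. \<forall>g \<in> hom C y z.
        \<exists>!h. h \<in> hom C s z \<and> cmp C h i = f \<and> cmp C h j = g)"

text \<open>\<open>is_pushout C f g p q\<close>: the square \<open>p \<circ> f = q \<circ> g\<close> is a pushout square.  Then \<open>q\<close> is the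
  pushout of \<open>f\<close> along \<open>g\<close> (and \<open>p\<close> that of \<open>g\<close> along \<open>f\<close>).\<close>

definition is_pushout ::
  "('o, 'a, 'm) cat_scheme \<Rightarrow> 'a \<Rightarrow> 'a \<Rightarrow> 'a \<Rightarrow> 'a \<Rightarrow> bool" where
  "is_pushout C f g p q \<longleftrightarrow>
     f \<in> arr C \<and> g \<in> arr C \<and> p \<in> arr C \<and> q \<in> arr C \<and>
     src C f = src C g \<and> src C p = tgt C f \<and> src C q = tgt C g \<and> tgt C p = tgt C q \<and>
     cmp C p f = cmp C q g \<and>
     (\<forall>z \<in> obj C. \<forall>s \<in> hom C (tgt C f) z. \<forall>t \<in> hom C (tgt C g) z.
        cmp C s f = cmp C t g \<longrightarrow>
        (\<exists>!h. h \<in> hom C (tgt C p) z \<and> cmp C h p = s \<and> cmp C h q = t))"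

text \<open>The maps with the right lifting property with respect to every map in \<open>S\<close>.\<close>

definition rlp :: "('o, 'a, 'm) cat_scheme \<Rightarrow> 'a set \<Rightarrow> 'a set" where
  "rlp C S = {p \<in> arr C. \<forall>i \<in> S.
     \<forall>f \<in> hom C (src C i) (src C p). \<forall>g \<in> hom C (tgt C i) (tgt C p).
       cmp C p f = cmp C g i \<longrightarrow>
       (\<exists>h \<in> hom C (tgt C i) (src C p). cmp C h i = f \<and> cmp C p h = g)}"


section \<open>Transfinite sequences, cell complexes and small objects\<close>

text \<open>Ordinals are represented by well-orders \<open>r\<close> on subsets of a type \<open>'i\<close>, their elements by the
  elements of \<open>Field r\<close>.  A functor from such an ordinal is given by objects \<open>X b\<close> and by
  transition maps \<open>t b c\<close> from \<open>X b\<close> to \<open>X c\<close>, for \<open>(b, c) \<in> r\<close>.\<close>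

definition below :: "'i rel \<Rightarrow> 'i \<Rightarrow> 'i set" where
  "below r c = {b. (b, c) \<in> r \<and> b \<noteq> c}"

definition limit_index :: "'i rel \<Rightarrow> 'i \<Rightarrow> bool" where
  "limit_index r c \<longleftrightarrow> c \<in> Field r \<and> below r c \<noteq> {} \<and>
     (\<forall>b \<in> below r c. \<exists>b' \<in> below r c. b \<in> below r b')"

definition succ_index :: "'i rel \<Rightarrow> 'i \<Rightarrow> 'i \<Rightarrow> bool" where
  "succ_index r b c \<longleftrightarrow> b \<in> below r c \<and> (\<forall>b' \<in> below r c. (b', b) \<in> r)"

definition limit_ordinal :: "'i rel \<Rightarrow> bool" where
  "limit_ordinal r \<longleftrightarrow> Well_order r \<and> Field r \<noteq> {} \<and>
     (\<forall>b \<in> Field r. \<exists>c \<in> Field r. b \<in> below r c)"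

definition is_cocone ::
  "('o, 'a, 'm) cat_scheme \<Rightarrow> 'i rel \<Rightarrow> 'i set \<Rightarrow> ('i \<Rightarrow> 'o) \<Rightarrow> ('i \<Rightarrow> 'i \<Rightarrow> 'a) \<Rightarrow>
   'o \<Rightarrow> ('i \<Rightarrow> 'a) \<Rightarrow> bool" where
  "is_cocone C r B X t L m \<longleftrightarrow> L \<in> obj C \<and> (\<forall>b \<in> B. m b \<in> hom C (X b) L) \<and>
     (\<forall>b \<in> B. \<forall>c \<in> B. (b, c) \<in> r \<longrightarrow> cmp C (m c) (t b c) = m b)"

text \<open>\<open>(L, m)\<close> is the colimit of the restriction of \<open>(X, t)\<close> to the set \<open>B\<close> of indices.\<close>

definition is_colimit ::
  "('o, 'a, 'm) cat_scheme \<Rightarrow> 'i rel \<Rightarrow> 'i set \<Rightarrow> ('i \<Rightarrow> 'o) \<Rightarrow> ('i \<Rightarrow> 'i \<Rightarrow> 'a) \<Rightarrow>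
   'o \<Rightarrow> ('i \<Rightarrow> 'a) \<Rightarrow> bool" where
  "is_colimit C r B X t L m \<longleftrightarrow> is_cocone C r B X t L m \<and>
     (\<forall>M n. is_cocone C r B X t M n \<longrightarrow>
        (\<exists>!h. h \<in> hom C L M \<and> (\<forall>b \<in> B. cmp C h (m b) = n b)))"

text \<open>As usual, preservation of colimits is required at limit ordinals only
  (no condition is put on the value at \<open>0\<close>).\<close>

definition transfinite_sequence ::
  "('o, 'a, 'm) cat_scheme \<Rightarrow> 'i rel \<Rightarrow> ('i \<Rightarrow> 'o) \<Rightarrow> ('i \<Rightarrow> 'i \<Rightarrow> 'a) \<Rightarrow> bool" where
  "transfinite_sequence C r X t \<longleftrightarrow> Well_order r \<and>
     (\<forall>b \<in> Field r. X b \<in> obj C \<and> t b b = ide C (X b)) \<and>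
     (\<forall>b c. (b, c) \<in> r \<longrightarrow> t b c \<in> hom C (X b) (X c)) \<and>
     (\<forall>b c d. (b, c) \<in> r \<and> (c, d) \<in> r \<longrightarrow> cmp C (t c d) (t b c) = t b d) \<and>
     (\<forall>c. limit_index r c \<longrightarrow> is_colimit C r (below r c) X t (X c) (\<lambda>b. t b c))"

definition pushouts_of :: "('o, 'a, 'm) cat_scheme \<Rightarrow> 'a set \<Rightarrow> 'a set" where
  "pushouts_of C S = {q. \<exists>f \<in> S. \<exists>g p. is_pushout C f g p q}"

text \<open>Relative \<open>S\<close>-cell complexes: compositions \<open>X 0 \<rightarrow> colim X\<close> of transfinite sequences of pushouts
  of maps in \<open>S\<close>.  The type \<open>'i\<close> provides the ordinals that may occur as lengths.\<close>

definition cell :: "'i itself \<Rightarrow> ('o, 'a, 'm) cat_scheme \<Rightarrow> 'a set \<Rightarrow> 'a set" where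
  "cell _ C S = {f. \<exists>(r :: 'i rel) X t L m b0.
     transfinite_sequence C r X t \<and>
     (\<forall>b c. succ_index r b c \<longrightarrow> t b c \<in> pushouts_of C S) \<and>
     is_colimit C r (Field r) X t L m \<and>
     b0 \<in> Field r \<and> (\<forall>b \<in> Field r. (b0, b) \<in> r) \<and> f = m b0}"

text \<open>\<open>A \<subseteq> \<lambda>\<close> satisfies \<open>sup A < \<lambda>\<close> iff it is bounded in the limit ordinal \<open>\<lambda>\<close>.\<close>

definition filtered_ordinal :: "'i rel \<Rightarrow> 'i rel \<Rightarrow> bool" where
  "filtered_ordinal k r \<longleftrightarrow> limit_ordinal r \<and>
     (\<forall>A \<subseteq> Field r. (card_of A, k) \<in> ordLeq \<longrightarrow> (\<exists>b \<in> Field r. \<forall>a \<in> A. (a, b) \<in> r))"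

text \<open>The colimit of the sets \<open>hom C A (X b)\<close>, as a quotient of their disjoint union.\<close>

definition hom_colim_rel ::
  "('o, 'a, 'm) cat_scheme \<Rightarrow> 'o \<Rightarrow> 'i rel \<Rightarrow> ('i \<Rightarrow> 'o) \<Rightarrow> ('i \<Rightarrow> 'i \<Rightarrow> 'a) \<Rightarrow> ('i \<times> 'a) rel" where
  "hom_colim_rel C A r X t = {((b, f), (c, g)).
     b \<in> Field r \<and> f \<in> hom C A (X b) \<and> c \<in> Field r \<and> g \<in> hom C A (X c) \<and>
     (\<exists>d. (b, d) \<in> r \<and> (c, d) \<in> r \<and> cmp C (t b d) f = cmp C (t c d) g)}"

definition hom_colim ::
  "('o, 'a, 'm) cat_scheme \<Rightarrow> 'o \<Rightarrow> 'i rel \<Rightarrow> ('i \<Rightarrow> 'o) \<Rightarrow> ('i \<Rightarrow> 'i \<Rightarrow> 'a) \<Rightarrow> ('i \<times> 'a) set set" where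
  "hom_colim C A r X t = (SIGMA b : Field r. hom C A (X b)) // hom_colim_rel C A r X t"

definition hom_colim_map :: "('o, 'a, 'm) cat_scheme \<Rightarrow> ('i \<Rightarrow> 'a) \<Rightarrow> ('i \<times> 'a) set \<Rightarrow> 'a" where
  "hom_colim_map C m q = the_elem ((\<lambda>(b, f). cmp C (m b) f) ` q)"

definition k_small_rel ::
  "('o, 'a, 'm) cat_scheme \<Rightarrow> 'i rel \<Rightarrow> 'a set \<Rightarrow> 'o \<Rightarrow> bool" where
  "k_small_rel C k D A \<longleftrightarrow>
     (\<forall>(r :: 'i rel) X t L m.
        filtered_ordinal k r \<and> transfinite_sequence C r X t \<and>
        (\<forall>b c. succ_index r b c \<longrightarrow> t b c \<in> D) \<and>
        is_colimit C r (Field r) X t L m \<longrightarrow>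
        bij_betw (hom_colim_map C m) (hom_colim C A r X t) (hom C A L))"

text \<open>The cardinal must be strictly smaller than the type \<open>'i\<close> that provides the ordinals: then its
  cardinal successor is an ordinal available in \<open>'i\<close>, so that the smallness condition is not void.\<close>

definition small_rel :: "'i itself \<Rightarrow> ('o, 'a, 'm) cat_scheme \<Rightarrow> 'a set \<Rightarrow> 'o \<Rightarrow> bool" where
  "small_rel _ C D A \<longleftrightarrow>
     (\<exists>k :: 'i rel. Card_order k \<and> (k, card_of (UNIV :: 'i set)) \<in> ordLess \<and> k_small_rel C k D A)"


section \<open>Cofibrantly generated model structures\<close>

record 'a model_structure =
  weq :: "'a set"
  cof :: "'a set"
  fib :: "'a set"

text \<open>The recognition conditions of Hovey's definition; that the three classes do form a model
  structure on \<open>C\<close> is a presupposition there and is not part of this predicate.  The type \<open>'i\<close>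
  provides the ordinals.\<close>

definition cofibrantly_generated ::
  "'i itself \<Rightarrow> ('o, 'a, 'm) cat_scheme \<Rightarrow> 'a model_structure \<Rightarrow> 'a set \<Rightarrow> 'a set \<Rightarrow> bool" where
  "cofibrantly_generated T C M I J \<longleftrightarrow>
     I \<subseteq> arr C \<and> J \<subseteq> arr C \<and>
     (\<forall>i \<in> I. small_rel T C (cell T C I) (src C i)) \<and>
     (\<forall>j \<in> J. small_rel T C (cell T C J) (src C j)) \<and>
     fib M = rlp C J \<and>
     fib M \<inter> weq M = rlp C I"


section \<open>C*-categories\<close>

text \<open>The scalar field is a set \<open>K\<close> of complex numbers, to be instantiated with the reals or with all
  of \<open>UNIV\<close>; complex conjugation restricts to the identity on the reals.  Scalar multiplication is
  only meaningful for scalars in \<open>K\<close>.  \<open>zero A x y\<close> is the zero vector of \<open>hom A x y\<close>.\<close>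

record ('o, 'a) star_cat = "('o, 'a) cat" +
  zero :: "'o \<Rightarrow> 'o \<Rightarrow> 'a"
  add :: "'a \<Rightarrow> 'a \<Rightarrow> 'a"
  scale :: "complex \<Rightarrow> 'a \<Rightarrow> 'a"
  star :: "'a \<Rightarrow> 'a"
  nrm :: "'a \<Rightarrow> real"

definition sub :: "('o, 'a, 'm) star_cat_scheme \<Rightarrow> 'a \<Rightarrow> 'a \<Rightarrow> 'a" where
  "sub A a b = add A a (scale A (- 1) b)"

locale linear_category = category A
  for K :: "complex set" and A :: "('o, 'a, 'm) star_cat_scheme" +
  assumes zero_hom: "x \<in> obj A \<Longrightarrow> y \<in> obj A \<Longrightarrow> zero A x y \<in> hom A x y"
    and add_hom: "a \<in> hom A x y \<Longrightarrow> b \<in> hom A x y \<Longrightarrow> add A a b \<in> hom A x y"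
    and scale_hom: "k \<in> K \<Longrightarrow> a \<in> hom A x y \<Longrightarrow> scale A k a \<in> hom A x y"
    and add_assoc: "a \<in> hom A x y \<Longrightarrow> b \<in> hom A x y \<Longrightarrow> c \<in> hom A x y \<Longrightarrow>
      add A (add A a b) c = add A a (add A b c)"
    and add_comm: "a \<in> hom A x y \<Longrightarrow> b \<in> hom A x y \<Longrightarrow> add A a b = add A b a"
    and add_zero: "a \<in> hom A x y \<Longrightarrow> add A a (zero A x y) = a"
    and sub_self: "a \<in> hom A x y \<Longrightarrow> sub A a a = zero A x y"
    and scale_one: "a \<in> hom A x y \<Longrightarrow> scale A 1 a = a"
    and scale_scale: "k \<in> K \<Longrightarrow> l \<in> K \<Longrightarrow> a \<in> hom A x y \<Longrightarrow>
      scale A k (scale A l a) = scale A (k * l) a"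
    and scale_add: "k \<in> K \<Longrightarrow> a \<in> hom A x y \<Longrightarrow> b \<in> hom A x y \<Longrightarrow>
      scale A k (add A a b) = add A (scale A k a) (scale A k b)"
    and add_scale: "k \<in> K \<Longrightarrow> l \<in> K \<Longrightarrow> a \<in> hom A x y \<Longrightarrow>
      scale A (k + l) a = add A (scale A k a) (scale A l a)"
    and cmp_add_right: "a \<in> hom A x y \<Longrightarrow> a' \<in> hom A x y \<Longrightarrow> b \<in> hom A y z \<Longrightarrow>
      cmp A b (add A a a') = add A (cmp A b a) (cmp A b a')"
    and cmp_add_left: "a \<in> hom A x y \<Longrightarrow> b \<in> hom A y z \<Longrightarrow> b' \<in> hom A y z \<Longrightarrow>
      cmp A (add A b b') a = add A (cmp A b a) (cmp A b' a)"
    and cmp_scale_right: "l \<in> K \<Longrightarrow> a \<in> hom A x y \<Longrightarrow> b \<in> hom A y z \<Longrightarrow>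
      cmp A b (scale A l a) = scale A l (cmp A b a)"
    and cmp_scale_left: "l \<in> K \<Longrightarrow> a \<in> hom A x y \<Longrightarrow> b \<in> hom A y z \<Longrightarrow>
      cmp A (scale A l b) a = scale A l (cmp A b a)"

locale star_category = linear_category K A
  for K :: "complex set" and A :: "('o, 'a, 'm) star_cat_scheme" +
  assumes star_hom: "a \<in> hom A x y \<Longrightarrow> star A a \<in> hom A y x"
    and star_add: "a \<in> hom A x y \<Longrightarrow> b \<in> hom A x y \<Longrightarrow>
      star A (add A a b) = add A (star A a) (star A b)"
    and star_scale: "k \<in> K \<Longrightarrow> a \<in> hom A x y \<Longrightarrow> star A (scale A k a) = scale A (cnj k) (star A a)"
    and star_cmp: "a \<in> hom A x y \<Longrightarrow> b \<in> hom A y z \<Longrightarrow>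
      star A (cmp A b a) = cmp A (star A a) (star A b)"
    and star_star: "a \<in> hom A x y \<Longrightarrow> star A (star A a) = a"

definition spectrum :: "complex set \<Rightarrow> ('o, 'a, 'm) star_cat_scheme \<Rightarrow> 'o \<Rightarrow> 'a \<Rightarrow> complex set" where
  "spectrum K A x a = {z \<in> K. \<not> invertible_in A x (sub A a (scale A z (ide A x)))}"

locale cstar_category = star_category K A
  for K :: "complex set" and A :: "('o, 'a, 'm) star_cat_scheme" +
  assumes nrm_nonneg: "a \<in> hom A x y \<Longrightarrow> 0 \<le> nrm A a"
    and nrm_eq_0: "a \<in> hom A x y \<Longrightarrow> nrm A a = 0 \<longleftrightarrow> a = zero A x y"
    and nrm_triangle: "a \<in> hom A x y \<Longrightarrow> b \<in> hom A x y \<Longrightarrow> nrm A (add A a b) \<le> nrm A a + nrm A b"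
    and nrm_scale: "k \<in> K \<Longrightarrow> a \<in> hom A x y \<Longrightarrow> nrm A (scale A k a) = cmod k * nrm A a"
    and nrm_complete: "(\<And>n. s n \<in> hom A x y) \<Longrightarrow>
      (\<And>e. 0 < e \<Longrightarrow> \<exists>N. \<forall>m \<ge> N. \<forall>n \<ge> N. nrm A (sub A (s m) (s n)) < e) \<Longrightarrow>
      \<exists>l \<in> hom A x y. (\<lambda>n. nrm A (sub A (s n) l)) \<longlonglongrightarrow> 0"
    and nrm_cmp: "a \<in> hom A x y \<Longrightarrow> b \<in> hom A y z \<Longrightarrow> nrm A (cmp A b a) \<le> nrm A b * nrm A a"
    and cstar_identity: "a \<in> hom A x y \<Longrightarrow> nrm A (cmp A (star A a) a) = (nrm A a)\<^sup>2"
    and star_cmp_positive: "a \<in> hom A x y \<Longrightarrow>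
      spectrum K A x (cmp A (star A a) a) \<subseteq> complex_of_real ` {0..}"

definition unitary_arrow :: "('o, 'a, 'm) star_cat_scheme \<Rightarrow> 'a \<Rightarrow> bool" where
  "unitary_arrow A u \<longleftrightarrow> u \<in> arr A \<and>
     cmp A (star A u) u = ide A (src A u) \<and> cmp A u (star A u) = ide A (tgt A u)"


section \<open>The category of small C*-categories\<close>

text \<open>The type \<open>'u\<close> plays the role of the universe: a C*-category is small if its objects and its
  arrows are elements of \<open>'u\<close>.  The two maps underlying a *-functor are extensional
  (\<open>undefined\<close> off the objects and arrows of the source), so that equality of *-functors is
  equality in the logic.\<close>

type_synonym 'u small_star_cat = "('u, 'u) star_cat"

record 'u sfun =
  fsrc :: "'u small_star_cat"
  ftgt :: "'u small_star_cat"
  fob :: "'u \<Rightarrow> 'u"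
  far :: "'u \<Rightarrow> 'u"

locale star_functor =
  fixes K :: "complex set" and F :: "'u sfun"
  assumes fsrc_cstar: "cstar_category K (fsrc F)"
    and ftgt_cstar: "cstar_category K (ftgt F)"
    and fob_ext: "fob F \<in> obj (fsrc F) \<rightarrow>\<^sub>E obj (ftgt F)"
    and far_ext: "far F \<in> arr (fsrc F) \<rightarrow>\<^sub>E arr (ftgt F)"
    and far_hom: "a \<in> hom (fsrc F) x y \<Longrightarrow> far F a \<in> hom (ftgt F) (fob F x) (fob F y)"
    and far_ide: "x \<in> obj (fsrc F) \<Longrightarrow> far F (ide (fsrc F) x) = ide (ftgt F) (fob F x)"
    and far_cmp: "a \<in> hom (fsrc F) x y \<Longrightarrow> b \<in> hom (fsrc F) y z \<Longrightarrow>
      far F (cmp (fsrc F) b a) = cmp (ftgt F) (far F b) (far F a)"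
    and far_add: "a \<in> hom (fsrc F) x y \<Longrightarrow> b \<in> hom (fsrc F) x y \<Longrightarrow>
      far F (add (fsrc F) a b) = add (ftgt F) (far F a) (far F b)"
    and far_scale: "k \<in> K \<Longrightarrow> a \<in> hom (fsrc F) x y \<Longrightarrow>
      far F (scale (fsrc F) k a) = scale (ftgt F) k (far F a)"
    and far_star: "a \<in> hom (fsrc F) x y \<Longrightarrow> far F (star (fsrc F) a) = star (ftgt F) (far F a)"

definition sfun_id :: "'u small_star_cat \<Rightarrow> 'u sfun" where
  "sfun_id A = \<lparr>fsrc = A, ftgt = A, fob = (\<lambda>x \<in> obj A. x), far = (\<lambda>a \<in> arr A. a)\<rparr>"

definition sfun_comp :: "'u sfun \<Rightarrow> 'u sfun \<Rightarrow> 'u sfun" where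
  "sfun_comp G F = \<lparr>fsrc = fsrc F, ftgt = ftgt G,
     fob = compose (obj (fsrc F)) (fob G) (fob F), far = compose (arr (fsrc F)) (far G) (far F)\<rparr>"

definition C1cat :: "complex set \<Rightarrow> ('u small_star_cat, 'u sfun) cat" where
  "C1cat K = \<lparr>obj = {A. cstar_category K A}, arr = {F. star_functor K F},
     src = fsrc, tgt = ftgt, ide = sfun_id, cmp = sfun_comp\<rparr>"

lemma star_functor_id:
  assumes "cstar_category K A"
  shows "star_functor K (sfun_id A)"
proof -
  interpret cstar_category K A by fact
  have arr: "a \<in> arr A" if "a \<in> hom A x y" for a x y
    using that by (simp add: hom_def)
  have obj: "x \<in> obj A" "y \<in> obj A" if "a \<in> hom A x y" for a x y
    using that src_obj tgt_obj by (auto simp: hom_def)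
  show ?thesis
    by (rule star_functor.intro)
      (auto simp: sfun_id_def arr obj arr[OF ide_hom] arr[OF cmp_hom] arr[OF add_hom]
        arr[OF scale_hom] arr[OF star_hom] ide_hom assms)
qed

lemma star_functor_comp:
  assumes F: "star_functor K F" and G: "star_functor K G" and FG: "fsrc G = ftgt F"
  shows "star_functor K (sfun_comp G F)"
proof -
  interpret F: star_functor K F by fact
  interpret G: star_functor K G by fact
  interpret A: cstar_category K "fsrc F" by (rule F.fsrc_cstar)
  have arr: "a \<in> arr (fsrc F)" if "a \<in> hom (fsrc F) x y" for a x y
    using that by (simp add: hom_def)
  have obj: "x \<in> obj (fsrc F)" "y \<in> obj (fsrc F)" if "a \<in> hom (fsrc F) x y" for a x y
    using that A.src_obj A.tgt_obj by (auto simp: hom_def)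
  have fob: "fob F x \<in> obj (fsrc G)" if "x \<in> obj (fsrc F)" for x
    using F.fob_ext that by (auto simp: FG)
  have far: "far F a \<in> arr (fsrc G)" if "a \<in> arr (fsrc F)" for a
    using F.far_ext that by (auto simp: FG)
  note Fhom = F.far_hom[folded FG]
  show ?thesis
  proof (rule star_functor.intro)
    show "fob (sfun_comp G F) \<in> obj (fsrc (sfun_comp G F)) \<rightarrow>\<^sub>E obj (ftgt (sfun_comp G F))"
      using G.fob_ext fob by (auto simp: sfun_comp_def compose_def PiE_def)
    show "far (sfun_comp G F) \<in> arr (fsrc (sfun_comp G F)) \<rightarrow>\<^sub>E arr (ftgt (sfun_comp G F))"
      using G.far_ext far by (auto simp: sfun_comp_def compose_def PiE_def)
  qed (auto simp: sfun_comp_def compose_def arr obj fob far A.ide_hom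
      arr[OF A.ide_hom] arr[OF A.cmp_hom] arr[OF A.add_hom] arr[OF A.scale_hom] arr[OF A.star_hom]
      F.fsrc_cstar G.ftgt_cstar F.far_ide[folded FG] G.far_ide
      F.far_cmp[folded FG] F.far_add[folded FG] F.far_scale[folded FG] F.far_star[folded FG]
      intro: G.far_hom Fhom G.far_cmp[OF Fhom Fhom] G.far_add[OF Fhom Fhom]
        G.far_scale[OF _ Fhom] G.far_star[OF Fhom])
qed

lemma category_C1cat: "category (C1cat K)"
proof
  fix F :: "'u sfun" and A B
  assume F: "F \<in> hom (C1cat K) A B"
  then have "star_functor K F" and "fsrc F = A" and "ftgt F = B"
    by (auto simp: hom_def C1cat_def)
  then interpret star_functor K F by simp
  have ext: "fob F \<in> extensional (obj (fsrc F))" "far F \<in> extensional (arr (fsrc F))"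
    using fob_ext far_ext by (auto simp: PiE_def)
  have mem: "fob F x \<in> obj (ftgt F)" if "x \<in> obj (fsrc F)" for x
    using fob_ext that by auto
  have mem': "far F a \<in> arr (ftgt F)" if "a \<in> arr (fsrc F)" for a
    using far_ext that by auto
  have "sfun_comp F (sfun_id (fsrc F)) = F"
    unfolding sfun_comp_def sfun_id_def
    by (rule sfun.equality) (auto simp: compose_def intro!: extensionalityI[OF _ ext(1)] extensionalityI[OF _ ext(2)])
  then show "cmp (C1cat K) F (ide (C1cat K) A) = F"
    using \<open>fsrc F = A\<close> by (simp add: C1cat_def)
  have "sfun_comp (sfun_id (ftgt F)) F = F"
    unfolding sfun_comp_def sfun_id_def
    by (rule sfun.equality) (auto simp: compose_def mem mem' intro!: extensionalityI[OF _ ext(1)] extensionalityI[OF _ ext(2)])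
  then show "cmp (C1cat K) (ide (C1cat K) B) F = F"
    using \<open>ftgt F = B\<close> by (simp add: C1cat_def)
next
  fix F G H :: "'u sfun" and A B D E
  assume "F \<in> hom (C1cat K) A B" "G \<in> hom (C1cat K) B D" "H \<in> hom (C1cat K) D E"
  then have F: "star_functor K F" "fsrc G = ftgt F"
    by (auto simp: hom_def C1cat_def)
  interpret star_functor K F by (rule F(1))
  have "fob F x \<in> obj (fsrc G)" if "x \<in> obj (fsrc F)" for x
    using fob_ext that F(2) by auto
  moreover have "far F a \<in> arr (fsrc G)" if "a \<in> arr (fsrc F)" for a
    using far_ext that F(2) by auto
  ultimately show "cmp (C1cat K) H (cmp (C1cat K) G F) = cmp (C1cat K) (cmp (C1cat K) H G) F"
    by (auto simp: C1cat_def sfun_comp_def compose_def fun_eq_iff restrict_def)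
qed (auto simp: C1cat_def hom_def star_functor.fsrc_cstar star_functor.ftgt_cstar star_functor_id
    star_functor_comp sfun_id_def[THEN arg_cong[where f=fsrc]] sfun_id_def[THEN arg_cong[where f=ftgt]]
    sfun_comp_def[THEN arg_cong[where f=fsrc]] sfun_comp_def[THEN arg_cong[where f=ftgt]])


section \<open>The unitary model structure\<close>

definition unitary_nat_iso :: "'u sfun \<Rightarrow> 'u sfun \<Rightarrow> bool" where
  "unitary_nat_iso F G \<longleftrightarrow> (\<exists>\<eta>.
     (\<forall>x \<in> obj (fsrc F). \<eta> x \<in> hom (ftgt F) (fob F x) (fob G x) \<and> unitary_arrow (ftgt F) (\<eta> x)) \<and>
     (\<forall>x y. \<forall>a \<in> hom (fsrc F) x y. cmp (ftgt F) (\<eta> y) (far F a) = cmp (ftgt F) (far G a) (\<eta> x)))"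

definition unitary_equivalence :: "complex set \<Rightarrow> 'u sfun \<Rightarrow> bool" where
  "unitary_equivalence K F \<longleftrightarrow> star_functor K F \<and>
     (\<exists>G. star_functor K G \<and> fsrc G = ftgt F \<and> ftgt G = fsrc F \<and>
        unitary_nat_iso (sfun_comp G F) (sfun_id (fsrc F)) \<and>
        unitary_nat_iso (sfun_comp F G) (sfun_id (ftgt F)))"

definition unitary_fibration :: "complex set \<Rightarrow> 'u sfun \<Rightarrow> bool" where
  "unitary_fibration K F \<longleftrightarrow> star_functor K F \<and>
     (\<forall>x \<in> obj (fsrc F). \<forall>y \<in> obj (ftgt F). \<forall>v \<in> hom (ftgt F) (fob F x) y.
        unitary_arrow (ftgt F) v \<longrightarrow>
        (\<exists>x' \<in> obj (fsrc F). \<exists>u \<in> hom (fsrc F) x x'. unitary_arrow (fsrc F) u \<and> far F u = v))"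

definition unitary_model_structure :: "complex set \<Rightarrow> 'u sfun model_structure" where
  "unitary_model_structure K = \<lparr>
     weq = {F. unitary_equivalence K F},
     cof = {F. star_functor K F \<and> inj_on (fob F) (obj (fsrc F))},
     fib = {F. unitary_fibration K F}\<rparr>"


section \<open>The C*-categories occurring in the generating maps\<close>

text \<open>These are determined up to isomorphism, within the universe \<open>'u\<close>.  A *-functor is determined
  on objects by its action on arrows, so the universal properties mention arrows only.\<close>

text \<open>\<open>A\<close> has one object \<open>p\<close>, and its endomorphism algebra is the C*-algebra \<open>K\<close> of scalars.\<close>

definition is_scalar_cat :: "complex set \<Rightarrow> 'u small_star_cat \<Rightarrow> 'u \<Rightarrow> bool" where
  "is_scalar_cat K A p \<longleftrightarrow> cstar_category K A \<and> obj A = {p} \<and>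
     (\<exists>\<theta>. bij_betw \<theta> K (hom A p p) \<and> \<theta> 1 = ide A p \<and>
        (\<forall>z \<in> K. \<forall>w \<in> K. \<theta> (z * w) = cmp A (\<theta> z) (\<theta> w) \<and>
           \<theta> (z + w) = add A (\<theta> z) (\<theta> w) \<and> \<theta> (z * w) = scale A z (\<theta> w)) \<and>
        (\<forall>z \<in> K. \<theta> (cnj z) = star A (\<theta> z) \<and> nrm A (\<theta> z) = cmod z))"

definition universal_contraction ::
  "complex set \<Rightarrow> 'u small_star_cat \<Rightarrow> 'u \<Rightarrow> 'u \<Rightarrow> 'u \<Rightarrow> bool" where
  "universal_contraction K A x y a \<longleftrightarrow> cstar_category K A \<and>
     obj A = {x, y} \<and> x \<noteq> y \<and> a \<in> hom A x y \<and> nrm A a \<le> 1 \<and>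
     (\<forall>B. cstar_category K B \<longrightarrow> (\<forall>b \<in> arr B. nrm B b \<le> 1 \<longrightarrow>
        (\<exists>!F. F \<in> hom (C1cat K) A B \<and> far F a = b)))"

definition universal_unitary ::
  "complex set \<Rightarrow> 'u small_star_cat \<Rightarrow> 'u \<Rightarrow> 'u \<Rightarrow> 'u \<Rightarrow> bool" where
  "universal_unitary K A x y u \<longleftrightarrow> cstar_category K A \<and>
     obj A = {x, y} \<and> x \<noteq> y \<and> u \<in> hom A x y \<and> unitary_arrow A u \<and>
     (\<forall>B. cstar_category K B \<longrightarrow> (\<forall>v. unitary_arrow B v \<longrightarrow>
        (\<exists>!F. F \<in> hom (C1cat K) A B \<and> far F u = v)))"

end

theory Submission
  imports Defs "HOL-Computational_Algebra.Polynomial" "HOL-Library.Nat_Bijection"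
begin

text \<open>The maps with the right lifting property with respect to \<open>Z\<close> are the fibrations by the universal
  property of the interval.  Both the trivial fibrations and the maps with the right lifting property
  with respect to \<open>U\<close>, \<open>V\<close>, \<open>W\<close> are the *-functors that are surjective on objects, full and faithful:
  after rescaling, \<open>V\<close> tests fullness and \<open>W\<close> tests faithfulness.

  The domains are small relative to all maps, for colimits of sequences in which countable sets of
  indices are bounded.  Since *-functors are contractive, norms decrease along such a sequence and
  are eventually constant.  So the algebraic colimit is already complete, and finitely many arrows,
  together with bounds on their norms and equations between them, come from some stage.

  Contractivity is derived, for both fields at once, from the positivity of \<open>a\<^sup>* a\<close> and a substitute
  for the spectral radius formula that uses real scalars only.\<close>


section \<open>Polynomials of an endomorphism\<close>

text \<open>Contractivity comes down to one claim: if \<open>y\<close> is self-adjoint of norm 1,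
  then \<open>1 - s y\<close> fails to be invertible for some real \<open>s\<close> in
  \<open>[-1, 1]\<close>. Over the complex numbers, resolvents at points \<open>w\<close> of the
  unit circle would be averaged over roots of unity. With real scalars only the product
  \<open>1 - 2 c y + y^2\<close> of \<open>1 - w y\<close> and \<open>1 - cnj w y\<close> is
  available, \<open>c\<close> being the real part of \<open>w\<close>; averaging becomes repeated
  doubling of the angle, and the functions averaged are Poisson kernels. A colimit \<open>L\<close>
  is given by its universal property among categories carried by \<open>'u\<close> only. So a
  colimit has to be built inside \<open>'u\<close>, which is why pairs must be coded in
  \<open>'u\<close>, and \<open>L\<close> is compared with it: it is a retract of the construction,
  compatibly with the maps from the stages. Countable bounds are what single sequences require: one
  that approximates an infimum of norms, or a Cauchy sequence, is realised at one stage. Injecting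
  sequences into \<open>'u\<close> makes \<open>'u\<close> uncountable, so that a countably infinite
  cardinal qualifies for smallness.\<close>

context linear_category
begin

lemma hom_obj:
  assumes "a \<in> hom A x y" shows "x \<in> obj A" "y \<in> obj A"
  using assms src_obj tgt_obj by (auto simp: hom_def)

lemma hom_arr: "a \<in> hom A x y \<Longrightarrow> a \<in> arr A"
  by (simp add: hom_def)

lemma arr_hom: "a \<in> arr A \<Longrightarrow> a \<in> hom A (src A a) (tgt A a)"
  by (simp add: hom_def)

lemma zero_add: "a \<in> hom A x y \<Longrightarrow> add A (zero A x y) a = a"
  using add_comm add_zero zero_hom hom_obj by metis

end

text \<open>Asking for the real scalars alone treats both fields at once. In particular
  \<open>-1\<close> lies in \<open>K\<close>, which makes \<open>sub\<close> an operation on Hom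
  spaces.\<close>

locale real_linear_category = linear_category K A
  for K :: "complex set" and A :: "('o, 'a, 'm) star_cat_scheme" +
  assumes reals: "\<real> \<subseteq> K"
begin

lemma of_real_K [simp]: "complex_of_real r \<in> K"
  using reals by auto

lemma numeral_K [simp]: "- 1 \<in> K" "0 \<in> K" "1 \<in> K"
  using of_real_K[of "-1"] of_real_K[of 0] of_real_K[of 1] by simp_all

lemma sub_hom: "a \<in> hom A x y \<Longrightarrow> b \<in> hom A x y \<Longrightarrow> sub A a b \<in> hom A x y"
  by (simp add: sub_def add_hom scale_hom)

lemma sub_add_cancel:
  assumes a: "a \<in> hom A x y" and b: "b \<in> hom A x y"
  shows "add A (sub A a b) b = a" "sub A (add A a b) b = a"
proof -
  have nb: "scale A (- 1) b \<in> hom A x y" using b scale_hom by simp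
  have 1: "add A b (scale A (- 1) b) = zero A x y" using sub_self[OF b] by (simp add: sub_def)
  have "add A (add A a (scale A (- 1) b)) b = add A a (add A (scale A (- 1) b) b)"
    by (rule add_assoc[OF a nb b])
  then show "add A (sub A a b) b = a"
    using 1 add_comm[OF b nb] add_zero[OF a] by (simp add: sub_def)
  have "add A (add A a b) (scale A (- 1) b) = add A a (add A b (scale A (- 1) b))"
    by (rule add_assoc[OF a b nb])
  then show "sub A (add A a b) b = a"
    using 1 add_zero[OF a] by (simp add: sub_def)
qed

text \<open>Source of the zero laws below: bilinearity shows that composites with zero, and
  multiples of or by zero, are additive idempotents.\<close>

lemma idem_zero: "a \<in> hom A x y \<Longrightarrow> add A a a = a \<Longrightarrow> a = zero A x y"
  by (metis sub_add_cancel(2) sub_self)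

lemma sub_eq_zero:
  assumes "a \<in> hom A x y" "b \<in> hom A x y" "sub A a b = zero A x y" shows "a = b"
  by (metis assms sub_add_cancel(1) zero_add)

lemma cmp_zero: "b \<in> hom A y z \<Longrightarrow> x \<in> obj A \<Longrightarrow> cmp A b (zero A x y) = zero A x z"
proof -
  assume b: "b \<in> hom A y z" and x: "x \<in> obj A"
  have z: "zero A x y \<in> hom A x y" using zero_hom x hom_obj[OF b] by simp
  have "add A (cmp A b (zero A x y)) (cmp A b (zero A x y)) = cmp A b (zero A x y)"
    using cmp_add_right[OF z z b] add_zero[OF z] by simp
  then show ?thesis using idem_zero[OF cmp_hom[OF z b]] by simp
qed

lemma zero_cmp: "a \<in> hom A x y \<Longrightarrow> z \<in> obj A \<Longrightarrow> cmp A (zero A y z) a = zero A x z"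
proof -
  assume a: "a \<in> hom A x y" and x: "z \<in> obj A"
  have z: "zero A y z \<in> hom A y z" using zero_hom x hom_obj[OF a] by simp
  have "add A (cmp A (zero A y z) a) (cmp A (zero A y z) a) = cmp A (zero A y z) a"
    using cmp_add_left[OF a z z] add_zero[OF z] by simp
  then show ?thesis using idem_zero[OF cmp_hom[OF a z]] by simp
qed

lemma scale_zero: "k \<in> K \<Longrightarrow> x \<in> obj A \<Longrightarrow> y \<in> obj A \<Longrightarrow> scale A k (zero A x y) = zero A x y"
  using scale_add[OF _ zero_hom zero_hom] idem_zero scale_hom zero_hom add_zero by metis

lemma scale_0: "a \<in> hom A x y \<Longrightarrow> scale A 0 a = zero A x y"
  using add_scale[of 0 0 a x y] idem_zero scale_hom by simp

lemma add_add_swap: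
  assumes "a \<in> hom A x y" "b \<in> hom A x y" "c \<in> hom A x y" "d \<in> hom A x y"
  shows "add A (add A a b) (add A c d) = add A (add A a c) (add A b d)"
proof -
  have "add A (add A a b) (add A c d) = add A a (add A (add A b c) d)"
    using assms by (simp add: add_assoc[of _ x y] add_hom)
  also have "\<dots> = add A a (add A (add A c b) d)"
    using add_comm[OF assms(2,3)] by simp
  also have "\<dots> = add A (add A a c) (add A b d)"
    using assms by (simp add: add_assoc[of _ x y] add_hom)
  finally show ?thesis .
qed

lemma sub_sub_swap:
  assumes "a \<in> hom A x y" "b \<in> hom A x y" "c \<in> hom A x y"
  shows "sub A (sub A a b) c = sub A (sub A a c) b"
proof -
  have "scale A (- 1) b \<in> hom A x y" "scale A (- 1) c \<in> hom A x y"
    using assms scale_hom by simp_all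
  then show ?thesis
    using assms(1) add_comm[of "scale A (- 1) b" x y "scale A (- 1) c"]
    by (simp add: sub_def add_assoc[of _ x y])
qed

lemma sub_cmp:
  assumes "a \<in> hom A x y" "b \<in> hom A y z" "b' \<in> hom A y z"
  shows "cmp A (sub A b b') a = sub A (cmp A b a) (cmp A b' a)"
  using assms by (simp add: sub_def cmp_add_left scale_hom cmp_scale_left[of _ _ x y _ z])

lemma cmp_sub:
  assumes "a \<in> hom A x y" "a' \<in> hom A x y" "b \<in> hom A y z"
  shows "cmp A b (sub A a a') = sub A (cmp A b a) (cmp A b a')"
  using assms by (simp add: sub_def cmp_add_right scale_hom cmp_scale_right[of _ _ x y _ z])

text \<open>Horner evaluation. It will be a ring homomorphism from a commutative ring, so identities
  between elements built from a single \<open>h\<close> can be proved as identities of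
  polynomials.\<close>

definition ev :: "'o \<Rightarrow> 'a \<Rightarrow> real poly \<Rightarrow> 'a" where
  "ev x h p = foldr (\<lambda>k b. add A (scale A (of_real k) (ide A x)) (cmp A h b)) (coeffs p) (zero A x x)"

context
  fixes x h
  assumes h: "h \<in> hom A x x"
begin

lemma ob: "x \<in> obj A" using hom_obj[OF h] by simp

lemma one: "ide A x \<in> hom A x x" using ide_hom ob by simp

lemma ev_0: "ev x h 0 = zero A x x"
  by (simp add: ev_def)

lemma ev_pCons: "ev x h (pCons k p) = add A (scale A (of_real k) (ide A x)) (cmp A h (ev x h p))"
\<comment> \<open>Exceptional case: prepending the coefficient 0 to the zero polynomial leaves the
  list of coefficients empty.\<close>
proof (cases "p = 0 \<and> k = 0")
  case True
  then show ?thesis using cmp_zero[OF h ob] scale_0[OF one] add_zero[OF zero_hom[OF ob ob]]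
    by (simp add: ev_def)
next
  case False
  then show ?thesis by (auto simp: ev_def cCons_def)
qed

lemma ev_hom: "ev x h p \<in> hom A x x"
  by (induct p) (auto simp: ev_0 ev_pCons zero_hom ob intro!: add_hom scale_hom one cmp_hom[OF _ h])

lemma ev_const: "ev x h [:k:] = scale A (of_real k) (ide A x)"
  using cmp_zero[OF h ob] add_zero[OF scale_hom[OF _ one]] by (simp add: ev_pCons ev_0)

lemma ev_1: "ev x h 1 = ide A x"
  using ev_const[of 1] scale_one[OF one] by (simp add: one_pCons)

lemma ev_add: "ev x h (p + q) = add A (ev x h p) (ev x h q)"
proof (induct p q rule: poly_induct2)
  case 0
  then show ?case using add_zero[OF zero_hom[OF ob ob]] by (simp add: ev_0)
next
  case (pCons a p b q)
  then show ?case
    by (simp add: ev_pCons add_scale[OF _ _ one] cmp_add_right[OF ev_hom ev_hom h]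
        add_add_swap[OF scale_hom[OF _ one] scale_hom[OF _ one] cmp_hom[OF ev_hom h]
          cmp_hom[OF ev_hom h]])
qed

lemma ev_smult: "ev x h (smult k p) = scale A (of_real k) (ev x h p)"
proof (induct p)
  case 0
  then show ?case using scale_zero[OF _ ob ob] by (simp add: ev_0)
next
  case (pCons a p)
  then show ?case
    by (simp add: ev_pCons scale_add[OF _ scale_hom[OF _ one] cmp_hom[OF ev_hom h]]
        scale_scale[OF _ _ one] cmp_scale_right[OF _ ev_hom h])
qed

lemma ev_X: "ev x h (pCons 0 p) = cmp A h (ev x h p)"
  using zero_add[OF cmp_hom[OF ev_hom h]] by (simp add: ev_pCons scale_0[OF one])

lemma ev_mult: "ev x h (p * q) = cmp A (ev x h p) (ev x h q)"
proof (induct p)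
  case 0
  then show ?case using zero_cmp[OF ev_hom ob] by (simp add: ev_0)
next
  case (pCons a p)
  have "ev x h (pCons a p * q) = add A (scale A (of_real a) (ev x h q))
    (cmp A h (cmp A (ev x h p) (ev x h q)))"
    by (simp add: ev_add ev_smult ev_X pCons)
  moreover have "cmp A h (cmp A (ev x h p) (ev x h q)) = cmp A (cmp A h (ev x h p)) (ev x h q)"
    by (rule cmp_assoc[OF ev_hom ev_hom h])
  moreover have "scale A (of_real a) (ev x h q) = cmp A (scale A (of_real a) (ide A x)) (ev x h q)"
    using cmp_scale_left[OF _ ev_hom one] ide_cmp[OF ev_hom] by simp
  ultimately show ?case
    by (simp add: ev_pCons cmp_add_left[OF ev_hom scale_hom[OF _ one] cmp_hom[OF ev_hom h]])
qed

lemma ev_diff: "ev x h (p - q) = sub A (ev x h p) (ev x h q)"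
  using ev_add[of p "smult (-1) q"] ev_smult[of "-1" q] by (simp add: sub_def)

lemma ev_id: "ev x h [:0, 1:] = h"
  by (simp add: ev_X ev_1[unfolded one_pCons] cmp_ide[OF h])

end

lemma ev_linear:
  assumes h: "h \<in> hom A x x"
  shows "ev x h [:1, -s:] = sub A (ide A x) (scale A (of_real s) h)"
proof -
  have "[:1, -s:] = 1 - smult s [:0, 1:]" by (simp add: one_pCons)
  then show ?thesis by (simp only: ev_diff[OF h] ev_1[OF h] ev_smult[OF h] ev_id[OF h])
qed

end


section \<open>Contractivity of *-functors\<close>

locale real_cstar_category = cstar_category K A + real_linear_category K A
  for K :: "complex set" and A :: "('o, 'a, 'm) star_cat_scheme"
begin

section \<open>Norm estimates and the Neumann series\<close>

lemma nrm_sub: "a \<in> hom A x y \<Longrightarrow> b \<in> hom A x y \<Longrightarrow> nrm A (sub A a b) \<le> nrm A a + nrm A b"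
  using nrm_triangle[of a x y "scale A (-1) b"] nrm_scale[of "-1" b x y] scale_hom[of "-1" b x y]
  by (simp add: sub_def)

lemma nrm_zero: "x \<in> obj A \<Longrightarrow> y \<in> obj A \<Longrightarrow> nrm A (zero A x y) = 0"
  using nrm_eq_0 zero_hom by blast

lemma nrm_add_ge: "a \<in> hom A x y \<Longrightarrow> b \<in> hom A x y \<Longrightarrow> nrm A a \<le> nrm A (add A a b) + nrm A b"
  using nrm_sub[of "add A a b" x y b] sub_add_cancel(2)[of a x y b] add_hom by simp

lemma star_ide:
  assumes "x \<in> obj A" shows "star A (ide A x) = ide A x"
proof -
  have i: "ide A x \<in> hom A x x" using ide_hom assms .
  show ?thesis
    using star_cmp[OF i star_hom[OF i]] cmp_ide ide_cmp star_star i star_hom[OF i] by metis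
qed

text \<open>By the C*-identity this norm equals its own square, hence is 0 or 1; the value 0 occurs
  at zero objects.\<close>

lemma nrm_ide: assumes "x \<in> obj A" shows "nrm A (ide A x) \<le> 1"
proof -
  have i: "ide A x \<in> hom A x x" using ide_hom assms .
  have "nrm A (ide A x) = (nrm A (ide A x))\<^sup>2"
    using cstar_identity[OF i] cmp_ide[OF i] star_ide[OF assms] by simp
  then show ?thesis by (auto simp: power2_eq_square)
qed

text \<open>When \<open>nrm A h = 1\<close>, the bound is the sum of the absolute values of the
  coefficients; this is how explicit polynomials are estimated later.\<close>

lemma nrm_ev_le:
  assumes h: "h \<in> hom A x x"
  shows "nrm A (ev x h p) \<le> poly (map_poly abs p) (nrm A h)"
proof (induct p)
  case 0
  then show ?case using nrm_zero ob[OF h] by (simp add: ev_0[OF h])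
next
  case (pCons a p)
  note E = ev_hom[OF h, of p]
  have "nrm A (ev x h (pCons a p)) \<le> \<bar>a\<bar> * nrm A (ide A x) + nrm A (cmp A h (ev x h p))"
    using nrm_triangle[OF scale_hom[OF _ one[OF h]] cmp_hom[OF E h], of "of_real a"]
      nrm_scale[OF _ one[OF h], of "of_real a"] by (simp add: ev_pCons[OF h])
  also have "\<dots> \<le> \<bar>a\<bar> * 1 + nrm A h * nrm A (ev x h p)"
    by (intro add_mono mult_left_mono nrm_ide ob[OF h] nrm_cmp[OF E h]) auto
  also have "\<dots> \<le> \<bar>a\<bar> * 1 + nrm A h * poly (map_poly abs p) (nrm A h)"
    by (intro add_mono mult_left_mono pCons nrm_nonneg[OF h]) auto
  finally show ?case using pCons by (simp add: map_poly_pCons)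
qed

text \<open>Neumann series. The partial sums are polynomials in \<open>h\<close>, so the telescoping
  identity \<open>(1 - X) q n = 1 - X^n\<close> can be used on either side before passing to the
  limit.\<close>

lemma invertible_one_minus:
  assumes h: "h \<in> hom A x x" and less: "nrm A h < 1"
  shows "invertible_in A x (ev x h [:1, -1:])"
proof -
  define q where "q n = (\<Sum>k<n. monom (1::real) k)" for n
  define s where "s n = ev x h (q n)" for n
  have q: "[:1, -1:] * q n = 1 - monom 1 n" for n
    by (induct n) (simp_all add: q_def algebra_simps monom_Suc)
  have sh: "s n \<in> hom A x x" for n by (simp add: s_def ev_hom[OF h])
  have N0: "0 \<le> nrm A h" using nrm_nonneg[OF h] .
  have am: "map_poly abs (monom c n) = monom \<bar>c\<bar> n" for c :: real and n
    by (simp add: map_poly_monom)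
  have ns: "nrm A (ev x h (\<Sum>k\<in>S. monom 1 k)) \<le> (\<Sum>k\<in>S. nrm A h ^ k)" if "finite S" for S
    using that
  proof induct
    case empty
    then show ?case using nrm_zero ob[OF h] by (simp add: ev_0[OF h])
  next
    case (insert k S)
    have "nrm A (ev x h (monom 1 k)) \<le> nrm A h ^ k"
      using nrm_ev_le[OF h, of "monom 1 k"] by (simp add: am poly_monom)
    then show ?case
      using insert nrm_triangle[OF ev_hom[OF h] ev_hom[OF h], of "monom 1 k" "\<Sum>k\<in>S. monom 1 k"]
      by (simp add: ev_add[OF h])
  qed
  have summ: "summable (\<lambda>k. nrm A h ^ k)" using less N0 by (simp add: summable_geometric)
  have tail: "nrm A (sub A (s n) (s m)) \<le> (\<Sum>k\<in>{m..<n}. nrm A h ^ k)" if "m \<le> n" for m n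
  proof -
    have "q n - q m = (\<Sum>k\<in>{m..<n}. monom 1 k)"
      using sum_diff_nat_ivl[of 0 m n "monom (1::real)"] that by (simp add: q_def lessThan_atLeast0)
    then show ?thesis using ns[of "{m..<n}"] by (simp add: s_def flip: ev_diff[OF h])
  qed
  \<comment> \<open>\<open>tail\<close> treats ordered pairs of indices; the Cauchy condition asks
    for both orders.\<close>
  have sym: "nrm A (sub A (s m) (s n)) = nrm A (sub A (s n) (s m))" for m n
  proof -
    have "sub A (s m) (s n) = scale A (of_real (-1)) (sub A (s n) (s m))"
      by (simp add: s_def flip: ev_diff[OF h] ev_smult[OF h] of_real_minus)
    then show ?thesis using nrm_scale[OF of_real_K sub_hom[OF sh sh], of "-1" n m] by simp
  qed
  have "\<exists>l \<in> hom A x x. (\<lambda>n. nrm A (sub A (s n) l)) \<longlonglongrightarrow> 0"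
  proof (rule nrm_complete)
    fix e :: real assume "0 < e"
    then obtain N where N: "\<And>m n. m \<ge> N \<Longrightarrow> norm (\<Sum>k\<in>{m..<n}. nrm A h ^ k) < e"
      using summ unfolding summable_Cauchy by blast
    have "nrm A (sub A (s m) (s n)) < e" if "m \<ge> N" "n \<ge> N" for m n
      using tail[of m n] tail[of n m] N[OF that(1), of n] N[OF that(2), of m] sym[of m n]
      by (cases "m \<le> n") auto
    then show "\<exists>N. \<forall>m \<ge> N. \<forall>n \<ge> N. nrm A (sub A (s m) (s n)) < e" by blast
  qed (rule sh)
  then obtain l where l: "l \<in> hom A x x" and lim: "(\<lambda>n. nrm A (sub A (s n) l)) \<longlonglongrightarrow> 0" by blast
  let ?u = "ev x h [:1, -1:]"
  have u: "?u \<in> hom A x x" by (rule ev_hom[OF h])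
  have lim0: "(\<lambda>n. nrm A (sub A (s n) l) * nrm A ?u + nrm A h ^ n) \<longlonglongrightarrow> 0"
    using tendsto_add[OF tendsto_mult_left_zero[OF lim] LIMSEQ_realpow_zero[OF N0 less]] by simp
  \<comment> \<open>To be applied with \<open>v\<close> the product of \<open>?u\<close> and
    \<open>l\<close> in either order: \<open>v\<close> is compared with \<open>1 - h^n\<close>, and
    both error terms tend to 0.\<close>
  have key: "v = ide A x" if v: "v \<in> hom A x x"
    and le: "\<And>n. nrm A (sub A (ev x h (1 - monom 1 n)) v) \<le> nrm A (sub A (s n) l) * nrm A ?u" for v
  proof -
    have "nrm A (sub A (ide A x) v) \<le> nrm A (sub A (s n) l) * nrm A ?u + nrm A h ^ n" for n
    proof -
      let ?m = "ev x h (monom 1 n)"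
      have m: "?m \<in> hom A x x" by (rule ev_hom[OF h])
      have i: "ide A x \<in> hom A x x" by (rule one[OF h])
      have nm: "nrm A ?m \<le> nrm A h ^ n"
        using nrm_ev_le[OF h, of "monom 1 n"] by (simp add: am poly_monom)
      have "sub A (ev x h (1 - monom 1 n)) v = sub A (sub A (ide A x) ?m) v"
        by (simp add: ev_diff[OF h] ev_1[OF h])
      also have "\<dots> = sub A (sub A (ide A x) v) ?m"
        by (rule sub_sub_swap[OF i m v])
      finally have "add A (sub A (ev x h (1 - monom 1 n)) v) ?m = sub A (ide A x) v"
        using sub_add_cancel(1)[OF sub_hom[OF i v] m] by simp
      then show ?thesis
        using nrm_triangle[OF sub_hom[OF ev_hom[OF h] v] m, of "1 - monom 1 n"] nm le[of n] by simp
    qed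
    then have "nrm A (sub A (ide A x) v) \<le> 0"
      using LIMSEQ_le_const[OF lim0] by blast
    then have "sub A (ide A x) v = zero A x x"
      using nrm_eq_0[OF sub_hom[OF one[OF h] v]] nrm_nonneg[OF sub_hom[OF one[OF h] v]] by linarith
    then show "v = ide A x"
      using sub_eq_zero[OF one[OF h] v] by simp
  qed
  have "cmp A ?u l = ide A x"
  proof (rule key)
    fix n
    have "ev x h (1 - monom 1 n) = cmp A ?u (s n)" by (simp add: s_def flip: ev_mult[OF h] q)
    then have "sub A (ev x h (1 - monom 1 n)) (cmp A ?u l) = cmp A ?u (sub A (s n) l)"
      using cmp_sub[OF sh l u] by simp
    then show "nrm A (sub A (ev x h (1 - monom 1 n)) (cmp A ?u l)) \<le> nrm A (sub A (s n) l) * nrm A ?u"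
      using nrm_cmp[OF sub_hom[OF sh l] u] by (simp add: mult.commute)
  qed (rule cmp_hom[OF l u])
  moreover have "cmp A l ?u = ide A x"
  proof (rule key)
    fix n
    have "ev x h (1 - monom 1 n) = cmp A (s n) ?u"
      by (simp only: s_def q[symmetric] mult.commute[of "[:1, -1:]"] ev_mult[OF h])
    then have "sub A (ev x h (1 - monom 1 n)) (cmp A l ?u) = cmp A (sub A (s n) l) ?u"
      using sub_cmp[OF u sh l] by simp
    then show "nrm A (sub A (ev x h (1 - monom 1 n)) (cmp A l ?u)) \<le> nrm A (sub A (s n) l) * nrm A ?u"
      using nrm_cmp[OF u sub_hom[OF sh l]] by simp
  qed (rule cmp_hom[OF u l])
  ultimately show ?thesis using u l by (auto simp: invertible_in_def)
qed


text \<open>If \<open>c\<close> is the real part of a point \<open>w\<close> of the unit circle,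
  this is the product of \<open>1 - w q\<close> and \<open>1 - cnj w q\<close>: a real substitute
  for a pair of conjugate resolvent denominators.\<close>

definition pker :: "real \<Rightarrow> real poly \<Rightarrow> real poly" where
  "pker c q = 1 - smult (2 * c) q + q * q"

text \<open>Doubling of the angle: if \<open>c\<close> is a cosine, then \<open>2 c^2 - 1\<close> is
  the cosine of twice the angle, and the square roots \<open>w\<close> and \<open>-w\<close> of
  \<open>w^2\<close> have real parts \<open>c\<close> and \<open>-c\<close>.\<close>

lemma pker_double: "pker (2 * c\<^sup>2 - 1) (q * q) = pker c q * pker (- c) q"
proof -
  have 1: "pker c q = 1 - 2 * [:c:] * q + q * q" for c q
    by (simp add: pker_def numeral_poly mult.commute)
  have 2: "[:2 * c\<^sup>2 - 1:] = 2 * [:c:] * [:c:] - 1" "[:- c:] = - [:c:]"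
    by (simp_all add: numeral_poly one_pCons power2_eq_square)
  show ?thesis unfolding 1 2 by (simp only: algebra_simps)
qed

text \<open>The averaging identity for Poisson kernels, multiplied by the common denominator of
  \<open>pker_double\<close>.\<close>

lemma pker_avg: "smult (1 / 2) ((1 - q * q) * pker (- c) q + (1 - q * q) * pker c q) = 1 - (q * q) *
  (q * q)"
proof -
  have "(1 - q * q) * pker (- c) q + (1 - q * q) * pker c q = (1 - q * q) * (pker (- c) q + pker c q)"
    by (simp only: distrib_left)
  also have "pker (- c) q + pker c q = smult 2 (1 + q * q)"
  proof -
    have "smult 2 r = r + r" for r :: "real poly" using smult_add_left[of 1 1 r] by simp
    then show ?thesis by (simp add: pker_def)
  qed
  finally show ?thesis by (simp add: algebra_simps)
qed

lemma invertible_cmp: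
  assumes f: "invertible_in A x f" and g: "invertible_in A x g"
  shows "invertible_in A x (cmp A f g)"
proof -
  obtain f' where f: "f \<in> hom A x x" "f' \<in> hom A x x" "cmp A f' f = ide A x" "cmp A f f' = ide A x"
    using f by (auto simp: invertible_in_def)
  obtain g' where g: "g \<in> hom A x x" "g' \<in> hom A x x" "cmp A g' g = ide A x" "cmp A g g' = ide A x"
    using g by (auto simp: invertible_in_def)
  have "cmp A (cmp A g' f') (cmp A f g) = cmp A g' (cmp A (cmp A f' f) g)"
    using cmp_assoc[OF cmp_hom[OF g(1) f(1)] f(2) g(2)] cmp_assoc[OF g(1) f(1) f(2)] by simp
  moreover have "cmp A (cmp A f g) (cmp A g' f') = cmp A f (cmp A (cmp A g g') f')"
    using cmp_assoc[OF cmp_hom[OF f(2) g(2)] g(1) f(1)] cmp_assoc[OF f(2) g(2) g(1)] by simp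
  ultimately show ?thesis
    using f g ide_cmp cmp_hom[of _ x x _ x] unfolding invertible_in_def by metis
qed

text \<open>Positivity enters here, as \<open>1 - 2 c t y + (t y)\<^sup>2 = (c - t y)\<^sup>2 + (1 - c\<^sup>2)\<close>.\<close>

lemma invertible_pker:
  assumes y: "y \<in> hom A x x" and sa: "star A y = y"
    and inv: "\<And>s. \<bar>s\<bar> \<le> 1 \<Longrightarrow> invertible_in A x (ev x y [:1, -s:])"
    and c: "\<bar>c\<bar> \<le> 1" and t: "0 \<le> t" "t \<le> 1"
  shows "invertible_in A x (ev x y (pker c [:0, t:]))"
proof (cases "\<bar>c\<bar> = 1")
  case True
  \<comment> \<open>Here the spectral value \<open>c^2 - 1\<close> would be 0, which positivity does
    not exclude. But the kernel is then the square of \<open>1 - c t Y\<close>, whose value is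
    invertible by \<open>inv\<close>.\<close>
  then have "c * c = 1" by (auto simp: abs_if split: if_splits)
  then have "pker c [:0, t:] = [:1, - (c * t):] * [:1, - (c * t):]"
    by (simp add: pker_def one_pCons algebra_simps)
  moreover have "\<bar>c * t\<bar> \<le> 1" using True t by (simp add: abs_mult)
  ultimately show ?thesis using invertible_cmp[OF inv inv, of "c * t" "c * t"]
    by (simp only: ev_mult[OF y])
next
  case False
  define z where "z = c * c - 1"
  have z: "z < 0"
    using False c abs_square_less_1[of c] by (simp add: z_def power2_eq_square)
  let ?g = "ev x y [:c, -t:]"
  have g: "?g \<in> hom A x x" by (rule ev_hom[OF y])
  have "?g = add A (scale A (of_real c) (ide A x)) (scale A (of_real (-t)) y)"
  proof -
    have "[:c, -t:] = smult c 1 + smult (-t) [:0, 1:]" by (simp add: one_pCons)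
    then show ?thesis by (simp only: ev_add[OF y] ev_smult[OF y] ev_1[OF y] ev_id[OF y])
  qed
  then have "star A ?g = ?g"
    using star_add[OF scale_hom[OF of_real_K one[OF y]] scale_hom[OF of_real_K y]]
      star_scale[OF of_real_K one[OF y]] star_scale[OF of_real_K y]
    by (simp add: sa star_ide[OF ob[OF y]] del: of_real_minus)
  then have gg: "cmp A (star A ?g) ?g = ev x y ([:c, -t:] * [:c, -t:])"
    by (simp only: ev_mult[OF y])
  have "complex_of_real z \<notin> complex_of_real ` {0..}"
    using z by auto
  then have "complex_of_real z \<notin> spectrum K A x (cmp A (star A ?g) ?g)"
    using star_cmp_positive[OF g] by blast
  then have "invertible_in A x (sub A (cmp A (star A ?g) ?g) (scale A z (ide A x)))"
    by (simp add: spectrum_def)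
  moreover have "sub A (cmp A (star A ?g) ?g) (scale A z (ide A x)) = ev x y (pker c [:0, t:])"
  proof -
    have "pker c [:0, t:] = [:c, -t:] * [:c, -t:] - smult z 1"
      by (simp add: pker_def one_pCons z_def algebra_simps)
    then show ?thesis by (simp only: gg ev_diff[OF y] ev_smult[OF y] ev_1[OF y])
  qed
  ultimately show ?thesis by simp
qed

text \<open>The resolvent identity, with \<open>S\<close> a left inverse and \<open>T\<close> a
  right inverse.\<close>

lemma sub_inverse:
  assumes S: "S \<in> hom A x x" and T: "T \<in> hom A x x" and D: "D \<in> hom A x x" and E: "E \<in> hom A x x"
    and SD: "cmp A S D = ide A x" and ET: "cmp A E T = ide A x"
  shows "sub A S T = cmp A S (cmp A (sub A E D) T)"
proof -
  have "cmp A S (cmp A (sub A E D) T) = sub A (cmp A S (cmp A E T)) (cmp A S (cmp A D T))"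
    using sub_cmp[OF T E D] cmp_sub[OF cmp_hom[OF T E] cmp_hom[OF T D] S] by simp
  also have "cmp A S (cmp A D T) = T"
    using cmp_assoc[OF T D S] SD ide_cmp[OF T] by simp
  finally show ?thesis using S ET by (simp add: cmp_ide)
qed

text \<open>By the resolvent identity, \<open>T\<close> is \<open>S\<close> minus a term of norm at
  most half the norm of \<open>T\<close>; that term is absorbed on the left.\<close>

lemma nrm_inverse_le:
  assumes S: "S \<in> hom A x x" and T: "T \<in> hom A x x" and D: "D \<in> hom A x x" and E: "E \<in> hom A x x"
    and SD: "cmp A S D = ide A x" and ET: "cmp A E T = ide A x"
    and M: "nrm A S \<le> M" and d: "nrm A (sub A E D) \<le> d" "M * d \<le> 1 / 2"
  shows "nrm A T \<le> 2 * M"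
proof -
  have ED: "sub A E D \<in> hom A x x" by (rule sub_hom[OF E D])
  have M0: "0 \<le> M" using nrm_nonneg[OF S] M by simp
  let ?R = "cmp A S (cmp A (sub A E D) T)"
  have RT: "cmp A (sub A E D) T \<in> hom A x x" by (rule cmp_hom[OF T ED])
  have R: "?R \<in> hom A x x" by (rule cmp_hom[OF RT S])
  have "add A ?R T = S"
    using sub_inverse[OF S T D E SD ET] sub_add_cancel(1)[OF S T] by simp
  then have "nrm A T \<le> nrm A S + nrm A ?R"
    using nrm_add_ge[OF T R] add_comm[OF T R] by simp
  also have "nrm A ?R \<le> nrm A S * (nrm A (sub A E D) * nrm A T)"
    by (rule order_trans[OF nrm_cmp[OF RT S]])
      (intro mult_left_mono nrm_cmp[OF T ED] nrm_nonneg[OF S])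
  also have "\<dots> \<le> M * (d * nrm A T)"
    by (intro mult_mono mult_right_mono M d nrm_nonneg[OF T] mult_nonneg_nonneg nrm_nonneg[OF ED] M0)
  also have "\<dots> \<le> 1 / 2 * nrm A T"
    using mult_right_mono[OF d(2) nrm_nonneg[OF T]] by (simp add: mult.assoc)
  finally show ?thesis using M by simp
qed

text \<open>Compactness of \<open>[-1, 1]\<close>, by bisection: near a point \<open>c\<close>,
  \<open>nrm_inverse_le\<close> bounds the inverses by twice the norm of the inverse at
  \<open>c\<close>.\<close>

lemma inverse_pker_bounded:
  assumes y: "y \<in> hom A x x" and ny: "nrm A y = 1"
    and inv: "\<And>c. \<bar>c\<bar> \<le> 1 \<Longrightarrow> invertible_in A x (ev x y (pker c [:0, 1:]))"
  shows "\<exists>M. \<forall>c. \<bar>c\<bar> \<le> 1 \<longrightarrow> (\<exists>S \<in> hom A x x. cmp A S (ev x y (pker c [:0, 1:])) = ide A x \<and>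
    nrm A S \<le> M)"
proof -
  let ?D = "\<lambda>c. ev x y (pker c [:0, 1:])"
  \<comment> \<open>The small intervals around a point may leave \<open>[-1, 1]\<close>; hence the
    restriction on \<open>c\<close> inside \<open>P\<close>.\<close>
  define P where "P a b \<longleftrightarrow> (\<exists>M. \<forall>c. a \<le> c \<longrightarrow> c \<le> b \<longrightarrow> \<bar>c\<bar> \<le> 1 \<longrightarrow>
    (\<exists>S \<in> hom A x x. cmp A S (?D c) = ide A x \<and> nrm A S \<le> M))" for a b
  have "(-1::real) \<le> 1" by simp
  then have "P (-1) 1"
  proof (induction rule: Bolzano)
    case (trans a b c)
    then obtain M N where
      M: "\<And>u. a \<le> u \<Longrightarrow> u \<le> b \<Longrightarrow> \<bar>u\<bar> \<le> 1 \<Longrightarrow> \<exists>S \<in> hom A x x. cmp A S (?D u) = ide A x \<and> nrm A S \<le> M" and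
      N: "\<And>u. b \<le> u \<Longrightarrow> u \<le> c \<Longrightarrow> \<bar>u\<bar> \<le> 1 \<Longrightarrow> \<exists>S \<in> hom A x x. cmp A S (?D u) = ide A x \<and> nrm A S \<le> N"
      unfolding P_def by auto
    have "\<exists>S \<in> hom A x x. cmp A S (?D u) = ide A x \<and> nrm A S \<le> max M N"
      if "a \<le> u" "u \<le> c" "\<bar>u\<bar> \<le> 1" for u
      using M[of u] N[of u] that by (cases "u \<le> b") (auto simp: le_max_iff_disj)
    then show ?case unfolding P_def by blast
  next
    case (local c)
    then have c: "\<bar>c\<bar> \<le> 1" by auto
    obtain S where S: "S \<in> hom A x x" "cmp A S (?D c) = ide A x"
      using inv[OF c] by (auto simp: invertible_in_def)
    define m where "m = nrm A S"
    have m: "0 \<le> m" unfolding m_def by (rule nrm_nonneg[OF S(1)])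
    \<comment> \<open>Denominators at distance below \<open>d\<close> differ by at most
      \<open>2 d\<close>, and \<open>m * (2 d) <= 1/2\<close> as \<open>nrm_inverse_le\<close>
      requires; the summand 1 covers \<open>m = 0\<close>.\<close>
    define d where "d = 1 / (4 * (m + 1))"
    have d: "0 < d" using m by (simp add: d_def)
    have "\<exists>T \<in> hom A x x. cmp A T (?D u) = ide A x \<and> nrm A T \<le> 2 * m"
      if u: "\<bar>u - c\<bar> < d" "\<bar>u\<bar> \<le> 1" for u
    proof -
      obtain T where T: "T \<in> hom A x x" "cmp A T (?D u) = ide A x" "cmp A (?D u) T = ide A x"
        using inv[OF u(2)] by (auto simp: invertible_in_def)
      have "pker u [:0, 1:] - pker c [:0, 1:] = smult (2 * (c - u)) [:0, 1:]"
        by (simp add: pker_def one_pCons algebra_simps)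
      then have "sub A (?D u) (?D c) = scale A (of_real (2 * (c - u))) y"
        by (metis ev_diff[OF y] ev_smult[OF y] ev_id[OF y])
      then have le: "nrm A (sub A (?D u) (?D c)) \<le> 2 * d"
        using nrm_scale[OF of_real_K y, of "2 * (c - u)"] u(1) ny
          by (simp add: abs_mult abs_minus_commute del: of_real_mult of_real_diff)
      have "m * (2 * d) \<le> 1 / 2" using m by (simp add: d_def field_simps)
      then have "nrm A T \<le> 2 * m"
        using nrm_inverse_le[OF S(1) T(1) ev_hom[OF y] ev_hom[OF y] S(2) T(3) _ le]
          by (simp add: m_def)
      then show ?thesis using T by blast
    qed
    moreover have "\<bar>u - c\<bar> < d" if "a \<le> c" "c \<le> b" "b - a < d" "a \<le> u" "u \<le> b" for a b u
      using that by auto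
    ultimately have "P a b" if "a \<le> c" "c \<le> b" "b - a < d" for a b
      using that unfolding P_def by blast
    then show ?case using d by blast
  qed
  then show ?thesis unfolding P_def by (metis abs_le_iff minus_le_iff)
qed

text \<open>Write \<open>D\<^sub>c\<close> for \<open>pker c\<close>.  The Poisson kernels
  \<open>H\<^sub>c(Y) = (1 - Y\<^sup>2) / D\<^sub>c(Y)\<close> satisfy \<open>H\<^bsub>2c\<^sup>2-1\<^esub>(Y\<^sup>2) = (H\<^sub>c(Y) + H\<^bsub>-c\<^esub>(Y)) / 2\<close>, so
  the distance between \<open>H\<^sub>c(y\<^sup>N)\<close> and \<open>H\<^sub>c((t y)\<^sup>N)\<close>, uniformly in \<open>c\<close>, does not increase when \<open>N\<close>
  is doubled.  The former stays away from \<open>1\<close>, while the latter tends to \<open>1\<close> for \<open>t < 1\<close>.\<close>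

lemma no_spectral_gap:
  assumes y: "y \<in> hom A x x" and sa: "star A y = y" and ny: "nrm A y = 1"
    and inv: "\<And>s. \<bar>s\<bar> \<le> 1 \<Longrightarrow> invertible_in A x (ev x y [:1, -s:])"
  shows False
proof -
  note eh = ev_hom[OF y]
  note inv' = invertible_pker[OF y sa inv]
  obtain M where M: "\<And>c. \<bar>c\<bar> \<le> 1 \<Longrightarrow>
    \<exists>S \<in> hom A x x. cmp A S (ev x y (pker c [:0, 1:])) = ide A x \<and> nrm A S \<le> M"
    using inverse_pker_bounded[OF y ny inv'] by auto
  define L where "L = max M 1"
  have L: "1 \<le> L" by (simp add: L_def)
  \<comment> \<open>The 64 makes the difference of the inverses in the case \<open>0\<close> below
    at most \<open>8 L^2 (1 - t) = 1/8\<close>. As \<open>L\<close> is at least 1, terms linear in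
    \<open>L\<close> are controlled too.\<close>
  define t where "t = 1 - 1 / (64 * L\<^sup>2)"
  have "1 \<le> L\<^sup>2" using L by (simp add: one_le_power)
  then have "64 * L\<^sup>2 > 1" by simp
  then have t: "0 < t" "t < 1" using L by (auto simp: t_def divide_less_eq)
  have tL: "(1 - t) * L\<^sup>2 = 1 / 64" using L by (simp add: t_def)
  define Q where "Q s n = [:0, s:] ^ (2 ^ n)" for s :: real and n :: nat
  have QSuc: "Q s (Suc n) = Q s n * Q s n" for s n by (simp only: Q_def power_Suc mult_2 power_add)
  \<comment> \<open>\<open>E\<close> and \<open>F\<close> are the Poisson kernels at
    \<open>y^(2^n)\<close> and at \<open>(t y)^(2^n)\<close>, described by denominator and numerator
    so that no quotient is formed. The bound 1/2 survives averaging.\<close>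
  have claim: "\<exists>E \<in> hom A x x. \<exists>F \<in> hom A x x.
      cmp A E (ev x y (pker c (Q 1 n))) = ev x y (1 - Q 1 n * Q 1 n) \<and>
      cmp A F (ev x y (pker c (Q t n))) = ev x y (1 - Q t n * Q t n) \<and> nrm A (sub A E F) \<le> 1 / 2"
    if "\<bar>c\<bar> \<le> 1" for n c
    using that
  proof (induct n arbitrary: c)
    case 0
    have Q0: "Q s 0 = [:0, s:]" for s by (simp add: Q_def)
    obtain S where S: "S \<in> hom A x x" "cmp A S (ev x y (pker c [:0, 1:])) = ide A x" "nrm A S \<le> L"
      using M[OF 0] by (auto simp: L_def)
    obtain T where T: "T \<in> hom A x x" "cmp A T (ev x y (pker c [:0, t:])) = ide A x"
      "cmp A (ev x y (pker c [:0, t:])) T = ide A x"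
      using inv'[OF _ 0, of t] t by (auto simp: invertible_in_def)
    let ?D = "ev x y (pker c [:0, 1:])" and ?E = "ev x y (pker c [:0, t:])"
    have t2: "1 - t * t \<le> 2 * (1 - t)" "0 \<le> 1 - t * t"
      using t zero_le_power2[of "1 - t"] mult_le_one[of t t]
      by (simp_all add: power2_eq_square algebra_simps)
    have "pker c [:0, t:] - pker c [:0, 1:] = [:0, 2 * c * (1 - t), t * t - 1:]"
      by (simp add: pker_def one_pCons algebra_simps)
    then have "nrm A (sub A ?E ?D) \<le> \<bar>2 * c * (1 - t)\<bar> + \<bar>t * t - 1\<bar>"
      using nrm_ev_le[OF y, of "[:0, 2 * c * (1 - t), t * t - 1:]"]
      by (simp add: ny map_poly_pCons flip: ev_diff[OF y])
    also have "\<dots> \<le> 2 * (1 - t) + 2 * (1 - t)"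
      using mult_right_mono[OF 0, of "2 * (1 - t)"] t t2
      by (intro add_mono) (simp_all add: abs_mult mult.commute mult.left_commute)
    finally have ED: "nrm A (sub A ?E ?D) \<le> 4 * (1 - t)" by simp
    have "L * (4 * (1 - t)) \<le> 1 / 2"
    proof -
      have "L * (1 - t) \<le> L\<^sup>2 * (1 - t)" using L t
        by (intro mult_right_mono) (auto simp: power2_eq_square)
      then show ?thesis using tL by (simp add: algebra_simps)
    qed
    then have nT: "nrm A T \<le> 2 * L"
      using nrm_inverse_le[OF S(1) T(1) eh eh S(2) T(3) S(3) ED] by blast
    let ?p = "ev x y (1 - [:0, 1:] * [:0, 1:])" and ?q = "ev x y (1 - [:0, t:] * [:0, t:])"
    have EDh: "sub A ?E ?D \<in> hom A x x" by (rule sub_hom[OF eh eh])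
    have "nrm A (sub A S T) \<le> nrm A S * (nrm A (sub A ?E ?D) * nrm A T)"
      unfolding sub_inverse[OF S(1) T(1) eh eh S(2) T(3)]
      by (rule order_trans[OF nrm_cmp[OF cmp_hom[OF T(1) EDh] S(1)]])
        (intro mult_left_mono nrm_cmp[OF T(1) EDh] nrm_nonneg[OF S(1)])
    also have "\<dots> \<le> L * (4 * (1 - t) * (2 * L))"
      by (intro mult_mono S ED nT nrm_nonneg[OF T(1)] mult_nonneg_nonneg nrm_nonneg[OF EDh])
        (use L t in auto)
    also have "\<dots> = 1 / 8" using tL by (simp add: power2_eq_square algebra_simps)
    finally have ST: "nrm A (sub A S T) \<le> 1 / 8" .
    have "1 - [:0, t:] * [:0, t:] = [:1, 0, - (t * t):]" by (simp add: one_pCons)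
    then have nq: "nrm A ?q \<le> 1 + t * t"
      using nrm_ev_le[OF y, of "[:1, 0, - (t * t):]"] by (simp add: ny map_poly_pCons)
    have pq: "?p = add A (sub A ?p ?q) ?q" using sub_add_cancel(1)[OF eh eh] by simp
    have "(1 - [:0, 1:] * [:0, 1:]) - (1 - [:0, t:] * [:0, t:]) = [:0, 0, t * t - 1:]"
      by (simp add: one_pCons)
    then have npq: "nrm A (sub A ?p ?q) \<le> 2 * (1 - t)"
      using nrm_ev_le[OF y, of "[:0, 0, t * t - 1:]"] t2
        by (simp add: ny map_poly_pCons flip: ev_diff[OF y])
    have q_h: "?q \<in> hom A x x" by (rule eh)
    have Sp: "cmp A S ?p \<in> hom A x x" "cmp A S (sub A ?p ?q) \<in> hom A x x" "cmp A S ?q \<in> hom A x x"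
      "cmp A T ?q \<in> hom A x x"
      "sub A S T \<in> hom A x x" "sub A ?p ?q \<in> hom A x x"
      using cmp_hom[OF eh S(1)] cmp_hom[OF sub_hom[OF eh eh] S(1)] cmp_hom[OF eh T(1)]
        sub_hom[OF S(1) T(1)] sub_hom[OF eh eh] by blast+
    \<comment> \<open>The difference of the kernels is split as
      \<open>S (p - q) + (S - T) q\<close>; each summand has norm at most 1/4.\<close>
    have "cmp A S ?p = add A (cmp A S (sub A ?p ?q)) (cmp A S ?q)"
      using cmp_add_right[OF Sp(6) q_h S(1)] pq by simp
    then have "sub A (cmp A S ?p) (cmp A T ?q) = add A (cmp A S (sub A ?p ?q))
      (sub A (cmp A S ?q) (cmp A T ?q))"
      using add_assoc[OF Sp(2,3) scale_hom[OF _ Sp(4)], of "-1"] by (simp add: sub_def)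
    also have "sub A (cmp A S ?q) (cmp A T ?q) = cmp A (sub A S T) ?q"
      using sub_cmp[OF q_h S(1) T(1)] by simp
    finally have split: "sub A (cmp A S ?p) (cmp A T ?q) = add A (cmp A S (sub A ?p ?q))
      (cmp A (sub A S T) ?q)" .
    have "nrm A (sub A (cmp A S ?p) (cmp A T ?q)) \<le> nrm A S * nrm A (sub A ?p ?q) + nrm A (sub A S T)
      * nrm A ?q"
      unfolding split using nrm_triangle[OF Sp(2) cmp_hom[OF q_h Sp(5)]] nrm_cmp[OF Sp(6) S(1)]
        nrm_cmp[OF q_h Sp(5)] by linarith
    also have "\<dots> \<le> L * (2 * (1 - t)) + 1 / 8 * 2"
      using t by (intro add_mono mult_mono S npq ST order_trans[OF nq] nrm_nonneg[OF Sp(6)]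
        nrm_nonneg[OF q_h])
        (use L t mult_le_one[of t t] in auto)
    also have "\<dots> \<le> 1 / 2" using \<open>L * (4 * (1 - t)) \<le> 1 / 2\<close> by (simp add: algebra_simps)
    finally have "nrm A (sub A (cmp A S ?p) (cmp A T ?q)) \<le> 1 / 2" .
    \<comment> \<open>Polynomials in \<open>y\<close> commute, so a left inverse of the denominator
      times the numerator is a quotient in the sense of \<open>claim\<close>.\<close>
    moreover have "cmp A (cmp A R (ev x y q)) (ev x y p) = ev x y q"
      if "R \<in> hom A x x" "cmp A R (ev x y p) = ide A x" for R p q
    proof -
      have "cmp A (cmp A R (ev x y q)) (ev x y p) = cmp A R (ev x y (p * q))"
        by (simp add: cmp_assoc[OF eh eh that(1)] mult.commute[of p] ev_mult[OF y])
      then show ?thesis using that cmp_assoc[OF eh eh that(1)] ide_cmp[OF eh]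
        by (simp add: ev_mult[OF y])
    qed
    ultimately show ?case
      using S T Sp by (intro bexI[of _ "cmp A S ?p"] bexI[of _ "cmp A T ?q"]) (simp_all add: Q0)
  next
    case (Suc n)
    \<comment> \<open>The half-angle formula: \<open>b\<close> and \<open>-b\<close> are the two
      parameters that double to \<open>c\<close>.\<close>
    define b where "b = sqrt ((1 + c) / 2)"
    have "0 \<le> (1 + c) / 2" "(1 + c) / 2 \<le> 1" using Suc(2) by auto
    then have "\<bar>b\<bar> \<le> 1" "b\<^sup>2 = (1 + c) / 2" by (simp_all add: b_def)
    then have b: "\<bar>b\<bar> \<le> 1" "c = 2 * b\<^sup>2 - 1" by auto
    have b': "\<bar>- b\<bar> \<le> 1" using b by simp
    obtain E F where E: "E \<in> hom A x x" "cmp A E (ev x y (pker b (Q 1 n))) = ev x y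
      (1 - Q 1 n * Q 1 n)"
      and F: "F \<in> hom A x x" "cmp A F (ev x y (pker b (Q t n))) = ev x y (1 - Q t n * Q t n)"
      and EF: "nrm A (sub A E F) \<le> 1 / 2" using Suc(1)[OF b(1)] by blast
    obtain E' F' where E': "E' \<in> hom A x x" "cmp A E' (ev x y (pker (- b) (Q 1 n))) = ev x y
      (1 - Q 1 n * Q 1 n)"
      and F': "F' \<in> hom A x x" "cmp A F' (ev x y (pker (- b) (Q t n))) = ev x y (1 - Q t n * Q t n)"
      and EF': "nrm A (sub A E' F') \<le> 1 / 2" using Suc(1)[OF b'] by blast
    define h where "h = complex_of_real (1 / 2)"
    have hK: "h \<in> K" unfolding h_def by (rule of_real_K)
    \<comment> \<open>One computation for both kernels, at \<open>y\<close> and at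
      \<open>t y\<close>: the mean of the kernels for \<open>b\<close> and \<open>-b\<close> at
      \<open>q\<close> is the kernel for \<open>c\<close> at \<open>q * q\<close>.\<close>
    have avg: "cmp A (scale A h (add A R R')) (ev x y (pker c (q * q))) = ev x y
      (1 - (q * q) * (q * q))"
      if R: "R \<in> hom A x x" "cmp A R (ev x y (pker b q)) = ev x y (1 - q * q)"
        and R': "R' \<in> hom A x x" "cmp A R' (ev x y (pker (- b) q)) = ev x y (1 - q * q)" for R R' q
    proof -
      have 1: "cmp A R (ev x y (pker c (q * q))) = ev x y ((1 - q * q) * pker (- b) q)"
        unfolding b(2) pker_double ev_mult[OF y] by (simp add: cmp_assoc[OF eh eh R(1)] R(2))
      have 2: "cmp A R' (ev x y (pker c (q * q))) = ev x y ((1 - q * q) * pker b q)"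
        unfolding b(2) pker_double mult.commute[of "pker b q"] ev_mult[OF y]
        by (simp add: cmp_assoc[OF eh eh R'(1)] R'(2))
      note avg = pker_avg[of q b]
      show ?thesis
        using avg cmp_scale_left[OF hK eh add_hom[OF R(1) R'(1)]] cmp_add_left[OF eh R(1) R'(1)]
        by (simp add: 1 2 h_def flip: ev_add[OF y] ev_smult[OF y] del: of_real_divide)
    qed
    have "sub A (scale A h (add A E E')) (scale A h (add A F F')) = scale A h
      (add A (sub A E F) (sub A E' F'))"
    proof -
      have nF: "scale A (-1) F \<in> hom A x x" "scale A (-1) F' \<in> hom A x x" using F F' scale_hom
        by simp_all
      have "scale A (- 1) (scale A h (add A F F')) = scale A h (scale A (- 1) (add A F F'))"
        using scale_scale[OF _ _ add_hom[OF F(1) F'(1)]] hK by simp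
      also have "scale A (- 1) (add A F F') = add A (scale A (- 1) F) (scale A (- 1) F')"
        using scale_add[OF _ F(1) F'(1)] by simp
      finally show ?thesis
        using scale_add[OF hK add_hom[OF E(1) E'(1)] add_hom[OF nF]] add_add_swap[OF E(1) E'(1) nF]
        by (simp add: sub_def)
    qed
    then have "nrm A (sub A (scale A h (add A E E')) (scale A h (add A F F'))) = 1 / 2 * nrm A
      (add A (sub A E F) (sub A E' F'))"
      using nrm_scale[OF hK add_hom[OF sub_hom[OF E(1) F(1)] sub_hom[OF E'(1) F'(1)]]]
        by (simp add: h_def)
    also have "\<dots> \<le> 1 / 2"
      using nrm_triangle[OF sub_hom[OF E(1) F(1)] sub_hom[OF E'(1) F'(1)]] EF EF' by simp
    finally show ?case
      using avg[OF E E'] avg[OF F F'] scale_hom[OF hK add_hom[OF E(1) E'(1)]]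
        scale_hom[OF hK add_hom[OF F(1) F'(1)]]
      unfolding QSuc by blast
  qed
  \<comment> \<open>For self-adjoint elements the C*-identity says that squaring squares the norm,
    so repeated squaring keeps norm 1.\<close>
  have y_pow: "nrm A (ev x y (Q 1 n)) = 1 \<and> star A (ev x y (Q 1 n)) = ev x y (Q 1 n)" for n
  proof (induct n)
    case 0
    then show ?case using ev_id[OF y] ny sa by (simp add: Q_def)
  next
    case (Suc n)
    then show ?case using cstar_identity[OF eh, of "Q 1 n"] star_cmp[OF eh eh, of "Q 1 n" "Q 1 n"]
      by (simp add: QSuc ev_mult[OF y])
  qed
  \<comment> \<open>Below 1/9 the estimate for \<open>F'\<close> yields the bound 1/4, and
    \<open>1/2 + 1/4\<close> is less than 1. The exponent of \<epsilon> is that of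
    \<open>Q t n * Q t n\<close>; it exceeds \<open>n\<close>.\<close>
  obtain n where n: "t ^ n < 1 / 9" using real_arch_pow_inv[of "1/9" t] t by auto
  define \<epsilon> where "\<epsilon> = t ^ (2 ^ Suc n)"
  have "\<epsilon> \<le> t ^ n" unfolding \<epsilon>_def
    using t less_exp[of "Suc n"] by (intro power_decreasing) auto
  then have "\<epsilon> < 1 / 9" using n by linarith
  moreover have "0 \<le> \<epsilon>" using t by (simp add: \<epsilon>_def)
  ultimately have eps: "0 \<le> \<epsilon>" "\<epsilon> < 1 / 9" by simp_all
  let ?w = "ev x y (Q 1 (Suc n))"
  have w: "?w \<in> hom A x x" "nrm A ?w = 1" using eh y_pow by auto
  \<comment> \<open>At \<open>c = 0\<close> the denominator is \<open>1 + q^2\<close>: the kernels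
    become \<open>(1 - w) / (1 + w)\<close> and
    \<open>(1 - \<epsilon> w) / (1 + \<epsilon> w)\<close>, with \<open>w\<close> still of norm 1
    and \<epsilon> small.\<close>
  obtain E F where E: "E \<in> hom A x x" "cmp A E (ev x y (pker 0 (Q 1 n))) = ev x y (1 - Q 1 n * Q 1 n)"
    and F: "F \<in> hom A x x" "cmp A F (ev x y (pker 0 (Q t n))) = ev x y (1 - Q t n * Q t n)"
    and EF: "nrm A (sub A E F) \<le> 1 / 2" using claim[of 0 n] by auto
  have i: "ide A x \<in> hom A x x" by (rule one[OF y])
  \<comment> \<open>Subtracting 1 from \<open>(1 - e w) / (1 + e w)\<close> leaves
    \<open>- 2 e w / (1 + e w)\<close>. For \<open>e = 1\<close> this forces norm at least 1; for
    small \<open>e\<close> it forces a small norm.\<close>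
  have shift: "add A R' (scale A (of_real e) (cmp A R' ?w)) = scale A (of_real (- 2 * e)) ?w"
    if R: "R \<in> hom A x x" "cmp A R (ev x y (1 + smult e (Q 1 (Suc n)))) = ev x y
      (1 - smult e (Q 1 (Suc n)))"
      and R': "R' = sub A R (ide A x)" for R R' e
  proof -
    have "add A R' (scale A (of_real e) (cmp A R' ?w)) = cmp A R'
      (ev x y (1 + smult e (Q 1 (Suc n))))"
      using cmp_add_right[OF i scale_hom[OF of_real_K w(1)] sub_hom[OF R(1) i], of e]
        cmp_scale_right[OF of_real_K w(1) sub_hom[OF R(1) i], of e] cmp_ide[OF sub_hom[OF R(1) i]]
      by (simp add: R' ev_add[OF y] ev_1[OF y] ev_smult[OF y])
    also have "\<dots> = sub A (ev x y (1 - smult e (Q 1 (Suc n)))) (ev x y (1 + smult e (Q 1 (Suc n))))"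
      using sub_cmp[OF eh R(1) i] R(2) ide_cmp[OF eh] by (simp add: R')
    also have "\<dots> = ev x y (smult (- 2 * e) (Q 1 (Suc n)))"
      by (simp add: algebra_simps flip: ev_diff[OF y] smult_add_left)
    finally show ?thesis by (simp only: ev_smult[OF y])
  qed
  have QT: "Q t n * Q t n = smult \<epsilon> (Q 1 (Suc n))"
    using smult_power[of t "[:0, 1:]" "2 ^ Suc n"] unfolding \<epsilon>_def QSuc[symmetric]
      by (simp add: Q_def)
  define E' where "E' = sub A E (ide A x)"
  define F' where "F' = sub A F (ide A x)"
  have E'F': "E' \<in> hom A x x" "F' \<in> hom A x x" by (simp_all add: E'_def F'_def sub_hom E F i)
  have "add A E' (scale A (of_real 1) (cmp A E' ?w)) = scale A (of_real (- 2 * 1)) ?w"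
    by (rule shift[OF E(1) _ E'_def]) (use E(2) in \<open>simp add: pker_def QSuc\<close>)
  then have "2 \<le> nrm A E' + nrm A (cmp A E' ?w)"
    using nrm_triangle[OF E'F'(1) cmp_hom[OF w(1) E'F'(1)]] nrm_scale[OF of_real_K w(1), of "-2"] w(2)
      scale_one[OF cmp_hom[OF w(1) E'F'(1)]] by simp
  then have E1: "1 \<le> nrm A E'" using nrm_cmp[OF w(1) E'F'(1)] w(2) by simp
  have F1: "add A F' (scale A (of_real \<epsilon>) (cmp A F' ?w)) = scale A (of_real (- 2 * \<epsilon>)) ?w"
    by (rule shift[OF F(1) _ F'_def]) (use F(2) in \<open>simp add: pker_def QT\<close>)
  have "nrm A F' \<le> 2 * \<epsilon> + \<epsilon> * nrm A F'"
  proof -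
    have "nrm A F' \<le> 2 * \<epsilon> + \<epsilon> * nrm A (cmp A F' ?w)"
      using nrm_add_ge[OF E'F'(2) scale_hom[OF of_real_K cmp_hom[OF w(1) E'F'(2)]], of \<epsilon>] w(2) eps
        nrm_scale[OF of_real_K w(1), of "-2 * \<epsilon>"]
          nrm_scale[OF of_real_K cmp_hom[OF w(1) E'F'(2)], of \<epsilon>]
      unfolding F1 by (simp del: of_real_mult of_real_minus add: abs_mult)
    also have "\<dots> \<le> 2 * \<epsilon> + \<epsilon> * nrm A F'"
      using nrm_cmp[OF w(1) E'F'(2)] w(2) eps by (simp add: mult_left_mono)
    finally show ?thesis .
  qed
  also have "\<dots> \<le> 2 / 9 + 1 / 9 * nrm A F'"
    using eps nrm_nonneg[OF E'F'(2)] by (intro add_mono mult_right_mono) auto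
  finally have F2: "nrm A F' \<le> 1 / 4" by simp
  have "sub A E F = sub A E' F'"
  proof -
    have "add A (sub A E F) F' = E'"
    proof -
      have "E = add A (sub A E F) F" using sub_add_cancel(1)[OF E(1) F(1)] by simp
      then have "E' = sub A (add A (sub A E F) F) (ide A x)" by (simp add: E'_def)
      then show ?thesis using add_assoc[OF sub_hom[OF E(1) F(1)] F(1) scale_hom[OF _ i], of "-1"]
        by (simp add: sub_def F'_def)
    qed
    then show ?thesis using sub_add_cancel(2)[OF sub_hom[OF E(1) F(1)] E'F'(2)] by simp
  qed
  then have "nrm A E' \<le> 1 / 2 + nrm A F'"
    using sub_add_cancel(1)[OF E'F'] nrm_triangle[OF sub_hom[OF E'F'] E'F'(2)] EF by simp
  then show False using E1 F2 by simp
qed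

end

lemma real_cstar_categoryI: "cstar_category K A \<Longrightarrow> \<real> \<subseteq> K \<Longrightarrow> real_cstar_category K A"
  by (simp add: real_cstar_category_def real_linear_category_def
      real_linear_category_axioms_def cstar_category_def star_category_def)

lemma (in star_functor) far_invertible:
  assumes "invertible_in (fsrc F) x a"
  shows "invertible_in (ftgt F) (fob F x) (far F a)"
proof -
  interpret A: cstar_category K "fsrc F" by (rule fsrc_cstar)
  obtain b where a: "a \<in> hom (fsrc F) x x" and b: "b \<in> hom (fsrc F) x x"
    "cmp (fsrc F) b a = ide (fsrc F) x" "cmp (fsrc F) a b = ide (fsrc F) x"
    using assms by (auto simp: invertible_in_def)
  have x: "x \<in> obj (fsrc F)" using A.hom_obj[OF a] by simp
  show ?thesis
    using far_hom[OF a] far_hom[OF b(1)] far_cmp[OF a b(1)] far_cmp[OF b(1) a] far_ide[OF x] b(2,3)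
    unfolding invertible_in_def by auto
qed

text \<open>If the norm grew at \<open>a\<close>, a multiple \<open>g\<close> of
  \<open>star a\<close> composed with \<open>a\<close> would have norm below 1 and an image of norm
  exactly 1. The Neumann series makes \<open>1 - s g\<close> invertible for real \<open>s\<close> in
  \<open>[-1, 1]\<close>, and functors preserve invertibility, against
  \<open>no_spectral_gap\<close>.\<close>

theorem star_functor_contractive:
  assumes F: "star_functor K F" and reals: "\<real> \<subseteq> K" and a: "a \<in> hom (fsrc F) x y"
  shows "nrm (ftgt F) (far F a) \<le> nrm (fsrc F) a"
proof (rule ccontr)
  let ?A = "fsrc F" and ?B = "ftgt F" and ?b = "far F a"
  interpret star_functor K F by (rule F)
  interpret A: real_cstar_category K ?A by (rule real_cstar_categoryI[OF fsrc_cstar reals])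
  interpret B: real_cstar_category K ?B by (rule real_cstar_categoryI[OF ftgt_cstar reals])
  assume "\<not> nrm ?B ?b \<le> nrm ?A a"
  then have less: "nrm ?A a < nrm ?B ?b" by simp
  define r where "r = (nrm ?B ?b)\<^sup>2"
  have r: "(nrm ?A a)\<^sup>2 < r" "0 < r"
    using less A.nrm_nonneg[OF a] by (auto simp: r_def power_strict_mono)
  define h where "h = cmp ?A (star ?A a) a"
  have h: "h \<in> hom ?A x x" "star ?A h = h" "nrm ?A h = (nrm ?A a)\<^sup>2"
    using A.cmp_hom[OF a A.star_hom[OF a]] A.star_cmp[OF a A.star_hom[OF a]] A.star_star[OF a]
      A.cstar_identity[OF a] by (simp_all add: h_def)
  have Fh: "nrm ?B (far F h) = r"
    using far_cmp[OF a A.star_hom[OF a]] far_star[OF a] B.cstar_identity[OF far_hom[OF a]]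
    by (simp add: h_def r_def)
  define g where "g = scale ?A (of_real (1 / r)) h"
  have g: "g \<in> hom ?A x x" "star ?A g = g" "nrm ?A g < 1"
    using A.scale_hom[OF A.of_real_K h(1)] A.star_scale[OF A.of_real_K h(1)]
      A.nrm_scale[OF A.of_real_K h(1), of "1 / r"] h r
    by (simp_all add: g_def del: of_real_divide)
  let ?y = "far F g"
  have y: "?y \<in> hom ?B (fob F x) (fob F x)" "star ?B ?y = ?y"
    using far_hom[OF g(1)] far_star[OF g(1)] g(2) by simp_all
  have "nrm ?B ?y = 1"
    using far_scale[OF A.of_real_K h(1)] B.nrm_scale[OF B.of_real_K far_hom[OF h(1)], of "1 / r"] Fh r
    by (simp add: g_def del: of_real_divide)
  moreover have "invertible_in ?B (fob F x) (B.ev (fob F x) ?y [:1, -s:])" if s: "\<bar>s\<bar> \<le> 1" for s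
  proof -
    let ?s = "complex_of_real s"
    have sg: "scale ?A ?s g \<in> hom ?A x x" by (rule A.scale_hom[OF A.of_real_K g(1)])
    have "nrm ?A (scale ?A ?s g) < 1"
      using A.nrm_scale[OF A.of_real_K g(1), of s] mult_right_mono[OF s A.nrm_nonneg[OF g(1)]] g(3)
        by simp
    then have "invertible_in ?A x (sub ?A (ide ?A x) (scale ?A ?s g))"
      using A.invertible_one_minus[OF sg] A.ev_linear[OF sg, of 1] A.scale_one[OF sg] by simp
    then have "invertible_in ?B (fob F x) (far F (sub ?A (ide ?A x) (scale ?A ?s g)))"
      by (rule far_invertible)
    moreover have "far F (sub ?A (ide ?A x) (scale ?A ?s g)) = sub ?B (ide ?B (fob F x))
      (scale ?B ?s ?y)"
      using far_add[OF A.one[OF g(1)] A.scale_hom[OF A.numeral_K(1) sg]]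
        far_scale[OF A.numeral_K(1) sg]
        far_scale[OF A.of_real_K g(1)] far_ide[OF A.ob[OF g(1)]] by (simp add: sub_def)
    ultimately show ?thesis by (simp add: B.ev_linear[OF y(1)])
  qed
  ultimately show False using B.no_spectral_gap[OF y] by blast
qed


section \<open>Countably directed colimits\<close>

text \<open>Functoriality of \<open>t\<close> is recorded on arrows; \<open>t_fob_t\<close> recovers
  it on objects through identities. \<open>enc\<close> makes room in \<open>'u\<close> for pairs of
  a stage and an arrow, and \<open>bound\<close> is directedness for sequences of stages.\<close>

locale countably_directed_system =
  fixes K :: "complex set" and r :: "'i rel" and X :: "'i \<Rightarrow> 'u small_star_cat"
    and t :: "'i \<Rightarrow> 'i \<Rightarrow> 'u sfun" and enc :: "'i \<times> 'u \<Rightarrow> 'u"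
  assumes scalars: "K = \<real> \<or> K = UNIV"
    and enc: "inj enc"
    and bound: "\<And>f :: nat \<Rightarrow> 'i. range f \<subseteq> Field r \<Longrightarrow> \<exists>d \<in> Field r. \<forall>n. (f n, d) \<in> r"
    and r_refl: "b \<in> Field r \<Longrightarrow> (b, b) \<in> r"
    and r_trans: "(b, c) \<in> r \<Longrightarrow> (c, d) \<in> r \<Longrightarrow> (b, d) \<in> r"
    and t_functor: "(b, c) \<in> r \<Longrightarrow> star_functor K (t b c)"
    and t_fsrc: "(b, c) \<in> r \<Longrightarrow> fsrc (t b c) = X b"
    and t_ftgt: "(b, c) \<in> r \<Longrightarrow> ftgt (t b c) = X c"
    and t_t: "(b, c) \<in> r \<Longrightarrow> (c, d) \<in> r \<Longrightarrow> \<alpha> \<in> arr (X b) \<Longrightarrow>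
      far (t c d) (far (t b c) \<alpha>) = far (t b d) \<alpha>"
begin

lemma reals: "\<real> \<subseteq> K"
  using scalars by auto

lemma K_closed:
  assumes "k \<in> K" "l \<in> K"
  shows "k * l \<in> K" "k + l \<in> K" "cnj k \<in> K"
  using assms scalars by (auto simp: Reals_cnj_iff)

lemma X_cstar: "b \<in> Field r \<Longrightarrow> real_cstar_category K (X b)"
  using real_cstar_categoryI[OF star_functor.fsrc_cstar[OF t_functor[OF r_refl]] reals]
    t_fsrc[OF r_refl]
  by simp

lemma X_category: "b \<in> Field r \<Longrightarrow> category (X b)"
  using X_cstar by (simp add: real_cstar_category_def cstar_category_def star_category_def
    linear_category_def)

lemma X_star: "b \<in> Field r \<Longrightarrow> star_category K (X b)"
  using X_cstar by (simp add: real_cstar_category_def cstar_category_def)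

lemma X_cs: "b \<in> Field r \<Longrightarrow> cstar_category K (X b)"
  using X_cstar by (simp add: real_cstar_category_def)

lemma X_lin: "b \<in> Field r \<Longrightarrow> linear_category K (X b)"
  using X_star by (simp add: star_category_def)

lemma r_Field: "(b, c) \<in> r \<Longrightarrow> b \<in> Field r" "(b, c) \<in> r \<Longrightarrow> c \<in> Field r"
  by (auto simp: Field_def)

lemma bound2: "b \<in> Field r \<Longrightarrow> c \<in> Field r \<Longrightarrow> \<exists>d \<in> Field r. (b, d) \<in> r \<and> (c, d) \<in> r"
proof -
  assume bc: "b \<in> Field r" "c \<in> Field r"
  define f where "f n = (if n = 0 then b else c)" for n :: nat
  have "range f \<subseteq> Field r" using bc by (auto simp: f_def)
  then obtain d where "d \<in> Field r" "\<And>n. (f n, d) \<in> r" using bound by blast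
  then show ?thesis by (metis f_def zero_neq_one)
qed

section \<open>Transition functors preserve the structure and do not increase norms\<close>

context
  fixes b c
  assumes bc: "(b, c) \<in> r"
begin

interpretation F: star_functor K "t b c" by (rule t_functor[OF bc])
interpretation B: real_cstar_category K "X b" by (rule X_cstar[OF r_Field(1)[OF bc]])
interpretation C: real_cstar_category K "X c" by (rule X_cstar[OF r_Field(2)[OF bc]])
lemmas [simp] = t_fsrc[OF bc] t_ftgt[OF bc]

lemma t_hom: "\<alpha> \<in> hom (X b) x y \<Longrightarrow> far (t b c) \<alpha> \<in> hom (X c) (fob (t b c) x) (fob (t b c) y)"
  using F.far_hom by simp

lemma t_arr: "\<alpha> \<in> arr (X b) \<Longrightarrow> far (t b c) \<alpha> \<in> arr (X c)"
  using t_hom[OF B.arr_hom] C.hom_arr by blast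

lemma t_obj: "x \<in> obj (X b) \<Longrightarrow> fob (t b c) x \<in> obj (X c)"
  using t_hom[OF B.ide_hom] C.hom_obj by blast

lemma t_src: "\<alpha> \<in> arr (X b) \<Longrightarrow> src (X c) (far (t b c) \<alpha>) = fob (t b c) (src (X b) \<alpha>)"
  using t_hom[OF B.arr_hom] by (simp add: hom_def)

lemma t_tgt: "\<alpha> \<in> arr (X b) \<Longrightarrow> tgt (X c) (far (t b c) \<alpha>) = fob (t b c) (tgt (X b) \<alpha>)"
  using t_hom[OF B.arr_hom] by (simp add: hom_def)

lemma t_ide: "x \<in> obj (X b) \<Longrightarrow> far (t b c) (ide (X b) x) = ide (X c) (fob (t b c) x)"
  using F.far_ide by simp

lemma t_cmp: "src (X b) \<beta> = tgt (X b) \<alpha> \<Longrightarrow> \<alpha> \<in> arr (X b) \<Longrightarrow> \<beta> \<in> arr (X b) \<Longrightarrow>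
    far (t b c) (cmp (X b) \<beta> \<alpha>) = cmp (X c) (far (t b c) \<beta>) (far (t b c) \<alpha>)"
  using F.far_cmp by (simp add: hom_def)

lemma t_add: "src (X b) \<alpha> = src (X b) \<beta> \<Longrightarrow> tgt (X b) \<alpha> = tgt (X b) \<beta> \<Longrightarrow> \<alpha> \<in> arr (X b) \<Longrightarrow> \<beta> \<in> arr (X b) \<Longrightarrow>
    far (t b c) (add (X b) \<alpha> \<beta>) = add (X c) (far (t b c) \<alpha>) (far (t b c) \<beta>)"
  using F.far_add by (simp add: hom_def)

lemma t_scale: "k \<in> K \<Longrightarrow> \<alpha> \<in> arr (X b) \<Longrightarrow> far (t b c) (scale (X b) k \<alpha>) = scale (X c) k (far (t b c) \<alpha>)"
  using F.far_scale by (simp add: hom_def)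

lemma t_star: "\<alpha> \<in> arr (X b) \<Longrightarrow> far (t b c) (star (X b) \<alpha>) = star (X c) (far (t b c) \<alpha>)"
  using F.far_star by (simp add: hom_def)

lemma t_zero:
  assumes "x \<in> obj (X b)" "y \<in> obj (X b)"
  shows "far (t b c) (zero (X b) x y) = zero (X c) (fob (t b c) x) (fob (t b c) y)"
proof -
  have z: "zero (X b) x y \<in> hom (X b) x y" using B.zero_hom assms by simp
  show ?thesis
    using B.scale_0[OF z] C.scale_0[OF t_hom[OF z]] t_scale[OF _ B.hom_arr[OF z], of 0] by simp
qed

lemma t_nrm: "\<alpha> \<in> arr (X b) \<Longrightarrow> nrm (X c) (far (t b c) \<alpha>) \<le> nrm (X b) \<alpha>"
  using star_functor_contractive[OF F.star_functor_axioms reals, of \<alpha>] B.arr_hom[of \<alpha>] by fastforce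

end

lemma src_obj: "b \<in> Field r \<Longrightarrow> \<alpha> \<in> arr (X b) \<Longrightarrow> src (X b) \<alpha> \<in> obj (X b)"
  and tgt_obj: "b \<in> Field r \<Longrightarrow> \<alpha> \<in> arr (X b) \<Longrightarrow> tgt (X b) \<alpha> \<in> obj (X b)"
  by (simp_all add: category.src_obj category.tgt_obj X_category)

lemma ide_arr: "b \<in> Field r \<Longrightarrow> x \<in> obj (X b) \<Longrightarrow> ide (X b) x \<in> arr (X b)"
  and ide_src: "b \<in> Field r \<Longrightarrow> x \<in> obj (X b) \<Longrightarrow> src (X b) (ide (X b) x) = x"
  using category.ide_hom[OF X_category] by (auto simp: hom_def)

lemma t_fob_t: "(b, c) \<in> r \<Longrightarrow> (c, d) \<in> r \<Longrightarrow> x \<in> obj (X b) \<Longrightarrow> fob (t c d) (fob (t b c) x) = fob (t b d) x"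
proof -
  assume r: "(b, c) \<in> r" "(c, d) \<in> r" and x: "x \<in> obj (X b)"
  note bd = r_trans[OF r]
  have "ide (X d) (fob (t c d) (fob (t b c) x)) = ide (X d) (fob (t b d) x)"
    using t_t[OF r ide_arr[OF r_Field(1)[OF r(1)] x]] t_ide[OF r(1) x] t_ide[OF r(2) t_obj[OF r(1) x]]
      t_ide[OF bd x]
    by simp
  then show ?thesis
    using ide_src[OF r_Field(2)[OF bd] t_obj[OF bd x]]
      ide_src[OF r_Field(2)[OF bd] t_obj[OF r(2) t_obj[OF r(1) x]]]
    by metis
qed

section \<open>Germs of arrows and of objects\<close>

definition eqv :: "'i \<Rightarrow> 'u \<Rightarrow> 'i \<Rightarrow> 'u \<Rightarrow> bool" where
  "eqv b \<alpha> c \<beta> \<longleftrightarrow> (\<exists>d. (b, d) \<in> r \<and> (c, d) \<in> r \<and> far (t b d) \<alpha> = far (t c d) \<beta>)"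

lemma eqv_refl: "b \<in> Field r \<Longrightarrow> eqv b \<alpha> b \<alpha>"
  using r_refl by (auto simp: eqv_def)

lemma eqv_sym: "eqv b \<alpha> c \<beta> \<Longrightarrow> eqv c \<beta> b \<alpha>"
  by (auto simp: eqv_def)

lemma eqv_trans:
  assumes "eqv b \<alpha> c \<beta>" "eqv c \<beta> d \<gamma>" and arr: "\<alpha> \<in> arr (X b)" "\<beta> \<in> arr (X c)" "\<gamma> \<in> arr (X d)"
  shows "eqv b \<alpha> d \<gamma>"
proof -
  obtain e where e: "(b, e) \<in> r" "(c, e) \<in> r" "far (t b e) \<alpha> = far (t c e) \<beta>"
    using assms(1) by (auto simp: eqv_def)
  obtain f where f: "(c, f) \<in> r" "(d, f) \<in> r" "far (t c f) \<beta> = far (t d f) \<gamma>"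
    using assms(2) by (auto simp: eqv_def)
  obtain g where g: "(e, g) \<in> r" "(f, g) \<in> r"
    using bound2[of e f] e f r_Field by blast
  have "far (t b g) \<alpha> = far (t d g) \<gamma>"
    using t_t[OF e(1) g(1) arr(1)] t_t[OF e(2) g(1) arr(2)] t_t[OF f(1) g(2) arr(2)]
      t_t[OF f(2) g(2) arr(3)] e f
    by metis
  then show ?thesis using e f g r_trans unfolding eqv_def by blast
qed

text \<open>An arrow of the colimit is a germ of arrows of the stages; in order to stay in the universe, it is
  represented by the code of a chosen member.  An object is represented by its identity arrow.\<close>

definition cl :: "'i \<Rightarrow> 'u \<Rightarrow> 'u" where
  "cl b \<alpha> = enc (SOME p. fst p \<in> Field r \<and> snd p \<in> arr (X (fst p)) \<and> eqv b \<alpha> (fst p) (snd p))"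

text \<open>Equivalent arrows satisfy the same choice predicate, so they have the same code;
  conversely the chosen member, recovered by injectivity of \<open>enc\<close>, is equivalent to
  both arrows.\<close>

lemma cl_eq:
  assumes b: "b \<in> Field r" "\<alpha> \<in> arr (X b)" and c: "c \<in> Field r" "\<beta> \<in> arr (X c)"
  shows "cl b \<alpha> = cl c \<beta> \<longleftrightarrow> eqv b \<alpha> c \<beta>"
proof
  let ?P = "\<lambda>b \<alpha> p. fst p \<in> Field r \<and> snd p \<in> arr (X (fst p)) \<and> eqv b \<alpha> (fst p) (snd p)"
  assume "cl b \<alpha> = cl c \<beta>"
  then have eq: "Eps (?P b \<alpha>) = Eps (?P c \<beta>)" using injD[OF enc] by (simp add: cl_def)
  have "?P b \<alpha> (Eps (?P b \<alpha>))" using someI[of "?P b \<alpha>" "(b, \<alpha>)"] b eqv_refl by simp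
  moreover have "?P c \<beta> (Eps (?P c \<beta>))" using someI[of "?P c \<beta>" "(c, \<beta>)"] c eqv_refl by simp
  ultimately show "eqv b \<alpha> c \<beta>"
    using eqv_trans[OF _ eqv_sym b(2) _ c(2)] unfolding eq by blast
next
  assume "eqv b \<alpha> c \<beta>"
  then have "eqv b \<alpha> e \<gamma> \<longleftrightarrow> eqv c \<beta> e \<gamma>" if "\<gamma> \<in> arr (X e)" for e \<gamma>
    using eqv_trans[OF eqv_sym _ c(2) b(2) that] eqv_trans[OF _ _ b(2) c(2) that] \<open>eqv b \<alpha> c \<beta>\<close>
      by blast
  then have "(fst p \<in> Field r \<and> snd p \<in> arr (X (fst p)) \<and> eqv b \<alpha> (fst p) (snd p)) =
      (fst p \<in> Field r \<and> snd p \<in> arr (X (fst p)) \<and> eqv c \<beta> (fst p) (snd p))" for p by blast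
  then show "cl b \<alpha> = cl c \<beta>" by (simp add: cl_def)
qed

lemma cl_t: "(b, c) \<in> r \<Longrightarrow> \<alpha> \<in> arr (X b) \<Longrightarrow> cl c (far (t b c) \<alpha>) = cl b \<alpha>"
  by (subst cl_eq) (auto simp: r_Field t_arr eqv_def t_t r_refl intro!: exI[of _ c])

definition oc :: "'i \<Rightarrow> 'u \<Rightarrow> 'u" where
  "oc b x = cl b (ide (X b) x)"

lemma oc_t: "(b, c) \<in> r \<Longrightarrow> x \<in> obj (X b) \<Longrightarrow> oc c (fob (t b c) x) = oc b x"
  using cl_t[of b c "ide (X b) x"] by (simp add: oc_def t_ide ide_arr r_Field)

lemma oc_eq:
  assumes "b \<in> Field r" "x \<in> obj (X b)" "c \<in> Field r" "y \<in> obj (X c)"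
  shows "oc b x = oc c y \<longleftrightarrow> (\<exists>d. (b, d) \<in> r \<and> (c, d) \<in> r \<and> fob (t b d) x = fob (t c d) y)"
  unfolding oc_def cl_eq[OF assms(1) ide_arr[OF assms(1,2)] assms(3) ide_arr[OF assms(3,4)]] eqv_def
proof -
  have "far (t b d) (ide (X b) x) = far (t c d) (ide (X c) y) \<longleftrightarrow> fob (t b d) x = fob (t c d) y"
    if d: "(b, d) \<in> r" "(c, d) \<in> r" for d
    using t_ide[OF d(1) assms(2)] t_ide[OF d(2) assms(4)]
      ide_src[OF r_Field(2)[OF d(1)] t_obj[OF d(1) assms(2)]]
      ide_src[OF r_Field(2)[OF d(2)] t_obj[OF d(2) assms(4)]] by metis
  then show "(\<exists>d. (b, d) \<in> r \<and> (c, d) \<in> r \<and> far (t b d) (ide (X b) x) = far (t c d) (ide (X c) y)) \<longleftrightarrow>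
      (\<exists>d. (b, d) \<in> r \<and> (c, d) \<in> r \<and> fob (t b d) x = fob (t c d) y)" by blast
qed

definition lift1 :: "('i \<Rightarrow> 'u \<Rightarrow> 'v) \<Rightarrow> 'u \<Rightarrow> 'v" where
  "lift1 g z = (SOME v. \<exists>b \<alpha>. b \<in> Field r \<and> \<alpha> \<in> arr (X b) \<and> z = cl b \<alpha> \<and> v = g b \<alpha>)"

text \<open>\<open>R\<close> says on which pairs at a common stage the operation makes sense.
  Representatives of composable germs may become composable only at a later stage, so the choice
  ranges over good pairs.\<close>

definition lift2 :: "('i \<Rightarrow> 'u \<Rightarrow> 'u \<Rightarrow> bool) \<Rightarrow> ('i \<Rightarrow> 'u \<Rightarrow> 'u \<Rightarrow> 'v) \<Rightarrow> 'u \<Rightarrow> 'u \<Rightarrow> 'v" where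
  "lift2 R g z w = (SOME v. \<exists>b \<alpha> \<beta>. b \<in> Field r \<and> \<alpha> \<in> arr (X b) \<and> \<beta> \<in> arr (X b) \<and> R b \<alpha> \<beta> \<and>
     z = cl b \<alpha> \<and> w = cl b \<beta> \<and> v = g b \<alpha> \<beta>)"

text \<open>Any two pairs of representatives of the same germs coincide at a later stage, so
  independence of the choice follows from invariance under transition functors.\<close>

lemma lift2_cl:
  assumes R: "\<And>b c \<alpha> \<beta>. (b, c) \<in> r \<Longrightarrow> \<alpha> \<in> arr (X b) \<Longrightarrow> \<beta> \<in> arr (X b) \<Longrightarrow> R b \<alpha> \<beta> \<Longrightarrow>
      g c (far (t b c) \<alpha>) (far (t b c) \<beta>) = g b \<alpha> \<beta>"
    and b: "b \<in> Field r" "\<alpha> \<in> arr (X b)" "\<beta> \<in> arr (X b)" "R b \<alpha> \<beta>"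
  shows "lift2 R g (cl b \<alpha>) (cl b \<beta>) = g b \<alpha> \<beta>"
  unfolding lift2_def
proof (rule some_equality)
  fix v
  assume "\<exists>c \<alpha>' \<beta>'. c \<in> Field r \<and> \<alpha>' \<in> arr (X c) \<and> \<beta>' \<in> arr (X c) \<and> R c \<alpha>' \<beta>' \<and>
     cl b \<alpha> = cl c \<alpha>' \<and> cl b \<beta> = cl c \<beta>' \<and> v = g c \<alpha>' \<beta>'"
  then obtain c \<alpha>' \<beta>' where c: "c \<in> Field r" "\<alpha>' \<in> arr (X c)" "\<beta>' \<in> arr (X c)" "R c \<alpha>' \<beta>'"
    "cl b \<alpha> = cl c \<alpha>'" "cl b \<beta> = cl c \<beta>'" and v: "v = g c \<alpha>' \<beta>'" by blast
  obtain d where d: "(b, d) \<in> r" "(c, d) \<in> r" "far (t b d) \<alpha> = far (t c d) \<alpha>'"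
    using c b by (auto simp: cl_eq eqv_def)
  obtain e where e: "(b, e) \<in> r" "(c, e) \<in> r" "far (t b e) \<beta> = far (t c e) \<beta>'"
    using c b by (auto simp: cl_eq eqv_def)
  obtain f where f: "(d, f) \<in> r" "(e, f) \<in> r" using bound2[of d e] r_Field d e by blast
  have "far (t b f) \<alpha> = far (t c f) \<alpha>'"
    using t_t[OF d(1) f(1) b(2)] t_t[OF d(2) f(1) c(2)] d(3) by simp
  moreover have "far (t b f) \<beta> = far (t c f) \<beta>'"
    using t_t[OF e(1) f(2) b(3)] t_t[OF e(2) f(2) c(3)] e(3) by simp
  ultimately show "v = g b \<alpha> \<beta>"
    using R[of b f \<alpha> \<beta>] R[of c f \<alpha>' \<beta>'] b c v r_trans[OF d(1) f(1)] r_trans[OF d(2) f(1)] by simp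
qed (use b in blast)

lemma lift1_cl:
  assumes R: "\<And>b c \<alpha>. (b, c) \<in> r \<Longrightarrow> \<alpha> \<in> arr (X b) \<Longrightarrow> g c (far (t b c) \<alpha>) = g b \<alpha>"
    and b: "b \<in> Field r" "\<alpha> \<in> arr (X b)"
  shows "lift1 g (cl b \<alpha>) = g b \<alpha>"
proof -
  have "lift1 g (cl b \<alpha>) = lift2 (\<lambda>b \<alpha> \<beta>. \<alpha> = \<beta>) (\<lambda>b \<alpha> \<beta>. g b \<alpha>) (cl b \<alpha>) (cl b \<alpha>)"
    by (auto simp: lift1_def lift2_def intro!: arg_cong[where f=Eps])
  also have "\<dots> = g b \<alpha>" by (rule lift2_cl) (use R b in auto)
  finally show ?thesis .
qed

text \<open>Objects are identity germs, so \<open>ide\<close> is the identity map, and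
  \<open>zero\<close> reads objects at a stage as sources of representatives. The norm is the
  largest one for which the maps from the stages are contractive.\<close>

definition colim :: "'u small_star_cat" where
  "colim = \<lparr>
     obj = {oc b x | b x. b \<in> Field r \<and> x \<in> obj (X b)},
     arr = {cl b \<alpha> | b \<alpha>. b \<in> Field r \<and> \<alpha> \<in> arr (X b)},
     src = lift1 (\<lambda>b \<alpha>. oc b (src (X b) \<alpha>)),
     tgt = lift1 (\<lambda>b \<alpha>. oc b (tgt (X b) \<alpha>)),
     ide = (\<lambda>x. x),
     cmp = lift2 (\<lambda>b \<beta> \<alpha>. src (X b) \<beta> = tgt (X b) \<alpha>) (\<lambda>b \<beta> \<alpha>. cl b (cmp (X b) \<beta> \<alpha>)),
     zero = lift2 (\<lambda>b \<alpha> \<beta>. True) (\<lambda>b \<alpha> \<beta>. cl b (zero (X b) (src (X b) \<alpha>) (src (X b) \<beta>))),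
     add = lift2 (\<lambda>b \<alpha> \<beta>. src (X b) \<alpha> = src (X b) \<beta> \<and> tgt (X b) \<alpha> = tgt (X b) \<beta>)
       (\<lambda>b \<alpha> \<beta>. cl b (add (X b) \<alpha> \<beta>)),
     scale = (\<lambda>k. lift1 (\<lambda>b \<alpha>. cl b (scale (X b) k \<alpha>))),
     star = lift1 (\<lambda>b \<alpha>. cl b (star (X b) \<alpha>)),
     nrm = (\<lambda>z. Inf {nrm (X b) \<alpha> | b \<alpha>. b \<in> Field r \<and> \<alpha> \<in> arr (X b) \<and> z = cl b \<alpha>})\<rparr>"

section \<open>Operations on germs computed at a stage\<close>

lemma colim_src: "b \<in> Field r \<Longrightarrow> \<alpha> \<in> arr (X b) \<Longrightarrow> src colim (cl b \<alpha>) = oc b (src (X b) \<alpha>)"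
  unfolding colim_def by simp (rule lift1_cl, auto simp: t_src oc_t src_obj r_Field)

lemma colim_tgt: "b \<in> Field r \<Longrightarrow> \<alpha> \<in> arr (X b) \<Longrightarrow> tgt colim (cl b \<alpha>) = oc b (tgt (X b) \<alpha>)"
  unfolding colim_def by simp (rule lift1_cl, auto simp: t_tgt oc_t tgt_obj r_Field)

lemma colim_hom: "b \<in> Field r \<Longrightarrow> \<alpha> \<in> hom (X b) x y \<Longrightarrow> cl b \<alpha> \<in> hom colim (oc b x) (oc b y)"
  by (auto simp: hom_def colim_src colim_tgt) (auto simp: colim_def)

lemma colim_ide: "ide colim x = x"
  by (simp add: colim_def)

lemma colim_cmp:
  assumes b: "b \<in> Field r" and f: "\<alpha> \<in> hom (X b) x y" and g: "\<beta> \<in> hom (X b) y z"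
  shows "cmp colim (cl b \<beta>) (cl b \<alpha>) = cl b (cmp (X b) \<beta> \<alpha>)"
proof -
  have [simp]: "cmp (X b) \<beta> \<alpha> \<in> arr (X b)"
    if "b \<in> Field r" "\<alpha> \<in> arr (X b)" "\<beta> \<in> arr (X b)" "src (X b) \<beta> = tgt (X b) \<alpha>" for b \<alpha> \<beta>
    using category.cmp_hom[OF X_category[OF that(1)]] that by (auto simp: hom_def)
  have "cl c (cmp (X c) (far (t b c) \<beta>) (far (t b c) \<alpha>)) = cl b (cmp (X b) \<beta> \<alpha>)"
    if "(b, c) \<in> r" "\<alpha> \<in> arr (X b)" "\<beta> \<in> arr (X b)" "src (X b) \<beta> = tgt (X b) \<alpha>" for b c \<alpha> \<beta>
    using cl_t[OF that(1), of "cmp (X b) \<beta> \<alpha>"] that by (simp add: t_cmp r_Field)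
  then show ?thesis
    using b f g unfolding colim_def by simp (rule lift2_cl, auto simp: hom_def)
qed

lemma colim_zero:
  assumes b: "b \<in> Field r" and x: "x \<in> obj (X b)" and y: "y \<in> obj (X b)"
  shows "zero colim (oc b x) (oc b y) = cl b (zero (X b) x y)"
proof -
  have z: "zero (X b) x y \<in> arr (X b)" if "b \<in> Field r" "x \<in> obj (X b)" "y \<in> obj (X b)" for b x y
    using linear_category.zero_hom[OF X_lin[OF that(1)] that(2,3)] by (simp add: hom_def)
  have "cl c (zero (X c) (src (X c) (far (t b c) \<alpha>)) (src (X c) (far (t b c) \<beta>))) =
      cl b (zero (X b) (src (X b) \<alpha>) (src (X b) \<beta>))"
    if "(b, c) \<in> r" "\<alpha> \<in> arr (X b)" "\<beta> \<in> arr (X b)" for b c \<alpha> \<beta>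
    using cl_t[OF that(1) z, of "src (X b) \<alpha>" "src (X b) \<beta>"] that
    by (simp add: t_src t_zero r_Field src_obj)
  then have "lift2 (\<lambda>b \<alpha> \<beta>. True) (\<lambda>b \<alpha> \<beta>. cl b (zero (X b) (src (X b) \<alpha>) (src (X b) \<beta>)))
      (cl b (ide (X b) x)) (cl b (ide (X b) y)) = cl b
        (zero (X b) (src (X b) (ide (X b) x)) (src (X b) (ide (X b) y)))"
    using assms by (intro lift2_cl) (auto simp: ide_arr)
  then show ?thesis using assms by (simp add: colim_def oc_def ide_src)
qed

lemma colim_add:
  assumes b: "b \<in> Field r" and f: "\<alpha> \<in> hom (X b) x y" and g: "\<beta> \<in> hom (X b) x y"
  shows "add colim (cl b \<alpha>) (cl b \<beta>) = cl b (add (X b) \<alpha> \<beta>)"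
proof -
  have [simp]: "add (X b) \<alpha> \<beta> \<in> arr (X b)"
    if "b \<in> Field r" "\<alpha> \<in> arr (X b)" "\<beta> \<in> arr (X b)" "src (X b) \<alpha> = src (X b) \<beta>"
      "tgt (X b) \<alpha> = tgt (X b) \<beta>" for b \<alpha> \<beta>
    using linear_category.add_hom[OF X_lin[OF that(1)], of \<alpha> "src (X b) \<alpha>" "tgt (X b) \<alpha>" \<beta>] that
    by (auto simp: hom_def)
  have "cl c (add (X c) (far (t b c) \<alpha>) (far (t b c) \<beta>)) = cl b (add (X b) \<alpha> \<beta>)"
    if "(b, c) \<in> r" "\<alpha> \<in> arr (X b)" "\<beta> \<in> arr (X b)" "src (X b) \<alpha> = src (X b) \<beta>"
      "tgt (X b) \<alpha> = tgt (X b) \<beta>" for b c \<alpha> \<beta>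
    using cl_t[OF that(1), of "add (X b) \<alpha> \<beta>"] that by (simp add: t_add r_Field)
  then show ?thesis
    using b f g unfolding colim_def by simp (rule lift2_cl, auto simp: hom_def)
qed

lemma colim_scale:
  assumes b: "b \<in> Field r" and f: "\<alpha> \<in> arr (X b)" and k: "k \<in> K"
  shows "scale colim k (cl b \<alpha>) = cl b (scale (X b) k \<alpha>)"
proof -
  have [simp]: "scale (X b) k \<alpha> \<in> arr (X b)" if "b \<in> Field r" "\<alpha> \<in> arr (X b)" for b \<alpha>
    using linear_category.scale_hom[OF X_lin[OF that(1)] k, of \<alpha>] that by (auto simp: hom_def)
  have "cl c (scale (X c) k (far (t b c) \<alpha>)) = cl b (scale (X b) k \<alpha>)"
    if "(b, c) \<in> r" "\<alpha> \<in> arr (X b)" for b c \<alpha>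
    using cl_t[OF that(1), of "scale (X b) k \<alpha>"] that k by (simp add: t_scale r_Field)
  then show ?thesis
    using b f unfolding colim_def by simp (rule lift1_cl, auto)
qed

lemma colim_star:
  assumes b: "b \<in> Field r" and f: "\<alpha> \<in> arr (X b)"
  shows "star colim (cl b \<alpha>) = cl b (star (X b) \<alpha>)"
proof -
  have [simp]: "star (X b) \<alpha> \<in> arr (X b)" if "b \<in> Field r" "\<alpha> \<in> arr (X b)" for b \<alpha>
    using star_category.star_hom[OF X_star[OF that(1)], of \<alpha>] that by (auto simp: hom_def)
  have "cl c (star (X c) (far (t b c) \<alpha>)) = cl b (star (X b) \<alpha>)"
    if "(b, c) \<in> r" "\<alpha> \<in> arr (X b)" for b c \<alpha>
    using cl_t[OF that(1), of "star (X b) \<alpha>"] that by (simp add: t_star r_Field)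
  then show ?thesis
    using b f unfolding colim_def by simp (rule lift1_cl, auto)
qed

section \<open>Norms of germs are attained\<close>

lemma colim_nrm_le:
  assumes b: "b \<in> Field r" "\<alpha> \<in> arr (X b)"
  shows "nrm colim (cl b \<alpha>) \<le> nrm (X b) \<alpha>"
proof -
  have "bdd_below {nrm (X c) \<beta> | c \<beta>. c \<in> Field r \<and> \<beta> \<in> arr (X c) \<and> cl b \<alpha> = cl c \<beta>}"
    using cstar_category.nrm_nonneg[OF X_cs] by (intro bdd_belowI[of _ 0]) (auto simp: hom_def)
  then show ?thesis using b unfolding colim_def by (auto intro!: cInf_lower)
qed

text \<open>Representatives within \<open>1 / Suc n\<close> of the infimum meet the images of
  \<alpha> at stages \<open>e n\<close>. At a bound of these stages, contractivity gives all the
  estimates at once.\<close>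

lemma colim_nrm_attained:
  assumes b: "b \<in> Field r" "\<alpha> \<in> arr (X b)"
  shows "\<exists>d. (b, d) \<in> r \<and> nrm (X d) (far (t b d) \<alpha>) = nrm colim (cl b \<alpha>)"
proof -
  let ?S = "{nrm (X c) \<beta> | c \<beta>. c \<in> Field r \<and> \<beta> \<in> arr (X c) \<and> cl b \<alpha> = cl c \<beta>}"
  have inf: "nrm colim (cl b \<alpha>) = Inf ?S" by (simp add: colim_def)
  have ne: "?S \<noteq> {}" using b by blast
  have ex: "\<exists>c \<beta> e. c \<in> Field r \<and> \<beta> \<in> arr (X c) \<and> nrm (X c) \<beta> < Inf ?S + 1 / Suc n \<and>
      (b, e) \<in> r \<and> (c, e) \<in> r \<and> far (t b e) \<alpha> = far (t c e) \<beta>" for n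
  proof -
    have "\<exists>s\<in>?S. s < Inf ?S + 1 / Suc n"
      by (rule cInf_lessD[OF ne]) simp
    then obtain c \<beta> where c: "c \<in> Field r" "\<beta> \<in> arr (X c)" "cl b \<alpha> = cl c \<beta>"
      "nrm (X c) \<beta> < Inf ?S + 1 / Suc n"
      by blast
    then show ?thesis using b by (auto simp: cl_eq eqv_def)
  qed
  define I where "I = Inf ?S"
  have "\<exists>c \<beta> e. c \<in> Field r \<and> \<beta> \<in> arr (X c) \<and> nrm (X c) \<beta> < I + 1 / Suc n \<and>
      (b, e) \<in> r \<and> (c, e) \<in> r \<and> far (t b e) \<alpha> = far (t c e) \<beta>" for n
    using ex[of n] unfolding I_def .
  then obtain c \<beta> e where c: "\<And>n. c n \<in> Field r" "\<And>n. \<beta> n \<in> arr (X (c n))"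
    "\<And>n. nrm (X (c n)) (\<beta> n) < I + 1 / Suc n"
    and e: "\<And>n. (b, e n) \<in> r" "\<And>n. (c n, e n) \<in> r" "\<And>n. far (t b (e n)) \<alpha> = far (t (c n) (e n)) (\<beta> n)"
    by metis
  obtain d where d: "d \<in> Field r" "\<And>n. (e n, d) \<in> r"
    using bound[of e] e(1) r_Field by blast
  have bd: "(b, d) \<in> r" using r_trans e(1) d(2) by blast
  have "nrm (X d) (far (t b d) \<alpha>) \<le> I + 1 / Suc n" for n
  proof -
    have "far (t b d) \<alpha> = far (t (c n) d) (\<beta> n)"
      using t_t[OF e(1) d(2) b(2)] t_t[OF e(2) d(2) c(2)] e(3) by metis
    then show ?thesis using t_nrm[OF r_trans[OF e(2) d(2)] c(2), of n] c(3)[of n] by simp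
  qed
  then have "nrm (X d) (far (t b d) \<alpha>) \<le> I"
    using LIMSEQ_inverse_real_of_nat_add[of "I"]
    by (intro LIMSEQ_le_const[of _ "I"]) (auto simp: inverse_eq_divide)
  moreover have "nrm colim (cl b \<alpha>) \<le> nrm (X d) (far (t b d) \<alpha>)"
    using colim_nrm_le[OF d(1) t_arr[OF bd b(2)]] cl_t[OF bd b(2)] by simp
  ultimately show ?thesis using bd inf I_def by auto
qed

text \<open>Beyond the stage where a norm is attained it stays constant: it cannot grow, nor fall
  below the norm of the germ. So a bound of all these stages works.\<close>

lemma colim_nrm_stable:
  fixes \<alpha> :: "nat \<Rightarrow> 'u"
  assumes b: "b \<in> Field r" and a: "\<And>n. \<alpha> n \<in> arr (X b)"
  shows "\<exists>d. (b, d) \<in> r \<and> (\<forall>n. nrm (X d) (far (t b d) (\<alpha> n)) = nrm colim (cl b (\<alpha> n)))"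
proof -
  obtain c where c: "\<And>n. (b, c n) \<in> r" "\<And>n. nrm (X (c n)) (far (t b (c n)) (\<alpha> n)) = nrm colim
    (cl b (\<alpha> n))"
    using colim_nrm_attained[OF b a] by metis
  obtain d where d: "d \<in> Field r" "\<And>n. (c n, d) \<in> r"
    using bound[of c] c r_Field by blast
  have bd: "(b, d) \<in> r" using r_trans c(1) d(2) by blast
  have "nrm (X d) (far (t b d) (\<alpha> n)) = nrm colim (cl b (\<alpha> n))" for n
  proof (rule antisym)
    show "nrm (X d) (far (t b d) (\<alpha> n)) \<le> nrm colim (cl b (\<alpha> n))"
      using t_nrm[OF d(2) t_arr[OF c(1) a], of n n] t_t[OF c(1) d(2) a, of n n] c(2)[of n] by simp
    show "nrm colim (cl b (\<alpha> n)) \<le> nrm (X d) (far (t b d) (\<alpha> n))"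
      using colim_nrm_le[OF d(1) t_arr[OF bd a], of n] cl_t[OF bd a, of n] by simp
  qed
  then show ?thesis using bd by blast
qed

section \<open>Lifting arrows of the colimit to one stage\<close>

lemma colim_obj_cases:
  assumes "x \<in> obj colim" obtains b \<xi> where "b \<in> Field r" "\<xi> \<in> obj (X b)" "x = oc b \<xi>"
  using assms by (auto simp: colim_def)

lemma colim_arr_cases:
  assumes "a \<in> arr colim" obtains b \<alpha> where "b \<in> Field r" "\<alpha> \<in> arr (X b)" "a = cl b \<alpha>"
  using assms by (auto simp: colim_def)

lemma oc_obj: "b \<in> Field r \<Longrightarrow> x \<in> obj (X b) \<Longrightarrow> oc b x \<in> obj colim"
  by (auto simp: colim_def)

text \<open>The point is that \<sigma> depends on the object and not on the index: arrows that are
  parallel or composable in the colimit get lifts that are parallel or composable.\<close>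

lemma colim_lift:
  fixes a x y :: "nat \<Rightarrow> 'u"
  assumes a: "\<And>n. a n \<in> hom colim (x n) (y n)"
  shows "\<exists>d \<in> Field r. \<exists>\<sigma> \<alpha>. \<forall>n. \<alpha> n \<in> hom (X d) (\<sigma> (x n)) (\<sigma> (y n)) \<and> a n = cl d (\<alpha> n)"
proof -
  have "\<exists>b \<alpha>. b \<in> Field r \<and> \<alpha> \<in> arr (X b) \<and> a n = cl b \<alpha>" for n
    using a[of n] colim_arr_cases[of "a n"] by (metis (mono_tags, lifting) hom_def mem_Collect_eq)
  then obtain b \<alpha> where b: "\<And>n. b n \<in> Field r" "\<And>n. \<alpha> n \<in> arr (X (b n))" "\<And>n. a n = cl (b n) (\<alpha> n)"
    by metis
  have x: "x n = oc (b n) (src (X (b n)) (\<alpha> n))" "y n = oc (b n) (tgt (X (b n)) (\<alpha> n))" for n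
    using a[of n] b[of n] by (auto simp: hom_def colim_src colim_tgt)
  \<comment> \<open>One representative is fixed for each object that occurs, at one of the stages
    \<open>b n\<close>, so that a bound of these stages also covers the objects.\<close>
  have "\<exists>c \<xi>. z \<in> range x \<union> range y \<longrightarrow> c \<in> range b \<and> \<xi> \<in> obj (X c) \<and> z = oc c \<xi>" for z
  proof (cases "z \<in> range x \<union> range y")
    case True
    then obtain n where "z = x n \<or> z = y n" by auto
    then show ?thesis
      using x[of n] src_obj[OF b(1,2), of n] tgt_obj[OF b(1,2), of n] by (metis rangeI)
  qed simp
  then obtain c \<xi> where c: "\<And>z. z \<in> range x \<union> range y \<Longrightarrow> c z \<in> range b"
    "\<And>z. z \<in> range x \<union> range y \<Longrightarrow> \<xi> z \<in> obj (X (c z))"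
    "\<And>z. z \<in> range x \<union> range y \<Longrightarrow> z = oc (c z) (\<xi> z)" by metis
  obtain e where e: "e \<in> Field r" "\<And>n. (b n, e) \<in> r" using bound[of b] b(1) by blast
  have ce: "(c z, e) \<in> r" if "z \<in> range x \<union> range y" for z using c(1)[OF that] e(2) by auto
  define \<tau> where "\<tau> z = fob (t (c z) e) (\<xi> z)" for z
  have \<tau>: "\<tau> z \<in> obj (X e)" "z = oc e (\<tau> z)" if "z \<in> range x \<union> range y" for z
    unfolding \<tau>_def using t_obj[OF ce[OF that] c(2)[OF that]] oc_t[OF ce[OF that] c(2)[OF that]]
      c(3)[OF that] by simp_all
  define \<beta> where "\<beta> n = far (t (b n) e) (\<alpha> n)" for n
  have \<beta>: "\<beta> n \<in> arr (X e)" "a n = cl e (\<beta> n)" for n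
    unfolding \<beta>_def using t_arr[OF e(2) b(2)] cl_t[OF e(2) b(2)] b(3) by simp_all
  \<comment> \<open>The source of \<open>\<beta> n\<close> and the chosen representative of
    \<open>x n\<close> have the same germ, but they coincide only at a later stage depending on
    \<open>n\<close>; likewise for targets.\<close>
  have *: "\<exists>f. (e, f) \<in> r \<and> fob (t e f) (src (X e) (\<beta> n)) = fob (t e f) (\<tau> (x n))"
    "\<exists>f. (e, f) \<in> r \<and> fob (t e f) (tgt (X e) (\<beta> n)) = fob (t e f) (\<tau> (y n))" for n
  proof -
    have "oc e (src (X e) (\<beta> n)) = oc e (\<tau> (x n))" "oc e (tgt (X e) (\<beta> n)) = oc e (\<tau> (y n))"
      using a[of n] \<beta>[of n] \<tau>(2)[of "x n"] \<tau>(2)[of "y n"] e(1)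
        by (auto simp: hom_def colim_src colim_tgt)
    then show "\<exists>f. (e, f) \<in> r \<and> fob (t e f) (src (X e) (\<beta> n)) = fob (t e f) (\<tau> (x n))"
      "\<exists>f. (e, f) \<in> r \<and> fob (t e f) (tgt (X e) (\<beta> n)) = fob (t e f) (\<tau> (y n))"
      using oc_eq[OF e(1) src_obj[OF e(1) \<beta>(1)] e(1) \<tau>(1)]
        oc_eq[OF e(1) tgt_obj[OF e(1) \<beta>(1)] e(1) \<tau>(1)] by auto
  qed
  obtain f where f: "\<And>n. (e, f n) \<in> r" "\<And>n. fob (t e (f n)) (src (X e) (\<beta> n)) = fob (t e (f n))
    (\<tau> (x n))"
    using *(1) by metis
  obtain g where g: "\<And>n. (e, g n) \<in> r" "\<And>n. fob (t e (g n)) (tgt (X e) (\<beta> n)) = fob (t e (g n))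
    (\<tau> (y n))"
    using *(2) by metis
  obtain f' where f': "\<And>n. (f n, f') \<in> r" using bound[of f] r_Field(2)[OF f(1)] by blast
  obtain g' where g': "\<And>n. (g n, g') \<in> r" using bound[of g] r_Field(2)[OF g(1)] by blast
  obtain d where d: "d \<in> Field r" "(f', d) \<in> r" "(g', d) \<in> r"
    using bound2[OF r_Field(2)[OF f'] r_Field(2)[OF g']] by blast
  have fd: "(f n, d) \<in> r" and gd: "(g n, d) \<in> r" for n using r_trans[OF f' d(2)] r_trans[OF g' d(3)]
    by simp_all
  have ed: "(e, d) \<in> r" using r_trans[OF f(1) fd] .
  define \<sigma> where "\<sigma> z = fob (t e d) (\<tau> z)" for z
  have "far (t e d) (\<beta> n) \<in> hom (X d) (\<sigma> (x n)) (\<sigma> (y n)) \<and> a n = cl d (far (t e d) (\<beta> n))" for n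
  proof -
    have "fob (t e d) (src (X e) (\<beta> n)) = \<sigma> (x n)"
      using t_fob_t[OF f(1) fd src_obj[OF e(1) \<beta>(1)]] t_fob_t[OF f(1) fd \<tau>(1)] f(2) unfolding \<sigma>_def
        by (metis UnI1 rangeI)
    moreover have "fob (t e d) (tgt (X e) (\<beta> n)) = \<sigma> (y n)"
      using t_fob_t[OF g(1) gd tgt_obj[OF e(1) \<beta>(1)]] t_fob_t[OF g(1) gd \<tau>(1)] g(2) unfolding \<sigma>_def
        by (metis UnI2 rangeI)
    ultimately show ?thesis
      using t_arr[OF ed \<beta>(1)] t_src[OF ed \<beta>(1)] t_tgt[OF ed \<beta>(1)] cl_t[OF ed \<beta>(1)] \<beta>(2)
        by (simp add: hom_def)
  qed
  then show ?thesis using d(1)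
    by (intro bexI[of _ d] exI[of _ \<sigma>] exI[of _ "\<lambda>n. far (t e d) (\<beta> n)"]) auto
qed

text \<open>The algebraic axioms involve at most three arrows, so each of them can be checked at a
  single stage.\<close>

lemma colim_lift3:
  assumes "a \<in> hom colim x x'" "b \<in> hom colim y y'" "c \<in> hom colim z z'"
  obtains d \<sigma> \<alpha> \<beta> \<gamma> where "d \<in> Field r"
    "\<alpha> \<in> hom (X d) (\<sigma> x) (\<sigma> x')" "\<beta> \<in> hom (X d) (\<sigma> y) (\<sigma> y')" "\<gamma> \<in> hom (X d) (\<sigma> z) (\<sigma> z')"
    "a = cl d \<alpha>" "b = cl d \<beta>" "c = cl d \<gamma>"
    "oc d (\<sigma> x) = x" "oc d (\<sigma> x') = x'" "oc d (\<sigma> y) = y" "oc d (\<sigma> y') = y'" "oc d (\<sigma> z) = z"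
      "oc d (\<sigma> z') = z'"
proof -
  \<comment> \<open>The three arrows are the start of a sequence that is constant from index 2
    on.\<close>
  define f where "f p q s n = (if n = (0::nat) then p else if n = 1 then q else s)" for p q s :: 'u
    and n
  have "f a b c n \<in> hom colim (f x y z n) (f x' y' z' n)" for n using assms by (simp add: f_def)
  from colim_lift[of "f a b c" "f x y z" "f x' y' z'", OF this] obtain d \<sigma> \<alpha> where d: "d \<in> Field r"
    and
    h: "\<And>n. \<alpha> n \<in> hom (X d) (\<sigma> (f x y z n)) (\<sigma> (f x' y' z' n)) \<and> f a b c n = cl d (\<alpha> n)" by blast
  have "\<alpha> 0 \<in> hom (X d) (\<sigma> x) (\<sigma> x')" "\<alpha> 1 \<in> hom (X d) (\<sigma> y) (\<sigma> y')" "\<alpha> 2 \<in> hom (X d) (\<sigma> z) (\<sigma> z')"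
    "a = cl d (\<alpha> 0)" "b = cl d (\<alpha> 1)" "c = cl d (\<alpha> 2)"
    using h[of 0] h[of 1] h[of 2] by (simp_all add: f_def)
  moreover from this have "oc d (\<sigma> x) = x" "oc d (\<sigma> x') = x'" "oc d (\<sigma> y) = y" "oc d (\<sigma> y') = y'"
    "oc d (\<sigma> z) = z" "oc d (\<sigma> z') = z'"
    using assms colim_hom[OF d] by (fastforce simp: hom_def)+
  ultimately show ?thesis using d that by blast
qed

lemma colim_lift2:
  assumes a: "a \<in> hom colim x x'" and b: "b \<in> hom colim y y'"
  obtains d \<sigma> \<alpha> \<beta> where "d \<in> Field r"
    "\<alpha> \<in> hom (X d) (\<sigma> x) (\<sigma> x')" "\<beta> \<in> hom (X d) (\<sigma> y) (\<sigma> y')"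
    "a = cl d \<alpha>" "b = cl d \<beta>"
    "oc d (\<sigma> x) = x" "oc d (\<sigma> x') = x'" "oc d (\<sigma> y) = y" "oc d (\<sigma> y') = y'"
  by (rule colim_lift3[OF a b b]) (rule that)

lemma colim_lift1:
  assumes a: "a \<in> hom colim x x'"
  obtains d \<sigma> \<alpha> where "d \<in> Field r" "\<alpha> \<in> hom (X d) (\<sigma> x) (\<sigma> x')" "a = cl d \<alpha>"
    "oc d (\<sigma> x) = x" "oc d (\<sigma> x') = x'"
  by (rule colim_lift3[OF a a a]) (rule that)

lemma colim_sub:
  assumes b: "b \<in> Field r" and f: "\<alpha> \<in> hom (X b) x y" and g: "\<beta> \<in> hom (X b) x y"
  shows "sub colim (cl b \<alpha>) (cl b \<beta>) = cl b (sub (X b) \<alpha> \<beta>)"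
proof -
  interpret B: real_cstar_category K "X b" by (rule X_cstar[OF b])
  show ?thesis
    using colim_add[OF b f B.scale_hom[OF _ g]] colim_scale[OF b B.hom_arr[OF g]]
      by (simp add: sub_def)
qed

section \<open>The C*-category axioms for the colimit\<close>

lemma colim_category: "category colim"
proof
  fix f assume "f \<in> arr colim"
  then show "src colim f \<in> obj colim" "tgt colim f \<in> obj colim"
    by (auto elim!: colim_arr_cases simp: colim_src colim_tgt intro!: oc_obj src_obj tgt_obj)
next
  fix x assume "x \<in> obj colim"
  then show "ide colim x \<in> hom colim x x"
    using colim_hom[OF _ category.ide_hom[OF X_category]]
    by (auto elim!: colim_obj_cases simp: colim_ide) (simp add: oc_def)
next
  fix f g x y z assume "f \<in> hom colim x y" "g \<in> hom colim y z"
  then obtain d \<sigma> \<alpha> \<beta> where d: "d \<in> Field r" and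
    h: "\<alpha> \<in> hom (X d) (\<sigma> x) (\<sigma> y)" "\<beta> \<in> hom (X d) (\<sigma> y) (\<sigma> z)" "f = cl d \<alpha>" "g = cl d \<beta>"
    "oc d (\<sigma> x) = x" "oc d (\<sigma> z) = z"
    by (rule colim_lift2) blast
  interpret D: real_cstar_category K "X d" by (rule X_cstar[OF d])
  show "cmp colim g f \<in> hom colim x z"
    using colim_cmp[OF d h(1,2)] colim_hom[OF d D.cmp_hom[OF h(1,2)]] h by simp
next
  fix f x y assume "f \<in> hom colim x y"
  then obtain d \<sigma> \<alpha> where d: "d \<in> Field r" and h: "\<alpha> \<in> hom (X d) (\<sigma> x) (\<sigma> y)" "f = cl d \<alpha>"
    "oc d (\<sigma> x) = x" "oc d (\<sigma> y) = y"
    by (rule colim_lift1) blast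
  interpret D: real_cstar_category K "X d" by (rule X_cstar[OF d])
  note o = D.hom_obj[OF h(1)]
  have "cmp colim f (oc d (\<sigma> x)) = f" "cmp colim (oc d (\<sigma> y)) f = f"
    using colim_cmp[OF d D.ide_hom[OF o(1)] h(1)] colim_cmp[OF d h(1) D.ide_hom[OF o(2)]]
      D.cmp_ide[OF h(1)] D.ide_cmp[OF h(1)] h(2) by (simp_all add: oc_def)
  then show "cmp colim f (ide colim x) = f" "cmp colim (ide colim y) f = f"
    using h by (simp_all add: colim_ide)
next
  fix f g h w x y z assume "f \<in> hom colim w x" "g \<in> hom colim x y" "h \<in> hom colim y z"
  then obtain d \<sigma> \<alpha> \<beta> \<gamma> where d: "d \<in> Field r" and
    h: "\<alpha> \<in> hom (X d) (\<sigma> w) (\<sigma> x)" "\<beta> \<in> hom (X d) (\<sigma> x) (\<sigma> y)" "\<gamma> \<in> hom (X d) (\<sigma> y) (\<sigma> z)"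
    "f = cl d \<alpha>" "g = cl d \<beta>" "h = cl d \<gamma>"
    by (rule colim_lift3) blast
  interpret D: real_cstar_category K "X d" by (rule X_cstar[OF d])
  show "cmp colim h (cmp colim g f) = cmp colim (cmp colim h g) f"
    using colim_cmp[OF d h(1,2)] colim_cmp[OF d h(2,3)] colim_cmp[OF d D.cmp_hom[OF h(1,2)] h(3)]
      colim_cmp[OF d h(1) D.cmp_hom[OF h(2,3)]] D.cmp_assoc[OF h(1-3)] h(4-6) by simp
qed

lemma colim_obj_hom: "x \<in> obj colim \<Longrightarrow> x \<in> hom colim x x"
  using category.ide_hom[OF colim_category] by (simp add: colim_ide)

lemma colim_linear: "linear_category K colim"
proof (intro linear_category.intro colim_category linear_category_axioms.intro)
  fix x y assume "x \<in> obj colim" "y \<in> obj colim"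
  then have "x \<in> hom colim x x" "y \<in> hom colim y y" by (simp_all add: colim_obj_hom)
  then obtain d \<sigma> \<alpha> \<beta> where d: "d \<in> Field r" and h: "\<alpha> \<in> hom (X d) (\<sigma> x) (\<sigma> x)"
    "\<beta> \<in> hom (X d) (\<sigma> y) (\<sigma> y)"
    "oc d (\<sigma> x) = x" "oc d (\<sigma> y) = y"
    by (rule colim_lift2) blast
  interpret D: real_cstar_category K "X d" by (rule X_cstar[OF d])
  note o = D.hom_obj[OF h(1)] D.hom_obj[OF h(2)]
  show "zero colim x y \<in> hom colim x y"
    using colim_zero[OF d o(1) o(3)] colim_hom[OF d D.zero_hom[OF o(1) o(3)]] h by simp
next
  fix a b x y assume "a \<in> hom colim x y" "b \<in> hom colim x y"
  then obtain d \<sigma> \<alpha> \<beta> where d: "d \<in> Field r" and h: "\<alpha> \<in> hom (X d) (\<sigma> x) (\<sigma> y)"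
    "\<beta> \<in> hom (X d) (\<sigma> x) (\<sigma> y)"
    and e: "a = cl d \<alpha>" "b = cl d \<beta>" "oc d (\<sigma> x) = x" "oc d (\<sigma> y) = y"
    by (rule colim_lift2) blast
  interpret D: real_cstar_category K "X d" by (rule X_cstar[OF d])
  show "add colim a b \<in> hom colim x y"
    using colim_add[OF d h] colim_hom[OF d D.add_hom[OF h]] e by simp
  show "add colim a b = add colim b a"
    using colim_add[OF d h] colim_add[OF d h(2,1)] D.add_comm[OF h] e by simp
  fix k assume k: "k \<in> K"
  show "scale colim k (add colim a b) = add colim (scale colim k a) (scale colim k b)"
    using colim_add[OF d h] colim_scale[OF d D.hom_arr[OF h(1)] k]
      colim_scale[OF d D.hom_arr[OF h(2)] k]
      colim_scale[OF d D.hom_arr[OF D.add_hom[OF h]] k]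
        colim_add[OF d D.scale_hom[OF k h(1)] D.scale_hom[OF k h(2)]]
      D.scale_add[OF k h] e by simp
next
  fix a x y assume "a \<in> hom colim x y"
  then obtain d \<sigma> \<alpha> where d: "d \<in> Field r" and h: "\<alpha> \<in> hom (X d) (\<sigma> x) (\<sigma> y)"
    and e: "a = cl d \<alpha>" "oc d (\<sigma> x) = x" "oc d (\<sigma> y) = y"
    by (rule colim_lift1) blast
  interpret D: real_cstar_category K "X d" by (rule X_cstar[OF d])
  note o = D.hom_obj[OF h]
  show "add colim a (zero colim x y) = a"
    using colim_zero[OF d o] colim_add[OF d h D.zero_hom[OF o]] D.add_zero[OF h] e by simp
  show "sub colim a a = zero colim x y"
    using colim_zero[OF d o] colim_sub[OF d h h] D.sub_self[OF h] e by simp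
  show "scale colim 1 a = a"
    using colim_scale[OF d D.hom_arr[OF h], of 1] D.scale_one[OF h] e by simp
  fix k assume k: "k \<in> K"
  note sk = colim_scale[OF d D.hom_arr[OF h] k] D.scale_hom[OF k h]
  show "scale colim k a \<in> hom colim x y"
    using sk(1) colim_hom[OF d sk(2)] e by simp
  fix l assume l: "l \<in> K"
  note sl = colim_scale[OF d D.hom_arr[OF h] l] D.scale_hom[OF l h]
  show "scale colim k (scale colim l a) = scale colim (k * l) a"
    using sl(1) colim_scale[OF d D.hom_arr[OF sl(2)] k] D.scale_scale[OF k l h]
      colim_scale[OF d D.hom_arr[OF h] K_closed(1)[OF k l]] e by simp
  show "scale colim (k + l) a = add colim (scale colim k a) (scale colim l a)"
    using sl(1) sk(1) colim_add[OF d sk(2) sl(2)] D.add_scale[OF k l h]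
      colim_scale[OF d D.hom_arr[OF h] K_closed(2)[OF k l]] e by simp
next
  fix a b c x y assume "a \<in> hom colim x y" "b \<in> hom colim x y" "c \<in> hom colim x y"
  then obtain d \<sigma> \<alpha> \<beta> \<gamma> where d: "d \<in> Field r"
    and h: "\<alpha> \<in> hom (X d) (\<sigma> x) (\<sigma> y)" "\<beta> \<in> hom (X d) (\<sigma> x) (\<sigma> y)" "\<gamma> \<in> hom (X d) (\<sigma> x) (\<sigma> y)"
    and e: "a = cl d \<alpha>" "b = cl d \<beta>" "c = cl d \<gamma>"
    by (rule colim_lift3) blast
  interpret D: real_cstar_category K "X d" by (rule X_cstar[OF d])
  show "add colim (add colim a b) c = add colim a (add colim b c)"
    using colim_add[OF d h(1,2)] colim_add[OF d h(2,3)] colim_add[OF d D.add_hom[OF h(1,2)] h(3)]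
      colim_add[OF d h(1) D.add_hom[OF h(2,3)]] D.add_assoc[OF h] e by simp
next
  fix a a' b x y z assume "a \<in> hom colim x y" "a' \<in> hom colim x y" "b \<in> hom colim y z"
  then obtain d \<sigma> \<alpha> \<beta> \<gamma> where d: "d \<in> Field r"
    and h: "\<alpha> \<in> hom (X d) (\<sigma> x) (\<sigma> y)" "\<beta> \<in> hom (X d) (\<sigma> x) (\<sigma> y)" "\<gamma> \<in> hom (X d) (\<sigma> y) (\<sigma> z)"
    and e: "a = cl d \<alpha>" "a' = cl d \<beta>" "b = cl d \<gamma>"
    by (rule colim_lift3) blast
  interpret D: real_cstar_category K "X d" by (rule X_cstar[OF d])
  show "cmp colim b (add colim a a') = add colim (cmp colim b a) (cmp colim b a')"
    using colim_add[OF d h(1,2)] colim_cmp[OF d D.add_hom[OF h(1,2)] h(3)] colim_cmp[OF d h(1,3)]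
      colim_cmp[OF d h(2,3)]
      colim_add[OF d D.cmp_hom[OF h(1,3)] D.cmp_hom[OF h(2,3)]] D.cmp_add_right[OF h] e by simp
next
  fix a b b' x y z assume "a \<in> hom colim x y" "b \<in> hom colim y z" "b' \<in> hom colim y z"
  then obtain d \<sigma> \<alpha> \<beta> \<gamma> where d: "d \<in> Field r"
    and h: "\<alpha> \<in> hom (X d) (\<sigma> x) (\<sigma> y)" "\<beta> \<in> hom (X d) (\<sigma> y) (\<sigma> z)" "\<gamma> \<in> hom (X d) (\<sigma> y) (\<sigma> z)"
    and e: "a = cl d \<alpha>" "b = cl d \<beta>" "b' = cl d \<gamma>"
    by (rule colim_lift3) blast
  interpret D: real_cstar_category K "X d" by (rule X_cstar[OF d])
  show "cmp colim (add colim b b') a = add colim (cmp colim b a) (cmp colim b' a)"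
    using colim_add[OF d h(2,3)] colim_cmp[OF d h(1) D.add_hom[OF h(2,3)]] colim_cmp[OF d h(1,2)]
      colim_cmp[OF d h(1,3)]
      colim_add[OF d D.cmp_hom[OF h(1,2)] D.cmp_hom[OF h(1,3)]] D.cmp_add_left[OF h] e by simp
next
  fix l a b x y z assume l: "l \<in> K" and "a \<in> hom colim x y" "b \<in> hom colim y z"
  then obtain d \<sigma> \<alpha> \<beta> where d: "d \<in> Field r" and h: "\<alpha> \<in> hom (X d) (\<sigma> x) (\<sigma> y)"
    "\<beta> \<in> hom (X d) (\<sigma> y) (\<sigma> z)"
    and e: "a = cl d \<alpha>" "b = cl d \<beta>"
    by - (erule (1) colim_lift2, blast)
  interpret D: real_cstar_category K "X d" by (rule X_cstar[OF d])
  note s = colim_scale[OF d D.hom_arr[OF h(1)] l] colim_scale[OF d D.hom_arr[OF h(2)] l]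
    colim_scale[OF d D.hom_arr[OF D.cmp_hom[OF h]] l] colim_cmp[OF d h]
  show "cmp colim b (scale colim l a) = scale colim l (cmp colim b a)"
    using s colim_cmp[OF d D.scale_hom[OF l h(1)] h(2)] D.cmp_scale_right[OF l h] e by simp
  show "cmp colim (scale colim l b) a = scale colim l (cmp colim b a)"
    using s colim_cmp[OF d h(1) D.scale_hom[OF l h(2)]] D.cmp_scale_left[OF l h] e by simp
qed

lemma colim_star_category: "star_category K colim"
proof (intro star_category.intro colim_linear star_category_axioms.intro)
  fix a x y assume "a \<in> hom colim x y"
  then obtain d \<sigma> \<alpha> where d: "d \<in> Field r" and h: "\<alpha> \<in> hom (X d) (\<sigma> x) (\<sigma> y)"
    and e: "a = cl d \<alpha>" "oc d (\<sigma> x) = x" "oc d (\<sigma> y) = y"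
    by (rule colim_lift1) blast
  interpret D: real_cstar_category K "X d" by (rule X_cstar[OF d])
  note s = colim_star[OF d D.hom_arr[OF h]]
  show "star colim a \<in> hom colim y x"
    using s colim_hom[OF d D.star_hom[OF h]] e by simp
  show "star colim (star colim a) = a"
    using s colim_star[OF d D.hom_arr[OF D.star_hom[OF h]]] D.star_star[OF h] e by simp
  fix k assume k: "k \<in> K"
  have "cnj k \<in> K" by (rule K_closed(3)[OF k k])
  then show "star colim (scale colim k a) = scale colim (cnj k) (star colim a)"
    using s colim_scale[OF d D.hom_arr[OF h] k] colim_star[OF d D.hom_arr[OF D.scale_hom[OF k h]]]
      colim_scale[OF d D.hom_arr[OF D.star_hom[OF h]]] D.star_scale[OF k h] e by simp
next
  fix a b x y assume "a \<in> hom colim x y" "b \<in> hom colim x y"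
  then obtain d \<sigma> \<alpha> \<beta> where d: "d \<in> Field r" and h: "\<alpha> \<in> hom (X d) (\<sigma> x) (\<sigma> y)"
    "\<beta> \<in> hom (X d) (\<sigma> x) (\<sigma> y)"
    and e: "a = cl d \<alpha>" "b = cl d \<beta>" "oc d (\<sigma> x) = x" "oc d (\<sigma> y) = y"
    by (rule colim_lift2) blast
  interpret D: real_cstar_category K "X d" by (rule X_cstar[OF d])
  show "star colim (add colim a b) = add colim (star colim a) (star colim b)"
    using colim_add[OF d h] colim_star[OF d D.hom_arr[OF D.add_hom[OF h]]] D.star_add[OF h]
      colim_star[OF d D.hom_arr[OF h(1)]] colim_star[OF d D.hom_arr[OF h(2)]]
      colim_add[OF d D.star_hom[OF h(1)] D.star_hom[OF h(2)]] e by simp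
next
  fix a b x y z assume "a \<in> hom colim x y" "b \<in> hom colim y z"
  then obtain d \<sigma> \<alpha> \<beta> where d: "d \<in> Field r" and h: "\<alpha> \<in> hom (X d) (\<sigma> x) (\<sigma> y)"
    "\<beta> \<in> hom (X d) (\<sigma> y) (\<sigma> z)"
    and e: "a = cl d \<alpha>" "b = cl d \<beta>"
    by (rule colim_lift2) blast
  interpret D: real_cstar_category K "X d" by (rule X_cstar[OF d])
  show "star colim (cmp colim b a) = cmp colim (star colim a) (star colim b)"
    using colim_cmp[OF d h] colim_star[OF d D.hom_arr[OF D.cmp_hom[OF h]]] D.star_cmp[OF h]
      colim_star[OF d D.hom_arr[OF h(1)]] colim_star[OF d D.hom_arr[OF h(2)]]
      colim_cmp[OF d D.star_hom[OF h(2)] D.star_hom[OF h(1)]] e by simp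
qed

lemma colim_nrm_stable2:
  assumes b: "b \<in> Field r" and a: "\<alpha> \<in> arr (X b)" "\<beta> \<in> arr (X b)"
  obtains d where "(b, d) \<in> r" "nrm (X d) (far (t b d) \<alpha>) = nrm colim (cl b \<alpha>)"
    "nrm (X d) (far (t b d) \<beta>) = nrm colim (cl b \<beta>)"
proof -
  define f where "f n = (if n = 0 then \<alpha> else \<beta>)" for n :: nat
  have "f n \<in> arr (X b)" for n using a by (simp add: f_def)
  from colim_nrm_stable[of b f, OF b this] obtain d where "(b, d) \<in> r"
    "\<And>n. nrm (X d) (far (t b d) (f n)) = nrm colim (cl b (f n))" by blast
  from this(1) this(2)[of 0] this(2)[of 1] show ?thesis using that by (simp add: f_def)
qed

text \<open>Inverses pass to the colimit, so spectra can only shrink; this transfers positivity from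
  a stage.\<close>

lemma colim_invertible:
  assumes d: "d \<in> Field r" and \<alpha>: "invertible_in (X d) x \<alpha>"
  shows "invertible_in colim (oc d x) (cl d \<alpha>)"
proof -
  obtain \<beta> where h: "\<alpha> \<in> hom (X d) x x" "\<beta> \<in> hom (X d) x x"
    and e: "cmp (X d) \<beta> \<alpha> = ide (X d) x" "cmp (X d) \<alpha> \<beta> = ide (X d) x"
    using \<alpha> by (auto simp: invertible_in_def)
  show ?thesis
    using colim_hom[OF d h(1)] colim_hom[OF d h(2)] colim_cmp[OF d h] colim_cmp[OF d h(2,1)] e
    by (auto simp: invertible_in_def colim_ide oc_def)
qed

text \<open>The differences of terms form a countable family, so a single stage realises all their
  norms. There the lifted sequence is Cauchy, and the germ of its limit is the required
  limit.\<close>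

lemma colim_complete:
  assumes s: "\<And>n. s n \<in> hom colim x y"
    and Cauchy: "\<And>e. 0 < e \<Longrightarrow> \<exists>N. \<forall>m \<ge> N. \<forall>n \<ge> N. nrm colim (sub colim (s m) (s n)) < e"
  shows "\<exists>l \<in> hom colim x y. (\<lambda>n. nrm colim (sub colim (s n) l)) \<longlonglongrightarrow> 0"
proof -
  obtain b \<sigma> \<alpha> where b: "b \<in> Field r" and \<alpha>: "\<And>n. \<alpha> n \<in> hom (X b) (\<sigma> x) (\<sigma> y)" "\<And>n. s n = cl b (\<alpha> n)"
    using colim_lift[of s "\<lambda>_. x" "\<lambda>_. y", OF s] by blast
  interpret B: real_cstar_category K "X b" by (rule X_cstar[OF b])
  \<comment> \<open>\<open>prod_decode\<close> enumerates the pairs of indices, turning the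
    differences into one sequence.\<close>
  define \<delta> where "\<delta> k = sub (X b) (\<alpha> (fst (prod_decode k))) (\<alpha> (snd (prod_decode k)))" for k
  have "\<delta> k \<in> arr (X b)" for k unfolding \<delta>_def by (rule B.hom_arr[OF B.sub_hom[OF \<alpha>(1) \<alpha>(1)]])
  from colim_nrm_stable[of b \<delta>, OF b this] obtain d where bd: "(b, d) \<in> r"
    and nd: "\<And>k. nrm (X d) (far (t b d) (\<delta> k)) = nrm colim (cl b (\<delta> k))" by blast
  have d: "d \<in> Field r" using r_Field bd by blast
  interpret D: real_cstar_category K "X d" by (rule X_cstar[OF d])
  define \<beta> where "\<beta> n = far (t b d) (\<alpha> n)" for n
  let ?x = "fob (t b d) (\<sigma> x)" and ?y = "fob (t b d) (\<sigma> y)"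
  have \<beta>: "\<beta> n \<in> hom (X d) ?x ?y" "s n = cl d (\<beta> n)" for n
    unfolding \<beta>_def using t_hom[OF bd \<alpha>(1)] cl_t[OF bd B.hom_arr[OF \<alpha>(1)]] \<alpha>(2) by simp_all
  have "far (t b d) (sub (X b) (\<alpha> m) (\<alpha> n)) = sub (X d) (\<beta> m) (\<beta> n)" for m n
  proof -
    have a: "\<alpha> k \<in> arr (X b)" "src (X b) (\<alpha> k) = \<sigma> x" "tgt (X b) (\<alpha> k) = \<sigma> y" for k
      using \<alpha>(1)[of k] by (simp_all add: hom_def)
    have "scale (X b) (- 1) (\<alpha> n) \<in> hom (X b) (\<sigma> x) (\<sigma> y)" by (rule B.scale_hom[OF _ \<alpha>(1)]) simp
    then show ?thesis using a t_add[OF bd, of "\<alpha> m" "scale (X b) (- 1) (\<alpha> n)"]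
      t_scale[OF bd _ a(1), of "- 1" n]
      by (simp add: sub_def \<beta>_def hom_def)
  qed
  then have eq: "nrm (X d) (sub (X d) (\<beta> m) (\<beta> n)) = nrm colim (sub colim (s m) (s n))" for m n
    using nd[of "prod_encode (m, n)"] colim_sub[OF b \<alpha>(1) \<alpha>(1), of m n] by (simp add: \<delta>_def \<alpha>(2))
  have "\<exists>l \<in> hom (X d) ?x ?y. (\<lambda>n. nrm (X d) (sub (X d) (\<beta> n) l)) \<longlonglongrightarrow> 0"
    by (rule D.nrm_complete[OF \<beta>(1)]) (use Cauchy eq in simp)
  then obtain l where l: "l \<in> hom (X d) ?x ?y" "(\<lambda>n. nrm (X d) (sub (X d) (\<beta> n) l)) \<longlonglongrightarrow> 0" by blast
  have sl: "sub colim (s n) (cl d l) = cl d (sub (X d) (\<beta> n) l)" for n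
    using colim_sub[OF d \<beta>(1) l(1)] \<beta>(2) by simp
  have sub_arr: "sub (X d) (\<beta> n) l \<in> arr (X d)" for n by (rule D.hom_arr[OF D.sub_hom[OF \<beta>(1) l(1)]])
  have nn: "0 \<le> nrm colim (cl d (sub (X d) (\<beta> n) l))" for n
    using colim_nrm_attained[OF d sub_arr[of n]] cstar_category.nrm_nonneg[OF X_cs]
      t_hom[OF _ D.sub_hom[OF \<beta>(1) l(1)]] r_Field
    by metis
  have "(\<lambda>n. nrm colim (sub colim (s n) (cl d l))) \<longlonglongrightarrow> 0"
    unfolding sl by (rule tendsto_sandwich[OF _ _ tendsto_const l(2)])
      (use nn colim_nrm_le[OF d sub_arr] in auto)
  moreover have "cl d l \<in> hom colim x y"
    using colim_hom[OF d l(1)] colim_hom[OF d \<beta>(1)[of 0]] s[of 0] \<beta>(2)[of 0] by (auto simp: hom_def)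
  ultimately show ?thesis by blast
qed

text \<open>Norm identities are checked at a stage where the norms involved are attained. For the
  inequalities it is enough to attain the right-hand side, since a germ has norm at most that of any
  representative.\<close>

lemma colim_cstar: "cstar_category K colim"
proof (intro cstar_category.intro colim_star_category cstar_category_axioms.intro)
  fix a x y assume "a \<in> hom colim x y"
  then obtain b \<sigma> \<alpha> where b: "b \<in> Field r" and h: "\<alpha> \<in> hom (X b) (\<sigma> x) (\<sigma> y)"
    and e: "a = cl b \<alpha>" "oc b (\<sigma> x) = x" "oc b (\<sigma> y) = y"
    by (rule colim_lift1) blast
  interpret B: real_cstar_category K "X b" by (rule X_cstar[OF b])
  note \<alpha> = B.hom_arr[OF h] and o = B.hom_obj[OF h]
  obtain d where bd: "(b, d) \<in> r" and nd: "nrm (X d) (far (t b d) \<alpha>) = nrm colim a"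
    using colim_nrm_attained[OF b \<alpha>] e by blast
  have d: "d \<in> Field r" using r_Field bd by blast
  interpret D: real_cstar_category K "X d" by (rule X_cstar[OF d])
  note h' = t_hom[OF bd h]
  show nn: "0 \<le> nrm colim a"
    using D.nrm_nonneg[OF h'] nd by simp
  have a: "a = cl d (far (t b d) \<alpha>)" and xy: "oc d (fob (t b d) (\<sigma> x)) = x"
    "oc d (fob (t b d) (\<sigma> y)) = y"
    using cl_t[OF bd \<alpha>] oc_t[OF bd o(1)] oc_t[OF bd o(2)] e by simp_all
  show "nrm colim a = 0 \<longleftrightarrow> a = zero colim x y"
  proof
    assume "nrm colim a = 0"
    then show "a = zero colim x y"
      using D.nrm_eq_0[OF h'] nd colim_zero[OF d D.hom_obj[OF h']] a xy by simp
  next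
    assume "a = zero colim x y"
    then have "a = cl b (zero (X b) (\<sigma> x) (\<sigma> y))" using colim_zero[OF b o] e by simp
    then have "nrm colim a \<le> 0"
      using colim_nrm_le[OF b B.hom_arr[OF B.zero_hom[OF o]]] B.nrm_zero[OF o] by simp
    then show "nrm colim a = 0" using nn by simp
  qed
  have aa: "cmp (X b) (star (X b) \<alpha>) \<alpha> \<in> hom (X b) (\<sigma> x) (\<sigma> x)"
    by (rule B.cmp_hom[OF h B.star_hom[OF h]])
  have saa: "cmp colim (star colim a) a = cl b (cmp (X b) (star (X b) \<alpha>) \<alpha>)"
    using colim_star[OF b \<alpha>] colim_cmp[OF b h B.star_hom[OF h]] e by simp
  show "nrm colim (cmp colim (star colim a) a) = (nrm colim a)\<^sup>2"
  proof -
    obtain d where bd: "(b, d) \<in> r" and nd: "nrm (X d) (far (t b d) \<alpha>) = nrm colim (cl b \<alpha>)"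
      "nrm (X d) (far (t b d) (cmp (X b) (star (X b) \<alpha>) \<alpha>)) = nrm colim
        (cl b (cmp (X b) (star (X b) \<alpha>) \<alpha>))"
      by (rule colim_nrm_stable2[OF b \<alpha> B.hom_arr[OF aa]])
    interpret E: real_cstar_category K "X d" by (rule X_cstar[OF r_Field(2)[OF bd]])
    have "far (t b d) (cmp (X b) (star (X b) \<alpha>) \<alpha>) = cmp (X d) (star (X d) (far (t b d) \<alpha>))
      (far (t b d) \<alpha>)"
      using t_cmp[OF bd, of "star (X b) \<alpha>" \<alpha>] t_star[OF bd \<alpha>] B.star_hom[OF h] h
        by (simp add: hom_def)
    then show ?thesis using nd E.cstar_identity[OF t_hom[OF bd h]] saa e by simp
  qed
  show "spectrum K colim x (cmp colim (star colim a) a) \<subseteq> complex_of_real ` {0..}"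
  proof
    fix z assume z: "z \<in> spectrum K colim x (cmp colim (star colim a) a)"
    then have zK: "z \<in> K" by (simp add: spectrum_def)
    show "z \<in> complex_of_real ` {0..}"
    proof (rule ccontr)
      assume "z \<notin> complex_of_real ` {0..}"
      then have "z \<notin> spectrum K (X b) (\<sigma> x) (cmp (X b) (star (X b) \<alpha>) \<alpha>)"
        using B.star_cmp_positive[OF h] by blast
      then have "invertible_in (X b) (\<sigma> x) (sub (X b) (cmp (X b) (star (X b) \<alpha>) \<alpha>)
        (scale (X b) z (ide (X b) (\<sigma> x))))"
        using zK by (simp add: spectrum_def)
      from colim_invertible[OF b this]
      have "invertible_in colim x (sub colim (cmp colim (star colim a) a)
        (scale colim z (ide colim x)))"
        using colim_sub[OF b aa B.scale_hom[OF zK B.ide_hom[OF o(1)]]]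
          colim_scale[OF b B.hom_arr[OF B.ide_hom[OF o(1)]] zK] saa e by (simp add: colim_ide oc_def)
      then show False using z by (simp add: spectrum_def)
    qed
  qed
  fix k assume k: "k \<in> K"
  show "nrm colim (scale colim k a) = cmod k * nrm colim a"
  proof -
    obtain d where bd: "(b, d) \<in> r" and nd: "nrm (X d) (far (t b d) \<alpha>) = nrm colim (cl b \<alpha>)"
      "nrm (X d) (far (t b d) (scale (X b) k \<alpha>)) = nrm colim (cl b (scale (X b) k \<alpha>))"
      by (rule colim_nrm_stable2[OF b \<alpha> B.hom_arr[OF B.scale_hom[OF k h]]])
    interpret E: real_cstar_category K "X d" by (rule X_cstar[OF r_Field(2)[OF bd]])
    show ?thesis
      using nd E.nrm_scale[OF k t_hom[OF bd h]] t_scale[OF bd k \<alpha>] colim_scale[OF b \<alpha> k] e by simp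
  qed
next
  fix a b x y assume "a \<in> hom colim x y" "b \<in> hom colim x y"
  then obtain c \<sigma> \<alpha> \<beta> where c: "c \<in> Field r" and h: "\<alpha> \<in> hom (X c) (\<sigma> x) (\<sigma> y)"
    "\<beta> \<in> hom (X c) (\<sigma> x) (\<sigma> y)"
    and e: "a = cl c \<alpha>" "b = cl c \<beta>"
    by (rule colim_lift2) blast
  interpret C: real_cstar_category K "X c" by (rule X_cstar[OF c])
  note ar = C.hom_arr[OF h(1)] C.hom_arr[OF h(2)]
  obtain d where cd: "(c, d) \<in> r" and nd: "nrm (X d) (far (t c d) \<alpha>) = nrm colim (cl c \<alpha>)"
    "nrm (X d) (far (t c d) \<beta>) = nrm colim (cl c \<beta>)"
    by (rule colim_nrm_stable2[OF c ar])
  have d: "d \<in> Field r" using r_Field cd by blast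
  interpret D: real_cstar_category K "X d" by (rule X_cstar[OF d])
  note h' = t_hom[OF cd h(1)] t_hom[OF cd h(2)]
  show "nrm colim (add colim a b) \<le> nrm colim a + nrm colim b"
    using colim_add[OF d h'] colim_nrm_le[OF d D.hom_arr[OF D.add_hom[OF h']]] D.nrm_triangle[OF h']
      nd e
      cl_t[OF cd ar(1)] cl_t[OF cd ar(2)] by simp
next
  fix a b x y z assume "a \<in> hom colim x y" "b \<in> hom colim y z"
  then obtain c \<sigma> \<alpha> \<beta> where c: "c \<in> Field r" and h: "\<alpha> \<in> hom (X c) (\<sigma> x) (\<sigma> y)"
    "\<beta> \<in> hom (X c) (\<sigma> y) (\<sigma> z)"
    and e: "a = cl c \<alpha>" "b = cl c \<beta>"
    by (rule colim_lift2) blast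
  interpret C: real_cstar_category K "X c" by (rule X_cstar[OF c])
  note ar = C.hom_arr[OF h(1)] C.hom_arr[OF h(2)]
  obtain d where cd: "(c, d) \<in> r" and nd: "nrm (X d) (far (t c d) \<alpha>) = nrm colim (cl c \<alpha>)"
    "nrm (X d) (far (t c d) \<beta>) = nrm colim (cl c \<beta>)"
    by (rule colim_nrm_stable2[OF c ar])
  have d: "d \<in> Field r" using r_Field cd by blast
  interpret D: real_cstar_category K "X d" by (rule X_cstar[OF d])
  note h' = t_hom[OF cd h(1)] t_hom[OF cd h(2)]
  show "nrm colim (cmp colim b a) \<le> nrm colim b * nrm colim a"
    using colim_cmp[OF d h'] colim_nrm_le[OF d D.hom_arr[OF D.cmp_hom[OF h']]] D.nrm_cmp[OF h'] nd e
      cl_t[OF cd ar(1)] cl_t[OF cd ar(2)] by simp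
qed (rule colim_complete)

section \<open>The cocone from the stages and the maps out of the colimit\<close>

definition colim_in :: "'i \<Rightarrow> 'u sfun" where
  "colim_in b = \<lparr>fsrc = X b, ftgt = colim, fob = (\<lambda>x \<in> obj (X b). oc b x),
    far = (\<lambda>\<alpha> \<in> arr (X b). cl b \<alpha>)\<rparr>"

lemma colim_in_sel: "fsrc (colim_in b) = X b" "ftgt (colim_in b) = colim"
  "\<alpha> \<in> arr (X b) \<Longrightarrow> far (colim_in b) \<alpha> = cl b \<alpha>"
  by (simp_all add: colim_in_def)

lemma colim_in_functor:
  assumes b: "b \<in> Field r"
  shows "star_functor K (colim_in b)"
proof -
  interpret B: real_cstar_category K "X b" by (rule X_cstar[OF b])
  have arr: "\<alpha> \<in> arr (X b)" "x \<in> obj (X b)" "y \<in> obj (X b)" if "\<alpha> \<in> hom (X b) x y" for \<alpha> x y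
    using B.hom_arr[OF that] B.hom_obj[OF that] by simp_all
  have cl_arr: "cl b \<alpha> \<in> arr colim" if "\<alpha> \<in> arr (X b)" for \<alpha>
    using colim_hom[OF b B.arr_hom[OF that]] by (simp add: hom_def)
  show ?thesis
    by (rule star_functor.intro)
      (auto simp: colim_in_def X_cs[OF b] colim_cstar oc_obj[OF b] cl_arr arr colim_hom[OF b]
        colim_ide oc_def
        arr(1)[OF B.ide_hom] arr(1)[OF B.cmp_hom] arr(1)[OF B.add_hom] arr(1)[OF B.scale_hom]
          arr(1)[OF B.star_hom]
        colim_cmp[OF b] colim_add[OF b] colim_scale[OF b] colim_star[OF b]
        simp flip: oc_def)
qed

lemma colim_in_t: "(b, c) \<in> r \<Longrightarrow> sfun_comp (colim_in c) (t b c) = colim_in b"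
  by (auto simp: sfun_comp_def colim_in_def t_fsrc compose_def t_obj t_arr oc_t cl_t fun_eq_iff)

text \<open>Objects of the colimit are germs of identities; hence the value on an object is obtained
  from the source of a representative arrow.\<close>

definition colim_out :: "'u small_star_cat \<Rightarrow> ('i \<Rightarrow> 'u sfun) \<Rightarrow> 'u sfun" where
  "colim_out L m = \<lparr>fsrc = colim, ftgt = L,
     fob = (\<lambda>x \<in> obj colim. lift1 (\<lambda>b \<alpha>. fob (m b) (src (X b) \<alpha>)) x),
     far = (\<lambda>a \<in> arr colim. lift1 (\<lambda>b \<alpha>. far (m b) \<alpha>) a)\<rparr>"

context
  fixes L m
  assumes L: "cstar_category K L"
    and m: "\<And>b. b \<in> Field r \<Longrightarrow> star_functor K (m b)" "\<And>b. b \<in> Field r \<Longrightarrow> fsrc (m b) = X b"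
      "\<And>b. b \<in> Field r \<Longrightarrow> ftgt (m b) = L"
    and m_t: "\<And>b c \<alpha>. (b, c) \<in> r \<Longrightarrow> \<alpha> \<in> arr (X b) \<Longrightarrow> far (m c) (far (t b c) \<alpha>) = far (m b) \<alpha>"
begin

lemma m_hom: "b \<in> Field r \<Longrightarrow> \<alpha> \<in> hom (X b) x y \<Longrightarrow> far (m b) \<alpha> \<in> hom L (fob (m b) x) (fob (m b) y)"
  using star_functor.far_hom[OF m(1)] m(2,3) by metis

lemma m_fob_t:
  assumes bc: "(b, c) \<in> r" and x: "x \<in> obj (X b)"
  shows "fob (m c) (fob (t b c) x) = fob (m b) x"
proof -
  have bc': "b \<in> Field r" "c \<in> Field r" using r_Field bc by auto
  have i: "ide (X b) x \<in> hom (X b) x x" by (rule category.ide_hom[OF X_category[OF bc'(1)] x])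
  show ?thesis using m_t[OF bc ide_arr[OF bc'(1) x]] m_hom[OF bc'(2) t_hom[OF bc i]]
    m_hom[OF bc'(1) i]
    by (simp add: hom_def)
qed

lemma colim_out_far: "b \<in> Field r \<Longrightarrow> \<alpha> \<in> arr (X b) \<Longrightarrow> far (colim_out L m) (cl b \<alpha>) = far (m b) \<alpha>"
proof -
  assume b: "b \<in> Field r" "\<alpha> \<in> arr (X b)"
  then have "cl b \<alpha> \<in> arr colim" by (auto simp: colim_def)
  moreover have "lift1 (\<lambda>b \<alpha>. far (m b) \<alpha>) (cl b \<alpha>) = far (m b) \<alpha>"
    by (rule lift1_cl[OF m_t b])
  ultimately show ?thesis by (simp add: colim_out_def)
qed

lemma colim_out_fob: "b \<in> Field r \<Longrightarrow> x \<in> obj (X b) \<Longrightarrow> fob (colim_out L m) (oc b x) = fob (m b) x"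
proof -
  assume b: "b \<in> Field r" "x \<in> obj (X b)"
  have "lift1 (\<lambda>b \<alpha>. fob (m b) (src (X b) \<alpha>)) (cl b (ide (X b) x)) = fob (m b)
    (src (X b) (ide (X b) x))"
    by (rule lift1_cl) (use b in \<open>auto simp: t_src m_fob_t src_obj r_Field ide_arr\<close>)
  then show ?thesis using b oc_obj by (simp add: colim_out_def ide_src oc_def)
qed

lemma colim_out_functor: "star_functor K (colim_out L m)"
proof -
  have sel: "fsrc (colim_out L m) = colim" "ftgt (colim_out L m) = L" by (simp_all add: colim_out_def)
  have hom: "far (colim_out L m) a \<in> hom L (fob (colim_out L m) x) (fob (colim_out L m) y)"
    if "a \<in> hom colim x y" for a x y
  proof -
    from that obtain d \<sigma> \<alpha> where d: "d \<in> Field r" and h: "\<alpha> \<in> hom (X d) (\<sigma> x) (\<sigma> y)"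
      and e: "a = cl d \<alpha>" "oc d (\<sigma> x) = x" "oc d (\<sigma> y) = y" by (rule colim_lift1) blast
    interpret D: real_cstar_category K "X d" by (rule X_cstar[OF d])
    note o = D.hom_obj[OF h]
    show ?thesis
      using colim_out_far[OF d D.hom_arr[OF h]] colim_out_fob[OF d o(1)] colim_out_fob[OF d o(2)]
        m_hom[OF d h] e by simp
  qed
  interpret L: real_cstar_category K L by (rule real_cstar_categoryI[OF L reals])
  interpret M: cstar_category K colim by (rule colim_cstar)
  show ?thesis
  proof (rule star_functor.intro, unfold sel)
    show "fob (colim_out L m) \<in> obj colim \<rightarrow>\<^sub>E obj L"
      using L.hom_obj(1)[OF hom[OF colim_obj_hom]] by (auto simp: PiE_def) (simp add: colim_out_def)
    show "far (colim_out L m) \<in> arr colim \<rightarrow>\<^sub>E arr L"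
      using L.hom_arr[OF hom[OF M.arr_hom]] by (auto simp: PiE_def) (simp add: colim_out_def)
    show "far (colim_out L m) a \<in> hom L (fob (colim_out L m) x) (fob (colim_out L m) y)"
      if "a \<in> hom colim x y" for a x y by (rule hom[OF that])
  next
    fix x assume "x \<in> obj colim"
    then obtain b \<xi> where b: "b \<in> Field r" "\<xi> \<in> obj (X b)" "x = oc b \<xi>" by (rule colim_obj_cases)
    then show "far (colim_out L m) (ide colim x) = ide L (fob (colim_out L m) x)"
      using colim_out_far[OF b(1) ide_arr[OF b(1,2)]] colim_out_fob[OF b(1,2)]
        star_functor.far_ide[OF m(1)[OF b(1)]] m(2,3)
      by (simp add: colim_ide oc_def)
  next
    fix a b x y z assume "a \<in> hom colim x y" "b \<in> hom colim y z"
    then obtain d \<sigma> \<alpha> \<beta> where d: "d \<in> Field r"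
      and h: "\<alpha> \<in> hom (X d) (\<sigma> x) (\<sigma> y)" "\<beta> \<in> hom (X d) (\<sigma> y) (\<sigma> z)"
      and e: "a = cl d \<alpha>" "b = cl d \<beta>" by (rule colim_lift2) blast
    interpret D: real_cstar_category K "X d" by (rule X_cstar[OF d])
    show "far (colim_out L m) (cmp colim b a) = cmp L (far (colim_out L m) b) (far (colim_out L m) a)"
      using colim_cmp[OF d h] colim_out_far[OF d D.hom_arr[OF h(1)]]
        colim_out_far[OF d D.hom_arr[OF h(2)]]
        colim_out_far[OF d D.hom_arr[OF D.cmp_hom[OF h]]] star_functor.far_cmp[OF m(1)[OF d]] h
          m(2,3)[OF d] e by simp
  next
    fix a b x y assume "a \<in> hom colim x y" "b \<in> hom colim x y"
    then obtain d \<sigma> \<alpha> \<beta> where d: "d \<in> Field r"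
      and h: "\<alpha> \<in> hom (X d) (\<sigma> x) (\<sigma> y)" "\<beta> \<in> hom (X d) (\<sigma> x) (\<sigma> y)"
      and e: "a = cl d \<alpha>" "b = cl d \<beta>" by (rule colim_lift2) blast
    interpret D: real_cstar_category K "X d" by (rule X_cstar[OF d])
    show "far (colim_out L m) (add colim a b) = add L (far (colim_out L m) a) (far (colim_out L m) b)"
      using colim_add[OF d h] colim_out_far[OF d D.hom_arr[OF h(1)]]
        colim_out_far[OF d D.hom_arr[OF h(2)]]
        colim_out_far[OF d D.hom_arr[OF D.add_hom[OF h]]] star_functor.far_add[OF m(1)[OF d]] h
          m(2,3)[OF d] e by simp
  next
    fix k a x y assume k: "k \<in> K" and "a \<in> hom colim x y"
    from this(2) obtain d \<sigma> \<alpha> where d: "d \<in> Field r" and h: "\<alpha> \<in> hom (X d) (\<sigma> x) (\<sigma> y)"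
      and e: "a = cl d \<alpha>" by (rule colim_lift1) blast
    interpret D: real_cstar_category K "X d" by (rule X_cstar[OF d])
    show "far (colim_out L m) (scale colim k a) = scale L k (far (colim_out L m) a)"
      using colim_scale[OF d D.hom_arr[OF h] k] colim_out_far[OF d D.hom_arr[OF h]]
        colim_out_far[OF d D.hom_arr[OF D.scale_hom[OF k h]]] star_functor.far_scale[OF m(1)[OF d] k]
          h m(2,3)[OF d] e by simp
  next
    fix a x y assume "a \<in> hom colim x y"
    then obtain d \<sigma> \<alpha> where d: "d \<in> Field r" and h: "\<alpha> \<in> hom (X d) (\<sigma> x) (\<sigma> y)"
      and e: "a = cl d \<alpha>" by (rule colim_lift1) blast
    interpret D: real_cstar_category K "X d" by (rule X_cstar[OF d])
    show "far (colim_out L m) (star colim a) = star L (far (colim_out L m) a)"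
      using colim_star[OF d D.hom_arr[OF h]] colim_out_far[OF d D.hom_arr[OF h]]
        colim_out_far[OF d D.hom_arr[OF D.star_hom[OF h]]] star_functor.far_star[OF m(1)[OF d]] h
          m(2,3)[OF d] e by simp
  qed (rule colim_cstar L)+
qed

lemma colim_out_in:
  assumes b: "b \<in> Field r"
  shows "sfun_comp (colim_out L m) (colim_in b) = m b"
proof -
  have ext: "fob (m b) \<in> extensional (obj (X b))" "far (m b) \<in> extensional (arr (X b))"
    using star_functor.fob_ext[OF m(1)[OF b]] star_functor.far_ext[OF m(1)[OF b]] m(2)[OF b]
      by (auto simp: PiE_def)
  show ?thesis
    unfolding sfun_comp_def
    by (rule sfun.equality)
      (auto simp: m[OF b] compose_def colim_out_fob[OF b] colim_out_far[OF b] colim_in_def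
        colim_out_def[THEN arg_cong[where f=ftgt]] intro!: extensionalityI[OF _ ext(1)]
          extensionalityI[OF _ ext(2)])
qed

end

end


section \<open>Arrows of the category of C*-categories\<close>

lemma obj_C1cat: "A \<in> obj (C1cat K) \<longleftrightarrow> cstar_category K A"
  by (simp add: C1cat_def)

lemma arr_C1cat: "F \<in> arr (C1cat K) \<longleftrightarrow> star_functor K F"
  by (simp add: C1cat_def)

lemma src_C1cat: "src (C1cat K) F = fsrc F" and tgt_C1cat: "tgt (C1cat K) F = ftgt F"
  and ide_C1cat: "ide (C1cat K) A = sfun_id A" and cmp_C1cat: "cmp (C1cat K) G F = sfun_comp G F"
  by (simp_all add: C1cat_def)

lemma hom_C1cat: "F \<in> hom (C1cat K) A B \<longleftrightarrow> star_functor K F \<and> fsrc F = A \<and> ftgt F = B"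
  by (simp add: hom_def C1cat_def)

lemma homD:
  assumes "F \<in> hom (C1cat K) A B"
  shows homD_functor: "star_functor K F" and homD_src: "fsrc F = A" and homD_tgt: "ftgt F = B"
    and homD_srccat: "cstar_category K A" and homD_tgtcat: "cstar_category K B"
    and homD_far: "\<And>x y a. a \<in> hom A x y \<Longrightarrow> far F a \<in> hom B (fob F x) (fob F y)"
    and homD_arr: "\<And>a. a \<in> arr A \<Longrightarrow> far F a \<in> arr B"
    and homD_fob: "\<And>x. x \<in> obj A \<Longrightarrow> fob F x \<in> obj B"
    and homD_ide: "\<And>x. x \<in> obj A \<Longrightarrow> far F (ide A x) = ide B (fob F x)"
proof -
  show *: "star_functor K F" "fsrc F = A" "ftgt F = B" using assms by (simp_all add: hom_C1cat)
  interpret star_functor K F by (rule *(1))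
  show "cstar_category K A" "cstar_category K B" using fsrc_cstar ftgt_cstar * by simp_all
  show fh: "far F a \<in> hom B (fob F x) (fob F y)" if "a \<in> hom A x y" for x y a
    using far_hom that * by simp
  show "far F a \<in> arr B" if "a \<in> arr A" for a
    using fh[of a "src A a" "tgt A a"] that by (simp_all add: hom_def)
  show "fob F x \<in> obj B" if "x \<in> obj A" for x
    using fob_ext that * by auto
  show "far F (ide A x) = ide B (fob F x)" if "x \<in> obj A" for x
    using far_ide that * by simp
qed

lemma cstar_ide_hom: "cstar_category K A \<Longrightarrow> x \<in> obj A \<Longrightarrow> ide A x \<in> hom A x x"
  by (metis category.ide_hom cstar_category.axioms(1) linear_category.axioms(1)
    star_category.axioms(1))

lemma far_cmp_C1cat:
  "F \<in> hom (C1cat K) A B \<Longrightarrow> a \<in> arr A \<Longrightarrow> far (cmp (C1cat K) G F) a = far G (far F a)"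
  by (simp add: hom_C1cat cmp_C1cat sfun_comp_def compose_def)

lemma fob_cmp_C1cat:
  "F \<in> hom (C1cat K) A B \<Longrightarrow> x \<in> obj A \<Longrightarrow> fob (cmp (C1cat K) G F) x = fob G (fob F x)"
  by (simp add: hom_C1cat cmp_C1cat sfun_comp_def compose_def)

lemma far_ide_C1cat: "a \<in> arr A \<Longrightarrow> far (ide (C1cat K) A) a = a"
  and fob_ide_C1cat: "x \<in> obj A \<Longrightarrow> fob (ide (C1cat K) A) x = x"
  by (simp_all add: ide_C1cat sfun_id_def)

lemma cmp_hom_C1cat:
  "F \<in> hom (C1cat K) A B \<Longrightarrow> G \<in> hom (C1cat K) B D \<Longrightarrow> cmp (C1cat K) G F \<in> hom (C1cat K) A D"
  using category.cmp_hom[OF category_C1cat] .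

lemma ide_hom_C1cat: "cstar_category K A \<Longrightarrow> ide (C1cat K) A \<in> hom (C1cat K) A A"
  using category.ide_hom[OF category_C1cat] by (simp add: obj_C1cat)

text \<open>Values on objects are the sources of values on identities; extensionality settles the
  maps off the carriers.\<close>

lemma sfun_eqI:
  assumes F: "F \<in> hom (C1cat K) A B" and G: "G \<in> hom (C1cat K) A B"
    and eq: "\<And>a. a \<in> arr A \<Longrightarrow> far F a = far G a"
  shows "F = G"
proof -
  interpret A: cstar_category K A by (rule homD_srccat[OF F])
  have fob: "fob F x = fob G x" if "x \<in> obj A" for x
    using homD_far[OF F A.ide_hom[OF that]] homD_far[OF G A.ide_hom[OF that]]
      eq[OF A.hom_arr[OF A.ide_hom[OF that]]]
    by (simp add: hom_def)
  have "fob F \<in> extensional (obj A)" "far F \<in> extensional (arr A)"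
    using star_functor.fob_ext[OF homD_functor[OF F]] star_functor.far_ext[OF homD_functor[OF F]]
      homD_src[OF F]
    by (auto simp: PiE_def)
  moreover have "fob G \<in> extensional (obj A)" "far G \<in> extensional (arr A)"
    using star_functor.fob_ext[OF homD_functor[OF G]] star_functor.far_ext[OF homD_functor[OF G]]
      homD_src[OF G]
    by (auto simp: PiE_def)
  ultimately show ?thesis
    using homD_src[OF F] homD_src[OF G] homD_tgt[OF F] homD_tgt[OF G]
      extensionalityI[of "fob F" "obj A" "fob G"] extensionalityI[of "far F" "arr A" "far G"] fob eq
    by (intro sfun.equality) auto
qed

lemma functor_unitary:
  assumes F: "F \<in> hom (C1cat K) A B" and u: "unitary_arrow A u"
  shows "unitary_arrow B (far F u)"
proof -
  interpret star_functor K F by (rule homD_functor[OF F])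
  note [simp] = homD_src[OF F] homD_tgt[OF F]
  interpret A: cstar_category K A by (rule homD_srccat[OF F])
  have uh: "u \<in> hom A (src A u) (tgt A u)" using u by (simp add: unitary_arrow_def hom_def)
  note o = A.hom_obj[OF uh] and su = A.star_hom[OF uh]
  show ?thesis
    using u far_hom[of u "src A u" "tgt A u"] uh
      far_cmp[of u "src A u" "tgt A u" "star A u" "src A u"]
      far_cmp[of "star A u" "tgt A u" "src A u" u "tgt A u"] su far_star[of u "src A u" "tgt A u"]
      far_ide[of "src A u"] far_ide[of "tgt A u"] o
    unfolding unitary_arrow_def by (auto simp: hom_def)
qed

lemma unitary_ide:
  assumes D: "cstar_category K D" and x: "x \<in> obj D" and K: "\<real> \<subseteq> K"
  shows "unitary_arrow D (ide D x)"
proof -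
  interpret D: real_cstar_category K D by (rule real_cstar_categoryI[OF D K])
  show ?thesis
    using D.star_ide[OF x] D.ide_hom[OF x] D.cmp_ide[OF D.ide_hom[OF x]]
      by (simp add: unitary_arrow_def hom_def)
qed


section \<open>Smallness\<close>

text \<open>The classes of the kernel of \<phi> are its fibres, and \<open>the_elem\<close> reads
  off the common value on each of them.\<close>

lemma bij_betw_fibres:
  assumes R: "R = {(p, q). p \<in> S \<and> q \<in> S \<and> \<phi> p = \<phi> q}"
  shows "bij_betw (\<lambda>q. the_elem (\<phi> ` q)) (S // R) (\<phi> ` S)"
proof -
  have cls: "R `` {p} = {q \<in> S. \<phi> q = \<phi> p}" if "p \<in> S" for p
    using that by (auto simp: R)
  have val: "the_elem (\<phi> ` (R `` {p})) = \<phi> p" if "p \<in> S" for p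
  proof -
    have "\<phi> ` (R `` {p}) = {\<phi> p}" using that by (auto simp: cls)
    then show ?thesis by simp
  qed
  have quot: "S // R = (\<lambda>p. R `` {p}) ` S" by (auto simp: quotient_def)
  show ?thesis
    unfolding quot
  proof (rule bij_betw_imageI)
    show "inj_on (\<lambda>q. the_elem (\<phi> ` q)) ((\<lambda>p. R `` {p}) ` S)"
    proof (rule inj_onI; elim imageE)
      fix q q' p p' assume p: "q = R `` {p}" "p \<in> S" "q' = R `` {p'}" "p' \<in> S"
        and "the_elem (\<phi> ` q) = the_elem (\<phi> ` q')"
      then have "\<phi> p = \<phi> p'" by (simp only: val)
      then show "q = q'" using p by (simp add: cls)
    qed
    show "(\<lambda>q. the_elem (\<phi> ` q)) ` (\<lambda>p. R `` {p}) ` S = \<phi> ` S"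
      unfolding image_image using val by (rule image_cong[OF refl])
  qed
qed

text \<open>Pairs are first moved to a common stage, where \<open>inj\<close> applies. Together with
  the cocone equations this identifies \<open>hom_colim_rel\<close> with the kernel of the
  evaluation map, whose image is everything by \<open>surj\<close>.\<close>

lemma bij_betw_hom_colim:
  assumes C: "category C" and r: "Well_order r" and seq: "transfinite_sequence C r X t"
    and coc: "is_cocone C r (Field r) X t L m"
    and surj: "\<And>f. f \<in> hom C A L \<Longrightarrow> \<exists>b \<in> Field r. \<exists>g \<in> hom C A (X b). cmp C (m b) g = f"
    and inj: "\<And>b g g'. b \<in> Field r \<Longrightarrow> g \<in> hom C A (X b) \<Longrightarrow> g' \<in> hom C A (X b) \<Longrightarrow>
      cmp C (m b) g = cmp C (m b) g' \<Longrightarrow> \<exists>d. (b, d) \<in> r \<and> cmp C (t b d) g = cmp C (t b d) g'"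
  shows "bij_betw (hom_colim_map C m) (hom_colim C A r X t) (hom C A L)"
proof -
  interpret category C by (rule C)
  define S where "S = (SIGMA b : Field r. hom C A (X b))"
  define \<phi> where "\<phi> = (\<lambda>(b, f). cmp C (m b) f)"
  have m: "m b \<in> hom C (X b) L" if "b \<in> Field r" for b using coc that by (auto simp: is_cocone_def)
  have mt: "cmp C (m c) (t b c) = m b" if "(b, c) \<in> r" for b c
    using coc that unfolding is_cocone_def Field_def by blast
  have t: "t b c \<in> hom C (X b) (X c)" if "(b, c) \<in> r" for b c
    using seq that by (auto simp: transfinite_sequence_def)
  have tt: "cmp C (t c d) (t b c) = t b d" if "(b, c) \<in> r" "(c, d) \<in> r" for b c d
    using seq that unfolding transfinite_sequence_def by blast
  have F: "b \<in> Field r" "c \<in> Field r" if "(b, c) \<in> r" for b c using that by (auto simp: Field_def)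
  have mtf: "cmp C (m c) (cmp C (t b c) f) = cmp C (m b) f" if "(b, c) \<in> r" "f \<in> hom C A (X b)"
    for b c f
    using cmp_assoc[OF that(2) t[OF that(1)] m[OF F(2)[OF that(1)]]] mt[OF that(1)] by simp
  have trans: "(b, d) \<in> r" if "(b, c) \<in> r" "(c, d) \<in> r" for b c d
    using r that unfolding well_order_on_def linear_order_on_def partial_order_on_def preorder_on_def
      by (meson transD)
  have total: "\<exists>d. (b, d) \<in> r \<and> (c, d) \<in> r" if "b \<in> Field r" "c \<in> Field r" for b c
    using r that unfolding well_order_on_def linear_order_on_def partial_order_on_def preorder_on_def
      refl_on_def total_on_def by metis
  have "hom_colim_rel C A r X t = {(p, q). p \<in> S \<and> q \<in> S \<and> \<phi> p = \<phi> q}"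
  proof (intro set_eqI iffI)
    fix x assume "x \<in> hom_colim_rel C A r X t"
    then obtain b f c g d where x: "x = ((b, f), (c, g))" "b \<in> Field r" "f \<in> hom C A (X b)"
      "c \<in> Field r" "g \<in> hom C A (X c)"
      and d: "(b, d) \<in> r" "(c, d) \<in> r" "cmp C (t b d) f = cmp C (t c d) g"
      by (auto simp: hom_colim_rel_def)
    then have "cmp C (m b) f = cmp C (m c) g" using mtf[OF d(1) x(3)] mtf[OF d(2) x(5)] by simp
    then show "x \<in> {(p, q). p \<in> S \<and> q \<in> S \<and> \<phi> p = \<phi> q}" using x by (simp add: S_def \<phi>_def)
  next
    fix x assume "x \<in> {(p, q). p \<in> S \<and> q \<in> S \<and> \<phi> p = \<phi> q}"
    then obtain b f c g where x: "x = ((b, f), (c, g))" "b \<in> Field r" "f \<in> hom C A (X b)"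
      "c \<in> Field r" "g \<in> hom C A (X c)"
      "cmp C (m b) f = cmp C (m c) g" by (auto simp: S_def \<phi>_def)
    obtain e where e: "(b, e) \<in> r" "(c, e) \<in> r" using total x by blast
    have "cmp C (m e) (cmp C (t b e) f) = cmp C (m e) (cmp C (t c e) g)"
      using mtf[OF e(1) x(3)] mtf[OF e(2) x(5)] x(6) by simp
    from inj[OF F(2)[OF e(1)] cmp_hom[OF x(3) t[OF e(1)]] cmp_hom[OF x(5) t[OF e(2)]] this]
    obtain d where d: "(e, d) \<in> r" "cmp C (t e d) (cmp C (t b e) f) = cmp C (t e d) (cmp C (t c e) g)"
      by blast
    then have "cmp C (t b d) f = cmp C (t c d) g"
      using cmp_assoc[OF x(3) t[OF e(1)] t[OF d(1)]] cmp_assoc[OF x(5) t[OF e(2)] t[OF d(1)]]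
        tt[OF e(1) d(1)] tt[OF e(2) d(1)] by simp
    then show "x \<in> hom_colim_rel C A r X t"
      using x trans[OF e(1) d(1)] trans[OF e(2) d(1)] by (auto simp: hom_colim_rel_def)
  qed
  from bij_betw_fibres[OF this] have "bij_betw (\<lambda>q. the_elem (\<phi> ` q)) (hom_colim C A r X t) (\<phi> ` S)"
    by (simp add: hom_colim_def S_def)
  moreover have "\<phi> ` S = hom C A L"
  proof (intro set_eqI iffI)
    fix f assume "f \<in> \<phi> ` S"
    then show "f \<in> hom C A L" by (auto simp: S_def \<phi>_def intro: cmp_hom m)
  next
    fix f assume "f \<in> hom C A L"
    from surj[OF this] show "f \<in> \<phi> ` S" by (force simp: S_def \<phi>_def)
  qed
  moreover have "hom_colim_map C m = (\<lambda>q. the_elem (\<phi> ` q))"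
    by (simp add: fun_eq_iff hom_colim_map_def \<phi>_def)
  ultimately show ?thesis by simp
qed

lemma countable_bound:
  fixes k :: "'i rel" and r :: "'j rel"
  assumes k: "(card_of (UNIV :: nat set), k) \<in> ordLeq"
    and r: "\<And>A. A \<subseteq> Field r \<Longrightarrow> (card_of A, k) \<in> ordLeq \<Longrightarrow> \<exists>b \<in> Field r. \<forall>a \<in> A. (a, b) \<in> r"
    and f: "range (f :: nat \<Rightarrow> 'j) \<subseteq> Field r"
  shows "\<exists>d \<in> Field r. \<forall>n. (f n, d) \<in> r"
proof -
  have "(card_of (range f), k) \<in> ordLeq"
    using ordLeq_transitive[OF card_of_image k] .
  from r[OF f this] show ?thesis by auto
qed

section \<open>Colimits given by their universal property, compared with the construction\<close>

locale countably_filtered_colimit =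
  fixes K :: "complex set" and r :: "'i rel" and X :: "'i \<Rightarrow> 'u small_star_cat"
    and t :: "'i \<Rightarrow> 'i \<Rightarrow> 'u sfun"
    and L :: "'u small_star_cat" and m :: "'i \<Rightarrow> 'u sfun" and enc :: "'i \<times> 'u \<Rightarrow> 'u"
  assumes scalars: "K = \<real> \<or> K = UNIV"
    and enc: "inj enc"
    and r: "Well_order r"
    and bound: "\<And>f :: nat \<Rightarrow> 'i. range f \<subseteq> Field r \<Longrightarrow> \<exists>d \<in> Field r. \<forall>n. (f n, d) \<in> r"
    and seq: "transfinite_sequence (C1cat K) r X t"
    and col: "is_colimit (C1cat K) r (Field r) X t L m"
begin

lemma coc: "is_cocone (C1cat K) r (Field r) X t L m"
  using col by (simp add: is_colimit_def)

lemma t: "(b, c) \<in> r \<Longrightarrow> t b c \<in> hom (C1cat K) (X b) (X c)"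
  using seq by (auto simp: transfinite_sequence_def)

lemma m: "b \<in> Field r \<Longrightarrow> m b \<in> hom (C1cat K) (X b) L"
  using coc by (auto simp: is_cocone_def)

lemma m_t: "(b, c) \<in> r \<Longrightarrow> cmp (C1cat K) (m c) (t b c) = m b"
  using coc unfolding is_cocone_def Field_def by blast

sublocale S: countably_directed_system K r X t enc
proof (rule countably_directed_system.intro)
  fix b assume "b \<in> Field r"
  then show "(b, b) \<in> r"
    using r unfolding well_order_on_def linear_order_on_def partial_order_on_def preorder_on_def
      refl_on_def by blast
next
  fix b c d assume bc: "(b, c) \<in> r" "(c, d) \<in> r"
  then show "(b, d) \<in> r"
    using r unfolding well_order_on_def linear_order_on_def partial_order_on_def preorder_on_def
      by (meson transD)
  fix \<alpha> assume "\<alpha> \<in> arr (X b)"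
  moreover have "cmp (C1cat K) (t c d) (t b c) = t b d" using seq bc
    unfolding transfinite_sequence_def by blast
  ultimately show "far (t c d) (far (t b c) \<alpha>) = far (t b d) \<alpha>"
    using far_cmp_C1cat[OF t[OF bc(1)]] by metis
next
  fix b c assume "(b, c) \<in> r"
  from t[OF this] show "star_functor K (t b c)" and "fsrc (t b c) = X b" and "ftgt (t b c) = X c"
    unfolding hom_C1cat by blast+
qed (use scalars enc bound in auto)

definition out :: "'u sfun" where "out = S.colim_out L m"

lemma L: "cstar_category K L"
  using coc by (simp add: is_cocone_def obj_C1cat)

lemma m_t_far: "(b, c) \<in> r \<Longrightarrow> \<alpha> \<in> arr (X b) \<Longrightarrow> far (m c) (far (t b c) \<alpha>) = far (m b) \<alpha>"
  using far_cmp_C1cat[OF t] m_t by metis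

lemma m_functor: "b \<in> Field r \<Longrightarrow> star_functor K (m b)" "b \<in> Field r \<Longrightarrow> fsrc (m b) = X b"
  "b \<in> Field r \<Longrightarrow> ftgt (m b) = L"
  using m by (simp_all add: hom_C1cat)

lemma out: "out \<in> hom (C1cat K) S.colim L"
  using S.colim_out_functor[OF L m_functor m_t_far]
    by (simp add: hom_C1cat out_def) (simp add: S.colim_out_def)

lemma out_in: "b \<in> Field r \<Longrightarrow> cmp (C1cat K) out (S.colim_in b) = m b"
  using S.colim_out_in[OF L m_functor m_t_far] by (simp add: cmp_C1cat out_def)

lemma out_cl: "b \<in> Field r \<Longrightarrow> \<alpha> \<in> arr (X b) \<Longrightarrow> far out (S.cl b \<alpha>) = far (m b) \<alpha>"
  using S.colim_out_far[OF L m_functor m_t_far] by (simp add: out_def)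

lemma colim_in: "b \<in> Field r \<Longrightarrow> S.colim_in b \<in> hom (C1cat K) (X b) S.colim"
  using S.colim_in_functor by (simp add: hom_C1cat S.colim_in_sel)

text \<open>\<open>h\<close> exists by the universal property of \<open>L\<close>. Both
  \<open>cmp out h\<close> and the identity of \<open>L\<close> respect the cocone \<open>m\<close>,
  so uniqueness makes them equal and exhibits \<open>L\<close> as a retract.\<close>

lemma comparison:
  obtains h where "h \<in> hom (C1cat K) L S.colim"
    "\<And>b. b \<in> Field r \<Longrightarrow> cmp (C1cat K) h (m b) = S.colim_in b"
    "cmp (C1cat K) out h = ide (C1cat K) L"
proof -
  interpret CC: category "C1cat K" by (rule category_C1cat)
  have "is_cocone (C1cat K) r (Field r) X t S.colim S.colim_in"
    using S.colim_cstar colim_in S.colim_in_t by (auto simp: is_cocone_def obj_C1cat cmp_C1cat)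
  then obtain h where h: "h \<in> hom (C1cat K) L S.colim"
    "\<And>b. b \<in> Field r \<Longrightarrow> cmp (C1cat K) h (m b) = S.colim_in b"
    using col unfolding is_colimit_def by blast
  have "\<exists>!k. k \<in> hom (C1cat K) L L \<and> (\<forall>b \<in> Field r. cmp (C1cat K) k (m b) = m b)"
    using col coc unfolding is_colimit_def by blast
  moreover have "cmp (C1cat K) (cmp (C1cat K) out h) (m b) = m b" if "b \<in> Field r" for b
    using CC.cmp_assoc[OF m[OF that] h(1) out] h(2)[OF that] out_in[OF that] by simp
  moreover have "cmp (C1cat K) (ide (C1cat K) L) (m b) = m b" if "b \<in> Field r" for b
    using CC.ide_cmp[OF m[OF that]] .
  ultimately have "cmp (C1cat K) out h = ide (C1cat K) L"
    using CC.cmp_hom[OF h(1) out] ide_hom_C1cat[OF L] by blast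
  then show ?thesis using h that by blast
qed

text \<open>The arrows are sent by \<open>h\<close> to the constructed colimit, lifted there, and
  brought back by \<open>out\<close>. Since \<open>h\<close> is contractive and norms of germs are
  attained, the lifts need not be larger than the arrows; contractions thus lift to
  contractions.\<close>

lemma colimit_lift:
  assumes a: "a \<in> hom L x x'" and b: "b \<in> hom L y y'"
  shows "\<exists>d \<in> Field r. \<exists>\<sigma> \<alpha> \<beta>. \<alpha> \<in> hom (X d) (\<sigma> x) (\<sigma> x') \<and> \<beta> \<in> hom (X d) (\<sigma> y) (\<sigma> y') \<and>
    far (m d) \<alpha> = a \<and> far (m d) \<beta> = b \<and> nrm (X d) \<alpha> \<le> nrm L a \<and> nrm (X d) \<beta> \<le> nrm L b"
proof -
  obtain h where h: "h \<in> hom (C1cat K) L S.colim" "cmp (C1cat K) out h = ide (C1cat K) L"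
    by (rule comparison) blast
  obtain d \<sigma> \<alpha> \<beta> where d: "d \<in> Field r" and \<alpha>: "\<alpha> \<in> hom (X d) (\<sigma> (fob h x)) (\<sigma> (fob h x'))"
    and \<beta>: "\<beta> \<in> hom (X d) (\<sigma> (fob h y)) (\<sigma> (fob h y'))"
      and e: "far h a = S.cl d \<alpha>" "far h b = S.cl d \<beta>"
    by (rule S.colim_lift2[OF homD_far[OF h(1) a] homD_far[OF h(1) b]])
  have ar: "\<alpha> \<in> arr (X d)" "\<beta> \<in> arr (X d)" "a \<in> arr L" "b \<in> arr L" using \<alpha> \<beta> a b
    by (auto simp: hom_def)
  obtain c where dc: "(d, c) \<in> r" and n: "nrm (X c) (far (t d c) \<alpha>) = nrm S.colim (S.cl d \<alpha>)"
    "nrm (X c) (far (t d c) \<beta>) = nrm S.colim (S.cl d \<beta>)" by (rule S.colim_nrm_stable2[OF d ar(1,2)])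
  have le: "nrm S.colim (far h z) \<le> nrm L z" if "z \<in> hom L p q" for z p q
    using star_functor_contractive[OF homD_functor[OF h(1)] S.reals] that homD_src[OF h(1)]
      homD_tgt[OF h(1)] by simp
  have outh: "far out (far h z) = z" if "z \<in> arr L" for z
    using far_cmp_C1cat[OF h(1) that, of out] h(2) far_ide_C1cat[OF that] by metis
  have "far (m c) (far (t d c) \<alpha>) = a" "far (m c) (far (t d c) \<beta>) = b"
    using m_t_far[OF dc] ar out_cl[OF d] e outh by metis+
  then show ?thesis
    using S.r_Field(2)[OF dc] S.t_hom[OF dc \<alpha>] S.t_hom[OF dc \<beta>] n e le[OF a] le[OF b]
    by (intro bexI[of _ c] exI[of _ "\<lambda>z. fob (t d c) (\<sigma> (fob h z))"] exI[of _ "far (t d c) \<alpha>"]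
      exI[of _ "far (t d c) \<beta>"]) auto
qed

text \<open>Applying \<open>h\<close> to the common value shows that the two germs are equal, which
  by construction means agreement at a stage.\<close>

lemma colimit_eq:
  assumes b: "b \<in> Field r" and ar: "\<alpha> \<in> arr (X b)" "\<beta> \<in> arr (X b)" and eq: "far (m b) \<alpha> = far (m b) \<beta>"
  shows "\<exists>d. (b, d) \<in> r \<and> far (t b d) \<alpha> = far (t b d) \<beta>"
proof -
  obtain h where h: "\<And>b. b \<in> Field r \<Longrightarrow> cmp (C1cat K) h (m b) = S.colim_in b"
    by (rule comparison) blast
  have "S.cl b \<alpha> = far h (far (m b) \<alpha>)" "S.cl b \<beta> = far h (far (m b) \<beta>)"
    using far_cmp_C1cat[OF m[OF b], of _ h] h[OF b] ar by (simp_all add: S.colim_in_sel)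
  then show ?thesis using S.cl_eq[OF b ar(1) b ar(2)] eq by (auto simp: S.eqv_def)
qed

lemma colimit_eq2:
  assumes b: "b \<in> Field r" and ar: "\<alpha> \<in> arr (X b)" "\<beta> \<in> arr (X b)" "\<alpha>' \<in> arr (X b)" "\<beta>' \<in> arr (X b)"
    and eq: "far (m b) \<alpha> = far (m b) \<beta>" "far (m b) \<alpha>' = far (m b) \<beta>'"
  shows "\<exists>d. (b, d) \<in> r \<and> far (t b d) \<alpha> = far (t b d) \<beta> \<and> far (t b d) \<alpha>' = far (t b d) \<beta>'"
proof -
  obtain d where d: "(b, d) \<in> r" "far (t b d) \<alpha> = far (t b d) \<beta>" using colimit_eq[OF b ar(1,2) eq(1)]
    by blast
  obtain e where e: "(b, e) \<in> r" "far (t b e) \<alpha>' = far (t b e) \<beta>'"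
    using colimit_eq[OF b ar(3,4) eq(2)] by blast
  obtain c where c: "(d, c) \<in> r" "(e, c) \<in> r" using S.bound2 S.r_Field d e by blast
  show ?thesis
    using S.t_t[OF d(1) c(1)] S.t_t[OF e(1) c(2)] ar d(2) e(2) S.r_trans[OF d(1) c(1)] by metis
qed

text \<open>Objects are compared through their identity arrows.\<close>

lemma colimit_eq2_obj:
  assumes b: "b \<in> Field r" and ob: "x \<in> obj (X b)" "y \<in> obj (X b)" "x' \<in> obj (X b)" "y' \<in> obj (X b)"
    and eq: "fob (m b) x = fob (m b) y" "fob (m b) x' = fob (m b) y'"
  shows "\<exists>d. (b, d) \<in> r \<and> fob (t b d) x = fob (t b d) y \<and> fob (t b d) x' = fob (t b d) y'"
proof -
  have "\<exists>d. (b, d) \<in> r \<and> far (t b d) (ide (X b) x) = far (t b d) (ide (X b) y) \<and>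
      far (t b d) (ide (X b) x') = far (t b d) (ide (X b) y')"
    using ob eq homD_ide[OF m[OF b]] by (intro colimit_eq2[OF b]) (auto intro: S.ide_arr[OF b])
  then obtain d where d: "(b, d) \<in> r" "far (t b d) (ide (X b) x) = far (t b d) (ide (X b) y)"
      "far (t b d) (ide (X b) x') = far (t b d) (ide (X b) y')" by blast
  have "src (X d) (far (t b d) (ide (X b) z)) = fob (t b d) z" if "z \<in> obj (X b)" for z
    using S.t_src[OF d(1) S.ide_arr[OF b that]] S.ide_src[OF b that] by simp
  then show ?thesis using d ob by metis
qed

lemma colimit_obj_lift:
  assumes x: "x \<in> obj L" and y: "y \<in> obj L"
  shows "\<exists>d \<in> Field r. \<exists>\<xi> \<in> obj (X d). \<exists>\<upsilon> \<in> obj (X d). fob (m d) \<xi> = x \<and> fob (m d) \<upsilon> = y"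
proof -
  obtain d \<sigma> \<alpha> \<beta> where d: "d \<in> Field r" and h: "\<alpha> \<in> hom (X d) (\<sigma> x) (\<sigma> x)" "\<beta> \<in> hom (X d) (\<sigma> y) (\<sigma> y)"
    and e: "far (m d) \<alpha> = ide L x" "far (m d) \<beta> = ide L y"
    using colimit_lift[OF cstar_ide_hom[OF L x] cstar_ide_hom[OF L y]] by blast
  have "src L (ide L x) = x" "src L (ide L y) = y"
    using cstar_ide_hom[OF L] x y by (auto simp: hom_def)
  moreover have "\<sigma> x \<in> obj (X d)" "\<sigma> y \<in> obj (X d)"
    using h S.src_obj[OF d, of \<alpha>] S.src_obj[OF d, of \<beta>] by (auto simp: hom_def)
  moreover have "src L (far (m d) \<alpha>) = fob (m d) (\<sigma> x)" "src L (far (m d) \<beta>) = fob (m d) (\<sigma> y)"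
    using homD_far[OF m[OF d] h(1)] homD_far[OF m[OF d] h(2)] by (simp_all add: hom_def)
  ultimately show ?thesis using d e by metis
qed

end

text \<open>With \<open>k\<close> at least countable, sequences of indices of a
  \<open>k\<close>-filtered ordinal are bounded. It remains to factor maps through a stage
  (\<open>surj\<close>) and to identify two factorisations later on (\<open>inj\<close>).\<close>

lemma k_small_relI:
  fixes k :: "'u rel" and A :: "'u small_star_cat" and enc :: "'u \<times> 'u \<Rightarrow> 'u"
  assumes scalars: "K = \<real> \<or> K = UNIV" and enc: "inj enc"
    and k: "(card_of (UNIV :: nat set), k) \<in> ordLeq"
    and surj: "\<And>(r :: 'u rel) X t L m f. countably_filtered_colimit K r X t L m enc \<Longrightarrow> Field r \<noteq> {} \<Longrightarrow>
      f \<in> hom (C1cat K) A L \<Longrightarrow> \<exists>b \<in> Field r. \<exists>g \<in> hom (C1cat K) A (X b). cmp (C1cat K) (m b) g = f"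
    and inj: "\<And>(r :: 'u rel) X t L m b g g'. countably_filtered_colimit K r X t L m enc \<Longrightarrow>
      b \<in> Field r \<Longrightarrow>
      g \<in> hom (C1cat K) A (X b) \<Longrightarrow> g' \<in> hom (C1cat K) A (X b) \<Longrightarrow>
      cmp (C1cat K) (m b) g = cmp (C1cat K) (m b) g' \<Longrightarrow>
      \<exists>d. (b, d) \<in> r \<and> cmp (C1cat K) (t b d) g = cmp (C1cat K) (t b d) g'"
  shows "k_small_rel (C1cat K) k D A"
  unfolding k_small_rel_def
proof (intro allI impI, elim conjE)
  fix r :: "'u rel" and X :: "'u \<Rightarrow> 'u small_star_cat" and t L m
  assume r: "filtered_ordinal k r" and seq: "transfinite_sequence (C1cat K) r X t"
    and col: "is_colimit (C1cat K) r (Field r) X t L m"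
  have wo: "Well_order r" and ne: "Field r \<noteq> {}" and
    bd: "\<And>A. A \<subseteq> Field r \<Longrightarrow> (card_of A, k) \<in> ordLeq \<Longrightarrow> \<exists>b \<in> Field r. \<forall>a \<in> A. (a, b) \<in> r"
    using r by (auto simp: filtered_ordinal_def limit_ordinal_def)
  have c: "countably_filtered_colimit K r X t L m enc"
    by (rule countably_filtered_colimit.intro[OF scalars enc wo countable_bound[OF k bd] seq col])
  have coc: "is_cocone (C1cat K) r (Field r) X t L m" using col by (simp add: is_colimit_def)
  show "bij_betw (hom_colim_map (C1cat K) m) (hom_colim (C1cat K) A r X t) (hom (C1cat K) A L)"
    by (rule bij_betw_hom_colim[OF category_C1cat wo seq coc surj[OF c ne] inj[OF c]])
qed


section \<open>Surjective equivalences\<close>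

locale surj_equiv =
  fixes K :: "complex set" and F :: "'u sfun" and A B
  assumes F: "F \<in> hom (C1cat K) A B"
    and surj: "y \<in> obj B \<Longrightarrow> \<exists>x \<in> obj A. fob F x = y"
    and faithful: "a \<in> hom A x y \<Longrightarrow> a' \<in> hom A x y \<Longrightarrow> far F a = far F a' \<Longrightarrow> a = a'"
    and full: "x \<in> obj A \<Longrightarrow> y \<in> obj A \<Longrightarrow> b \<in> hom B (fob F x) (fob F y) \<Longrightarrow> \<exists>a \<in> hom A x y. far F a = b"
begin

sublocale A: cstar_category K A by (rule homD_srccat[OF F])
sublocale B: cstar_category K B by (rule homD_tgtcat[OF F])

lemmas F_hom = homD_far[OF F]

lemma F_ops:
  "a \<in> hom A x y \<Longrightarrow> b \<in> hom A y z \<Longrightarrow> far F (cmp A b a) = cmp B (far F b) (far F a)"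
  "a \<in> hom A x y \<Longrightarrow> a' \<in> hom A x y \<Longrightarrow> far F (add A a a') = add B (far F a) (far F a')"
  "k \<in> K \<Longrightarrow> a \<in> hom A x y \<Longrightarrow> far F (scale A k a) = scale B k (far F a)"
  "a \<in> hom A x y \<Longrightarrow> far F (star A a) = star B (far F a)"
  using star_functor.far_cmp[OF homD_functor[OF F]] star_functor.far_add[OF homD_functor[OF F]]
    star_functor.far_scale[OF homD_functor[OF F]] star_functor.far_star[OF homD_functor[OF F]]
  by (simp_all add: homD_src[OF F] homD_tgt[OF F])

lemma reflects_unitary:
  assumes u: "u \<in> hom A x y" and Fu: "unitary_arrow B (far F u)"
  shows "unitary_arrow A u"
proof -
  note su = A.star_hom[OF u] and o = A.hom_obj[OF u]
  have "far F (cmp A (star A u) u) = far F (ide A x)" "far F (cmp A u (star A u)) = far F (ide A y)"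
    using F_ops(1)[OF u su] F_ops(1)[OF su u] F_ops(4)[OF u] Fu F_hom[OF u] homD_ide[OF F o(1)]
      homD_ide[OF F o(2)]
    by (simp_all add: unitary_arrow_def hom_def)
  then have "cmp A (star A u) u = ide A x" "cmp A u (star A u) = ide A y"
    using faithful[OF A.cmp_hom[OF u su] A.ide_hom[OF o(1)]]
      faithful[OF A.cmp_hom[OF su u] A.ide_hom[OF o(2)]] by simp_all
  then show ?thesis using u by (simp add: unitary_arrow_def hom_def)
qed

text \<open>Once objects are lifted, fullness provides and faithfulness determines the lift of each
  arrow. The lift on objects is a parameter because a lifting problem against \<open>V\<close>
  prescribes it.\<close>

lemma lift_functor:
  assumes G: "G \<in> hom (C1cat K) D B"
    and \<phi>: "\<And>x. x \<in> obj D \<Longrightarrow> \<phi> x \<in> obj A" "\<And>x. x \<in> obj D \<Longrightarrow> fob F (\<phi> x) = fob G x"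
  obtains H where "H \<in> hom (C1cat K) D A" "cmp (C1cat K) F H = G" "\<And>x. x \<in> obj D \<Longrightarrow> fob H x = \<phi> x"
proof -
  interpret D: cstar_category K D by (rule homD_srccat[OF G])
  interpret G: star_functor K G by (rule homD_functor[OF G])
  note Gs = homD_src[OF G] homD_tgt[OF G]
  define \<psi> where "\<psi> c = (SOME a. a \<in> hom A (\<phi> (src D c)) (\<phi> (tgt D c)) \<and> far F a = far G c)" for c
  have \<psi>: "\<psi> c \<in> hom A (\<phi> x) (\<phi> y)" "far F (\<psi> c) = far G c" if c: "c \<in> hom D x y" for c x y
  proof -
    have "\<exists>a. a \<in> hom A (\<phi> (src D c)) (\<phi> (tgt D c)) \<and> far F a = far G c"
      using full[OF \<phi>(1) \<phi>(1), of x y "far G c"] D.hom_obj[OF c] \<phi>(2) homD_far[OF G c] c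
        by (auto simp: hom_def)
    from someI_ex[OF this] show "\<psi> c \<in> hom A (\<phi> x) (\<phi> y)" "far F (\<psi> c) = far G c"
      using c by (simp_all add: \<psi>_def hom_def)
  qed
  \<comment> \<open>Every functor law for \<psi> reduces to this: the expected value has the right
    ends and the right image under \<open>F\<close>.\<close>
  have uniq: "\<psi> c = a" if "c \<in> hom D x y" "a \<in> hom A (\<phi> x) (\<phi> y)" "far F a = far G c" for c x y a
    using faithful[OF \<psi>(1)[OF that(1)] that(2)] \<psi>(2)[OF that(1)] that(3) by simp
  define H where "H = \<lparr>fsrc = D, ftgt = A, fob = (\<lambda>x \<in> obj D. \<phi> x), far = (\<lambda>c \<in> arr D. \<psi> c)\<rparr>"
  have sel: "fsrc H = D" "ftgt H = A" "fob H = (\<lambda>x \<in> obj D. \<phi> x)" "far H = (\<lambda>c \<in> arr D. \<psi> c)"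
    by (simp_all add: H_def)
  have farH: "far H c = \<psi> c" if "c \<in> hom D x y" for c x y using D.hom_arr[OF that] by (simp add: sel)
  have fobH: "fob H x = \<phi> x" "fob H y = \<phi> y" if "c \<in> hom D x y" for c x y
    using D.hom_obj[OF that] by (simp_all add: sel)
  have "star_functor K H"
  proof (rule star_functor.intro, unfold sel(1,2))
    show "fob H \<in> obj D \<rightarrow>\<^sub>E obj A" using \<phi>(1) by (auto simp: sel)
    show "far H \<in> arr D \<rightarrow>\<^sub>E arr A" using A.hom_arr[OF \<psi>(1)[OF D.arr_hom]] by (auto simp: sel)
    show "far H c \<in> hom A (fob H x) (fob H y)" if "c \<in> hom D x y" for c x y
      using \<psi>(1)[OF that] farH[OF that] fobH[OF that] by simp
    show "far H (ide D x) = ide A (fob H x)" if "x \<in> obj D" for x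
      using farH[OF D.ide_hom[OF that]] uniq[OF D.ide_hom[OF that] A.ide_hom[OF \<phi>(1)[OF that]]]
        homD_ide[OF F \<phi>(1)[OF that]] homD_ide[OF G that] \<phi>(2)[OF that] that by (simp add: sel(3))
  next
    fix a b x y z assume h: "a \<in> hom D x y" "b \<in> hom D y z"
    show "far H (cmp D b a) = cmp A (far H b) (far H a)"
      using uniq[OF D.cmp_hom[OF h] A.cmp_hom[OF \<psi>(1)[OF h(1)] \<psi>(1)[OF h(2)]]]
        F_ops(1)[OF \<psi>(1)[OF h(1)] \<psi>(1)[OF h(2)]]
        G.far_cmp[unfolded Gs, OF h] \<psi>(2)[OF h(1)] \<psi>(2)[OF h(2)] farH[OF h(1)] farH[OF h(2)]
          farH[OF D.cmp_hom[OF h]] by simp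
  next
    fix a b x y assume h: "a \<in> hom D x y" "b \<in> hom D x y"
    show "far H (add D a b) = add A (far H a) (far H b)"
      using uniq[OF D.add_hom[OF h] A.add_hom[OF \<psi>(1)[OF h(1)] \<psi>(1)[OF h(2)]]]
        F_ops(2)[OF \<psi>(1)[OF h(1)] \<psi>(1)[OF h(2)]]
        G.far_add[unfolded Gs, OF h] \<psi>(2)[OF h(1)] \<psi>(2)[OF h(2)] farH[OF h(1)] farH[OF h(2)]
          farH[OF D.add_hom[OF h]] by simp
  next
    fix k a x y assume k: "k \<in> K" and h: "a \<in> hom D x y"
    show "far H (scale D k a) = scale A k (far H a)"
      using uniq[OF D.scale_hom[OF k h] A.scale_hom[OF k \<psi>(1)[OF h]]] F_ops(3)[OF k \<psi>(1)[OF h]]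
        G.far_scale[unfolded Gs, OF k h] \<psi>(2)[OF h] farH[OF h] farH[OF D.scale_hom[OF k h]] by simp
  next
    fix a x y assume h: "a \<in> hom D x y"
    show "far H (star D a) = star A (far H a)"
      using uniq[OF D.star_hom[OF h] A.star_hom[OF \<psi>(1)[OF h]]] F_ops(4)[OF \<psi>(1)[OF h]]
        G.far_star[unfolded Gs, OF h] \<psi>(2)[OF h] farH[OF h] farH[OF D.star_hom[OF h]] by simp
  qed (rule D.cstar_category_axioms A.cstar_category_axioms)+
  then have H: "H \<in> hom (C1cat K) D A" by (simp add: hom_C1cat sel)
  moreover have "cmp (C1cat K) F H = G"
  proof (rule sfun_eqI[OF cmp_hom_C1cat[OF H F] G])
    fix c assume "c \<in> arr D"
    then show "far (cmp (C1cat K) F H) c = far G c"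
      using far_cmp_C1cat[OF H, of c F] \<psi>(2)[OF D.arr_hom] by (simp add: sel)
  qed
  ultimately show ?thesis using that by (simp add: sel)
qed

lemma is_fibration: "unitary_fibration K F"
  unfolding unitary_fibration_def homD_src[OF F] homD_tgt[OF F]
proof (intro conjI ballI impI)
  fix x y v assume x: "x \<in> obj A" and y: "y \<in> obj B"
    and v: "v \<in> hom B (fob F x) y" "unitary_arrow B v"
  obtain x' where x': "x' \<in> obj A" "fob F x' = y" using surj[OF y] by blast
  then obtain u where "u \<in> hom A x x'" "far F u = v" using full[OF x x'(1)] v by blast
  then show "\<exists>x' \<in> obj A. \<exists>u \<in> hom A x x'. unitary_arrow A u \<and> far F u = v"
    using reflects_unitary v x' by blast
qed (rule homD_functor[OF F])

text \<open>A section on objects lifts the identity of \<open>B\<close> to a strict section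
  \<open>H\<close> of \<open>F\<close>. The isomorphism from \<open>H F\<close> to the identity has
  as components lifts of identity arrows, unitary because \<open>F\<close> reflects
  unitaries.\<close>

lemma is_equivalence:
  assumes K: "\<real> \<subseteq> K"
  shows "unitary_equivalence K F"
proof -
  obtain \<sigma> where \<sigma>: "\<And>y. y \<in> obj B \<Longrightarrow> \<sigma> y \<in> obj A" "\<And>y. y \<in> obj B \<Longrightarrow> fob F (\<sigma> y) = y"
    using surj by metis
  obtain H where H: "H \<in> hom (C1cat K) B A" "cmp (C1cat K) F H = ide (C1cat K) B"
  proof (rule lift_functor[OF ide_hom_C1cat[OF B.cstar_category_axioms] \<sigma>(1)])
    show "fob F (\<sigma> y) = fob (ide (C1cat K) B) y" if "y \<in> obj B" for y
      using \<sigma>(2)[OF that] fob_ide_C1cat[OF that, of K] by simp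
  qed
  have FH: "far F (far H b) = b" if "b \<in> arr B" for b
    using far_cmp_C1cat[OF H(1) that, of F] H(2) far_ide_C1cat[OF that] by metis
  have FHo: "fob F (fob H y) = y" if "y \<in> obj B" for y
    using fob_cmp_C1cat[OF H(1) that, of F] H(2) fob_ide_C1cat[OF that] by metis
  have "unitary_nat_iso (sfun_id B) (sfun_id B)"
    unfolding unitary_nat_iso_def
  proof (intro exI[of _ "ide B"] conjI ballI allI)
    fix x assume "x \<in> obj (fsrc (sfun_id B))"
    then show "ide B x \<in> hom (ftgt (sfun_id B)) (fob (sfun_id B) x) (fob (sfun_id B) x)"
      "unitary_arrow (ftgt (sfun_id B)) (ide B x)"
      using B.ide_hom unitary_ide[OF B.cstar_category_axioms _ K] by (simp_all add: sfun_id_def)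
  next
    fix x y a assume "a \<in> hom (fsrc (sfun_id B)) x y"
    then have a: "a \<in> hom B x y" by (simp add: sfun_id_def)
    then show "cmp (ftgt (sfun_id B)) (ide B y) (far (sfun_id B) a) = cmp (ftgt (sfun_id B))
      (far (sfun_id B) a) (ide B x)"
      using B.hom_arr[OF a] B.cmp_ide[OF a] B.ide_cmp[OF a] by (simp add: sfun_id_def)
  qed
  then have 1: "unitary_nat_iso (sfun_comp F H) (sfun_id (ftgt F))"
    using H(2) by (simp add: cmp_C1cat ide_C1cat homD_tgt[OF F])
  have HF: "sfun_comp H F \<in> hom (C1cat K) A A"
    using cmp_hom_C1cat[OF F H(1)] by (simp add: cmp_C1cat)
  have HFo: "fob (sfun_comp H F) x = fob H (fob F x)" if "x \<in> obj A" for x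
    using fob_cmp_C1cat[OF F that, of H] by (simp add: cmp_C1cat)
  have HFa: "far (sfun_comp H F) a = far H (far F a)" if "a \<in> arr A" for a
    using far_cmp_C1cat[OF F that, of H] by (simp add: cmp_C1cat)
  have "\<exists>e. x \<in> obj A \<longrightarrow> e \<in> hom A (fob H (fob F x)) x \<and> far F e = ide B (fob F x)" for x
  proof (cases "x \<in> obj A")
    case True
    note Fx = homD_fob[OF F True]
    show ?thesis
      using full[OF homD_fob[OF H(1) Fx] True, of "ide B (fob F x)"] B.ide_hom[OF Fx] FHo[OF Fx]
        by auto
  qed simp
  then obtain \<eta> where \<eta>: "\<And>x. x \<in> obj A \<Longrightarrow> \<eta> x \<in> hom A (fob H (fob F x)) x"
    "\<And>x. x \<in> obj A \<Longrightarrow> far F (\<eta> x) = ide B (fob F x)" by metis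
  have "unitary_nat_iso (sfun_comp H F) (sfun_id A)"
    unfolding unitary_nat_iso_def homD_src[OF HF] homD_tgt[OF HF]
  proof (intro exI[of _ \<eta>] conjI ballI allI)
    fix x assume x: "x \<in> obj A"
    show "\<eta> x \<in> hom A (fob (sfun_comp H F) x) (fob (sfun_id A) x)"
      using \<eta>(1)[OF x] HFo[OF x] x by (simp add: sfun_id_def)
    show "unitary_arrow A (\<eta> x)"
      by (rule reflects_unitary[OF \<eta>(1)[OF x]])
        (simp add: \<eta>(2)[OF x] unitary_ide[OF B.cstar_category_axioms homD_fob[OF F x] K])
  next
    fix x y a assume a: "a \<in> hom A x y"
    note o = A.hom_obj[OF a]
    have b: "far H (far F a) \<in> hom A (fob H (fob F x)) (fob H (fob F y))"
      by (rule homD_far[OF H(1) F_hom[OF a]])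
    have "cmp A (\<eta> y) (far H (far F a)) = cmp A a (\<eta> x)"
    proof (rule faithful[OF A.cmp_hom[OF b \<eta>(1)[OF o(2)]] A.cmp_hom[OF \<eta>(1)[OF o(1)] a]])
      show "far F (cmp A (\<eta> y) (far H (far F a))) = far F (cmp A a (\<eta> x))"
        using F_ops(1)[OF b \<eta>(1)[OF o(2)]] F_ops(1)[OF \<eta>(1)[OF o(1)] a] \<eta>(2)[OF o(1)] \<eta>(2)[OF o(2)]
          FH[OF B.hom_arr[OF F_hom[OF a]]] B.cmp_ide[OF F_hom[OF a]] B.ide_cmp[OF F_hom[OF a]] by simp
    qed
    then show "cmp A (\<eta> y) (far (sfun_comp H F) a) = cmp A (far (sfun_id A) a) (\<eta> x)"
      using HFa[OF A.hom_arr[OF a]] A.hom_arr[OF a] by (simp add: sfun_id_def)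
  qed
  then have 2: "unitary_nat_iso (sfun_comp H F) (sfun_id (fsrc F))" by (simp add: homD_src[OF F])
  show ?thesis
    unfolding unitary_equivalence_def
    by (intro conjI exI[of _ H] 1 2 homD_functor[OF F] homD_functor[OF H(1)])
      (simp_all add: homD_src[OF H(1)] homD_tgt[OF H(1)] homD_src[OF F] homD_tgt[OF F])
qed

end

text \<open>Naturality recovers \<open>a\<close> from \<open>far H a\<close> by composing with
  unitaries that depend only on \<open>x\<close> and \<open>y\<close>.\<close>

lemma unitary_nat_iso_reflects:
  assumes H: "H \<in> hom (C1cat K) A A" and iso: "unitary_nat_iso H (sfun_id A)"
    and a: "a \<in> hom A x y" "a' \<in> hom A x y" and eq: "far H a = far H a'"
  shows "a = a'"
proof -
  interpret A: cstar_category K A by (rule homD_srccat[OF H])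
  obtain \<eta> where \<eta>: "\<And>x. x \<in> obj A \<Longrightarrow> \<eta> x \<in> hom A (fob H x) (fob (sfun_id A) x)"
    "\<And>x. x \<in> obj A \<Longrightarrow> unitary_arrow A (\<eta> x)"
    and nat: "\<And>x y a. a \<in> hom A x y \<Longrightarrow> cmp A (\<eta> y) (far H a) = cmp A (far (sfun_id A) a) (\<eta> x)"
    using iso unfolding unitary_nat_iso_def homD_src[OF H] homD_tgt[OF H] by blast
  note o = A.hom_obj[OF a(1)]
  have e: "\<eta> x \<in> hom A (fob H x) x" using \<eta>(1)[OF o(1)] o(1) by (simp add: sfun_id_def)
  note se = A.star_hom[OF e]
  have inv: "cmp A (\<eta> x) (star A (\<eta> x)) = ide A x"
    using \<eta>(2)[OF o(1)] e by (simp add: unitary_arrow_def hom_def)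
  have "cmp A (cmp A (\<eta> y) (far H c)) (star A (\<eta> x)) = c" if c: "c \<in> hom A x y" for c
  proof -
    have "cmp A (\<eta> y) (far H c) = cmp A c (\<eta> x)" using nat[OF c] A.hom_arr[OF c]
      by (simp add: sfun_id_def)
    then show ?thesis using A.cmp_assoc[OF se e c] inv A.cmp_ide[OF c] by simp
  qed
  note L = this
  show ?thesis by (rule trans[OF sym[OF L[OF a(1), unfolded eq]] L[OF a(2)]])
qed

lemma trivial_fibration_iff:
  assumes K: "\<real> \<subseteq> K"
  shows "unitary_fibration K F \<and> unitary_equivalence K F \<longleftrightarrow> surj_equiv K F (fsrc F) (ftgt F)"
proof
  assume "surj_equiv K F (fsrc F) (ftgt F)"
  then show "unitary_fibration K F \<and> unitary_equivalence K F"
    using surj_equiv.is_fibration surj_equiv.is_equivalence[OF _ K] by blast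
next
  let ?A = "fsrc F" and ?B = "ftgt F"
  assume *: "unitary_fibration K F \<and> unitary_equivalence K F"
  then obtain G where F: "star_functor K F" and G: "star_functor K G" "fsrc G = ?B" "ftgt G = ?A"
    and i: "unitary_nat_iso (sfun_comp G F) (sfun_id ?A)"
      "unitary_nat_iso (sfun_comp F G) (sfun_id ?B)"
    by (auto simp: unitary_equivalence_def)
  have Fh: "F \<in> hom (C1cat K) ?A ?B" and Gh: "G \<in> hom (C1cat K) ?B ?A"
    using F G by (simp_all add: hom_C1cat)
  have GF: "sfun_comp G F \<in> hom (C1cat K) ?A ?A" and FG: "sfun_comp F G \<in> hom (C1cat K) ?B ?B"
    using cmp_hom_C1cat[OF Fh Gh] cmp_hom_C1cat[OF Gh Fh] by (simp_all add: cmp_C1cat)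
  have GFa: "far (sfun_comp G F) a = far G (far F a)" if "a \<in> arr ?A" for a
    using far_cmp_C1cat[OF Fh that, of G] by (simp add: cmp_C1cat)
  have FGa: "far (sfun_comp F G) a = far F (far G a)" if "a \<in> arr ?B" for a
    using far_cmp_C1cat[OF Gh that, of F] by (simp add: cmp_C1cat)
  interpret A: cstar_category K ?A by (rule homD_srccat[OF Fh])
  interpret B: cstar_category K ?B by (rule homD_tgtcat[OF Fh])
  have faithful: "a = a'" if "a \<in> hom ?A x y" "a' \<in> hom ?A x y" "far F a = far F a'" for a a' x y
    using unitary_nat_iso_reflects[OF GF i(1) that(1,2)] GFa[OF A.hom_arr[OF that(1)]]
      GFa[OF A.hom_arr[OF that(2)]] that(3)
    by simp
  have faithful_G: "b = b'" if "b \<in> hom ?B x y" "b' \<in> hom ?B x y" "far G b = far G b'" for b b' x y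
    using unitary_nat_iso_reflects[OF FG i(2) that(1,2)] FGa[OF B.hom_arr[OF that(1)]]
      FGa[OF B.hom_arr[OF that(2)]] that(3)
    by simp
  obtain \<eta> where \<eta>: "\<And>x. x \<in> obj ?A \<Longrightarrow> \<eta> x \<in> hom ?A (fob (sfun_comp G F) x) (fob (sfun_id ?A) x)"
    "\<And>x. x \<in> obj ?A \<Longrightarrow> unitary_arrow ?A (\<eta> x)"
    and nat: "\<And>x y a. a \<in> hom ?A x y \<Longrightarrow> cmp ?A (\<eta> y) (far (sfun_comp G F) a) = cmp ?A
      (far (sfun_id ?A) a) (\<eta> x)"
    using i(1) unfolding unitary_nat_iso_def homD_src[OF GF] homD_tgt[OF GF] by blast
  have \<eta>h: "\<eta> x \<in> hom ?A (fob G (fob F x)) x" if "x \<in> obj ?A" for x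
    using \<eta>(1)[OF that] that fob_cmp_C1cat[OF Fh that, of G] by (simp add: sfun_id_def cmp_C1cat)
  have full: "\<exists>a \<in> hom ?A x y. far F a = b"
    if x: "x \<in> obj ?A" and y: "y \<in> obj ?A" and b: "b \<in> hom ?B (fob F x) (fob F y)" for x y b
  proof -
    note ex = \<eta>h[OF x] and ey = \<eta>h[OF y]
    note sx = A.star_hom[OF ex] and sy = A.star_hom[OF ey]
    have ux: "cmp ?A (star ?A (\<eta> x)) (\<eta> x) = ide ?A (fob G (fob F x))"
      using \<eta>(2)[OF x] ex by (simp add: unitary_arrow_def hom_def)
    have uy: "cmp ?A (star ?A (\<eta> y)) (\<eta> y) = ide ?A (fob G (fob F y))"
      using \<eta>(2)[OF y] ey by (simp add: unitary_arrow_def hom_def)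
    have Gb: "far G b \<in> hom ?A (fob G (fob F x)) (fob G (fob F y))" by (rule homD_far[OF Gh b])
    note c = A.cmp_hom[OF Gb ey]
    \<comment> \<open>The candidate suggested by naturality of \<eta>. It satisfies
      \<open>G F a = G b\<close>, and faithfulness of \<open>G\<close> gives
      \<open>F a = b\<close>.\<close>
    define a where "a = cmp ?A (cmp ?A (\<eta> y) (far G b)) (star ?A (\<eta> x))"
    have a: "a \<in> hom ?A x y" unfolding a_def by (rule A.cmp_hom[OF sx c])
    have Ga: "far G (far F a) \<in> hom ?A (fob G (fob F x)) (fob G (fob F y))"
      by (rule homD_far[OF Gh homD_far[OF Fh a]])
    have "cmp ?A (\<eta> y) (far G (far F a)) = cmp ?A a (\<eta> x)"
      using nat[OF a] GFa[OF A.hom_arr[OF a]] A.hom_arr[OF a] by (simp add: sfun_id_def)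
    also have "\<dots> = cmp ?A (\<eta> y) (far G b)"
      using A.cmp_assoc[OF ex sx c] ux A.cmp_ide[OF c] by (simp add: a_def)
    finally have eq: "cmp ?A (\<eta> y) (far G (far F a)) = cmp ?A (\<eta> y) (far G b)" .
    have "cmp ?A (star ?A (\<eta> y)) (cmp ?A (\<eta> y) z) = z"
      if z: "z \<in> hom ?A (fob G (fob F x)) (fob G (fob F y))" for z
      using A.cmp_assoc[OF z ey sy] uy A.ide_cmp[OF z] by simp
    note L = this
    have "far G (far F a) = far G b" by (rule trans[OF sym[OF L[OF Ga, unfolded eq]] L[OF Gb]])
    then have "far F a = b" using faithful_G[OF homD_far[OF Fh a] b] by simp
    then show ?thesis using a by blast
  qed
  \<comment> \<open>Essential surjectivity is made strict by the fibration property: the unitary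
    from \<open>F G y\<close> to \<open>y\<close> lifts, and the target of the lift lies over
    \<open>y\<close> itself.\<close>
  have surj: "\<exists>x \<in> obj ?A. fob F x = y" if y: "y \<in> obj ?B" for y
  proof -
    obtain \<epsilon> where \<epsilon>: "\<And>x. x \<in> obj ?B \<Longrightarrow> \<epsilon> x \<in> hom ?B (fob (sfun_comp F G) x) (fob (sfun_id ?B) x)"
      "\<And>x. x \<in> obj ?B \<Longrightarrow> unitary_arrow ?B (\<epsilon> x)"
      using i(2) unfolding unitary_nat_iso_def homD_src[OF FG] homD_tgt[OF FG] by blast
    have v: "\<epsilon> y \<in> hom ?B (fob F (fob G y)) y" "unitary_arrow ?B (\<epsilon> y)"
      using \<epsilon>[OF y] y fob_cmp_C1cat[OF Gh y, of F] by (simp_all add: sfun_id_def cmp_C1cat)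
    obtain x' u where u: "x' \<in> obj ?A" "u \<in> hom ?A (fob G y) x'" "far F u = \<epsilon> y"
      using * homD_fob[OF Gh y] y v unfolding unitary_fibration_def by blast
    then have "fob F x' = y" using homD_far[OF Fh u(2)] v(1) by (simp add: hom_def)
    then show ?thesis using u(1) by blast
  qed
  show "surj_equiv K F ?A ?B"
    by (rule surj_equiv.intro[OF Fh surj faithful full])
qed


section \<open>The generating maps\<close>

text \<open>\<theta> identifies arrows with scalars; the arrow of the scalar \<open>z\<close> is
  sent to \<open>z\<close> times the identity of \<open>x\<close>.\<close>

lemma scalar_cat_functor:
  assumes scalars: "K = \<real> \<or> K = UNIV" and Fld: "is_scalar_cat K Fld pt"
    and B: "cstar_category K B" and x: "x \<in> obj B"
  shows "\<exists>F \<in> hom (C1cat K) Fld B. fob F pt = x"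
proof -
  obtain \<theta> where A: "cstar_category K Fld" "obj Fld = {pt}"
    and bij: "bij_betw \<theta> K (hom Fld pt pt)" "\<theta> 1 = ide Fld pt"
    and \<theta>: "\<And>z w. z \<in> K \<Longrightarrow> w \<in> K \<Longrightarrow> \<theta> (z * w) = cmp Fld (\<theta> z) (\<theta> w)"
      "\<And>z w. z \<in> K \<Longrightarrow> w \<in> K \<Longrightarrow> \<theta> (z + w) = add Fld (\<theta> z) (\<theta> w)"
      "\<And>z w. z \<in> K \<Longrightarrow> w \<in> K \<Longrightarrow> \<theta> (z * w) = scale Fld z (\<theta> w)"
      "\<And>z. z \<in> K \<Longrightarrow> \<theta> (cnj z) = star Fld (\<theta> z)"
    using Fld unfolding is_scalar_cat_def by blast
  interpret A: cstar_category K Fld by (rule A(1))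
  have reals: "\<real> \<subseteq> K" using scalars by auto
  interpret B: real_cstar_category K B by (rule real_cstar_categoryI[OF B reals])
  have K: "z * w \<in> K" "z + w \<in> K" "cnj z \<in> K" if "z \<in> K" "w \<in> K" for z w
    using that scalars by (auto simp: Reals_cnj_iff)
  define \<psi> where "\<psi> = inv_into K \<theta>"
  have arr: "arr Fld = hom Fld pt pt"
    using A.src_obj A.tgt_obj A(2) by (auto simp: hom_def)
  have \<psi>: "\<psi> c \<in> K" "\<theta> (\<psi> c) = c" if "c \<in> hom Fld pt pt" for c
    using that bij(1) by (auto simp: \<psi>_def bij_betw_def inv_into_into f_inv_into_f)
  have \<psi>\<theta>: "\<psi> (\<theta> z) = z" if "z \<in> K" for z
    using that bij(1) by (auto simp: \<psi>_def bij_betw_def)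
  let ?i = "ide B x"
  have i: "?i \<in> hom B x x" by (rule B.ide_hom[OF x])
  define F where "F = \<lparr>fsrc = Fld, ftgt = B, fob = (\<lambda>p \<in> {pt}. x),
    far = (\<lambda>c \<in> arr Fld. scale B (\<psi> c) ?i)\<rparr>"
  have sel: "fsrc F = Fld" "ftgt F = B" "fob F = (\<lambda>p \<in> {pt}. x)"
    "far F = (\<lambda>c \<in> arr Fld. scale B (\<psi> c) ?i)"
    by (simp_all add: F_def)
  have far: "far F c = scale B (\<psi> c) ?i" if "c \<in> hom Fld pt pt" for c
    using that by (simp add: sel arr)
  have at: "u = pt \<and> v = pt" if "c \<in> hom Fld u v" for c u v
    using A.hom_obj[OF that] A(2) by simp
  have "star_functor K F"
  proof (rule star_functor.intro, unfold sel(1,2))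
    show "fob F \<in> obj Fld \<rightarrow>\<^sub>E obj B" using x by (simp add: sel A(2))
    show "far F \<in> arr Fld \<rightarrow>\<^sub>E arr B"
      using B.hom_arr[OF B.scale_hom[OF \<psi>(1) i]] by (auto simp: sel arr)
    show "far F c \<in> hom B (fob F u) (fob F v)" if "c \<in> hom Fld u v" for c u v
      using at[OF that] that B.scale_hom[OF \<psi>(1) i] far by (simp add: sel(3))
    show "far F (ide Fld u) = ide B (fob F u)" if "u \<in> obj Fld" for u
      using that A(2) far[OF A.ide_hom[of pt]] \<psi>\<theta>[of 1] bij(2) B.scale_one[OF i] B.numeral_K
        by (simp add: sel(3))
  next
    fix a b u v w assume h: "a \<in> hom Fld u v" "b \<in> hom Fld v w"
    then have a: "a \<in> hom Fld pt pt" and b: "b \<in> hom Fld pt pt" using at[OF h(1)] at[OF h(2)]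
      by simp_all
    note ka = \<psi>(1)[OF a] and kb = \<psi>(1)[OF b]
    have "\<psi> (cmp Fld b a) = \<psi> b * \<psi> a"
      using \<theta>(1)[OF kb ka] \<psi>(2)[OF a] \<psi>(2)[OF b] \<psi>\<theta>[OF K(1)[OF kb ka]] by simp
    then show "far F (cmp Fld b a) = cmp B (far F b) (far F a)"
      using far[OF A.cmp_hom[OF a b]] far[OF a] far[OF b]
        B.cmp_scale_right[OF ka i B.scale_hom[OF kb i]]
        B.cmp_scale_left[OF kb i i] B.cmp_ide[OF i] B.scale_scale[OF ka kb i]
          by (simp add: mult.commute)
  next
    fix a b u v assume h: "a \<in> hom Fld u v" "b \<in> hom Fld u v"
    then have a: "a \<in> hom Fld pt pt" and b: "b \<in> hom Fld pt pt" using at[OF h(1)] at[OF h(2)]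
      by simp_all
    note ka = \<psi>(1)[OF a] and kb = \<psi>(1)[OF b]
    have "\<psi> (add Fld a b) = \<psi> a + \<psi> b"
      using \<theta>(2)[OF ka kb] \<psi>(2)[OF a] \<psi>(2)[OF b] \<psi>\<theta>[OF K(2)[OF ka kb]] by simp
    then show "far F (add Fld a b) = add B (far F a) (far F b)"
      using far[OF A.add_hom[OF a b]] far[OF a] far[OF b] B.add_scale[OF ka kb i] by simp
  next
    fix k a u v assume k: "k \<in> K" and h: "a \<in> hom Fld u v"
    then have a: "a \<in> hom Fld pt pt" using at[OF h] by simp
    note ka = \<psi>(1)[OF a]
    have "\<psi> (scale Fld k a) = k * \<psi> a"
      using \<theta>(3)[OF k ka] \<psi>(2)[OF a] \<psi>\<theta>[OF K(1)[OF k ka]] by simp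
    then show "far F (scale Fld k a) = scale B k (far F a)"
      using far[OF A.scale_hom[OF k a]] far[OF a] B.scale_scale[OF k ka i] by simp
  next
    fix a u v assume h: "a \<in> hom Fld u v"
    then have a: "a \<in> hom Fld pt pt" using at[OF h] by simp
    note ka = \<psi>(1)[OF a]
    have "\<psi> (star Fld a) = cnj (\<psi> a)"
      using \<theta>(4)[OF ka] \<psi>(2)[OF a] \<psi>\<theta>[OF K(3)[OF ka ka]] by simp
    then show "far F (star Fld a) = star B (far F a)"
      using far[OF A.star_hom[OF a]] far[OF a] B.star_scale[OF ka i] B.star_ide[OF x] by simp
  qed (rule A B)+
  then show ?thesis by (intro bexI[of _ F]) (simp_all add: hom_C1cat sel)
qed

text \<open>Every arrow of \<open>Fld\<close> is a scalar multiple of the identity.\<close>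

lemma scalar_cat_functor_eq:
  assumes scalars: "K = \<real> \<or> K = UNIV" and Fld: "is_scalar_cat K Fld pt"
    and F: "F \<in> hom (C1cat K) Fld B" and G: "G \<in> hom (C1cat K) Fld B" and eq: "fob F pt = fob G pt"
  shows "F = G"
proof (rule sfun_eqI[OF F G])
  fix c assume c: "c \<in> arr Fld"
  obtain \<theta> where A: "cstar_category K Fld" "obj Fld = {pt}"
    and bij: "bij_betw \<theta> K (hom Fld pt pt)" "\<theta> 1 = ide Fld pt"
    and \<theta>: "\<And>z w. z \<in> K \<Longrightarrow> w \<in> K \<Longrightarrow> \<theta> (z * w) = scale Fld z (\<theta> w)"
    using Fld unfolding is_scalar_cat_def by blast
  interpret A: cstar_category K Fld by (rule A(1))
  have "c \<in> hom Fld pt pt" using c A.src_obj A.tgt_obj A(2) by (auto simp: hom_def)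
  then obtain z where z: "z \<in> K" "c = \<theta> z" using bij(1) by (auto simp: bij_betw_def)
  have "(1::complex) \<in> K" using scalars by auto
  then have cz: "c = scale Fld z (ide Fld pt)" using \<theta>[of z 1] z bij(2) by simp
  have "far H c = scale B z (ide B (fob H pt))" if H: "H \<in> hom (C1cat K) Fld B" for H
    using star_functor.far_scale[OF homD_functor[OF H] z(1), of "ide Fld pt" pt pt] homD_src[OF H]
      homD_tgt[OF H]
      A.ide_hom[of pt] A(2) homD_ide[OF H, of pt] cz by simp
  then show "far F c = far G c" using F G eq by simp
qed

lemma empty_functor:
  fixes A B :: "'u small_star_cat"
  assumes "cstar_category K A" "obj A = {}" "cstar_category K B"
  shows "\<exists>F. F \<in> hom (C1cat K) A B"
proof -
  interpret A: cstar_category K A by fact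
  have arr: "arr A = {}" using A.src_obj assms(2) by auto
  \<comment> \<open>Extensional maps on an empty carrier are constantly
    \<open>undefined\<close>.\<close>
  define F where "F = \<lparr>fsrc = A, ftgt = B, fob = (\<lambda>x. undefined), far = (\<lambda>a. undefined)\<rparr>"
  have "star_functor K F"
    by (rule star_functor.intro) (use assms arr in \<open>auto simp: F_def hom_def\<close>)
  then show ?thesis by (auto simp: hom_C1cat F_def)
qed

lemma empty_functor_eq:
  assumes "obj A = {}" "F \<in> hom (C1cat K) A B" "G \<in> hom (C1cat K) A B"
  shows "F = G"
proof (rule sfun_eqI[OF assms(2,3)])
  interpret A: cstar_category K A by (rule homD_srccat[OF assms(2)])
  fix a assume "a \<in> arr A"
  then show "far F a = far G a" using A.src_obj assms(1) by auto
qed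

text \<open>Moves an arrow into the unit ball, where \<open>One\<close> and \<open>P\<close>
  classify arrows, in a way that scaling by \<open>1 / e\<close> undoes.\<close>

lemma (in real_cstar_category) scale_contraction:
  assumes a: "a \<in> hom A x y" and e: "0 < e" "e * nrm A a \<le> 1"
  shows "scale A (of_real e) a \<in> hom A x y" "nrm A (scale A (of_real e) a) \<le> 1"
    "scale A (of_real (1 / e)) (scale A (of_real e) a) = a"
  using scale_hom[OF of_real_K a] nrm_scale[OF of_real_K a, of e]
    scale_scale[OF of_real_K of_real_K a, of "1 / e" e]
    scale_one[OF a] e by simp_all

locale generating_maps =
  fixes K :: "complex set"
    and Emp Fld Sum One P Iv :: "'u small_star_cat"
    and U V W Z in0 in1 j0 j1 :: "'u sfun"
    and pt x0 x1 a y0 y1 u :: 'u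
    and enc :: "'u \<times> 'u \<Rightarrow> 'u"
  assumes scalars: "K = \<real> \<or> K = UNIV"
    and enc: "inj enc"
    and empty: "Emp \<in> obj (C1cat K)" "obj Emp = {}"
    and field: "is_scalar_cat K Fld pt"
    and coproduct: "is_coproduct (C1cat K) Fld Fld Sum in0 in1"
    and one: "universal_contraction K One x0 x1 a"
    and interval: "universal_unitary K Iv y0 y1 u"
    and U: "U \<in> hom (C1cat K) Emp Fld"
    and V: "V \<in> hom (C1cat K) Sum One"
      "fob (cmp (C1cat K) V in0) pt = x0" "fob (cmp (C1cat K) V in1) pt = x1"
    and P: "is_pushout (C1cat K) V V j0 j1" "P = tgt (C1cat K) j0"
    and W: "W \<in> hom (C1cat K) P One"
      "cmp (C1cat K) W j0 = ide (C1cat K) One" "cmp (C1cat K) W j1 = ide (C1cat K) One"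
    and Z: "Z \<in> hom (C1cat K) Fld Iv" "fob Z pt = y0"
begin

interpretation CC: category "C1cat K :: ('u small_star_cat, 'u sfun) cat" by (rule category_C1cat)

lemma reals: "\<real> \<subseteq> K" using scalars by auto

lemma pt: "pt \<in> obj Fld" using field by (simp add: is_scalar_cat_def)

lemmas fld_ex = scalar_cat_functor[OF scalars field]
lemmas fld_eq = scalar_cat_functor_eq[OF scalars field]

definition "s0 = fob in0 pt"
definition "s1 = fob in1 pt"

lemma in_hom: "in0 \<in> hom (C1cat K) Fld Sum" "in1 \<in> hom (C1cat K) Fld Sum"
  using coproduct by (simp_all add: is_coproduct_def)

lemma s_obj: "s0 \<in> obj Sum" "s1 \<in> obj Sum"
  using homD_fob[OF in_hom(1) pt] homD_fob[OF in_hom(2) pt] by (simp_all add: s0_def s1_def)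

lemma V_s: "fob V s0 = x0" "fob V s1 = x1"
  using V fob_cmp_C1cat[OF in_hom(1) pt] fob_cmp_C1cat[OF in_hom(2) pt]
    by (simp_all add: s0_def s1_def)

section \<open>*-functors out of \<open>Sum\<close>, \<open>One\<close> and \<open>P\<close>\<close>

lemma coproduct_universal:
  assumes f: "f \<in> hom (C1cat K) Fld B" and g: "g \<in> hom (C1cat K) Fld B"
  shows "\<exists>!h. h \<in> hom (C1cat K) Sum B \<and> cmp (C1cat K) h in0 = f \<and> cmp (C1cat K) h in1 = g"
proof -
  have "B \<in> obj (C1cat K)" using homD_tgtcat[OF f] by (simp add: obj_C1cat)
  with coproduct[unfolded is_coproduct_def, THEN conjunct2, THEN conjunct2] f g show ?thesis by blast
qed

lemma sum_ex:
  assumes B: "cstar_category K B" and x: "x \<in> obj B" and y: "y \<in> obj B"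
  shows "\<exists>F \<in> hom (C1cat K) Sum B. fob F s0 = x \<and> fob F s1 = y"
proof -
  obtain f where f: "f \<in> hom (C1cat K) Fld B" "fob f pt = x" using fld_ex[OF B x] by blast
  obtain g where g: "g \<in> hom (C1cat K) Fld B" "fob g pt = y" using fld_ex[OF B y] by blast
  obtain h where h: "h \<in> hom (C1cat K) Sum B" "cmp (C1cat K) h in0 = f" "cmp (C1cat K) h in1 = g"
    using coproduct_universal[OF f(1) g(1)] by blast
  then show ?thesis
    using fob_cmp_C1cat[OF in_hom(1) pt, of h] fob_cmp_C1cat[OF in_hom(2) pt, of h] f g
    by (intro bexI[of _ h]) (simp_all add: s0_def s1_def)
qed

lemma sum_eq:
  assumes F: "F \<in> hom (C1cat K) Sum B" and G: "G \<in> hom (C1cat K) Sum B"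
    and eq: "fob F s0 = fob G s0" "fob F s1 = fob G s1"
  shows "F = G"
proof -
  note F0 = cmp_hom_C1cat[OF in_hom(1) F] and G0 = cmp_hom_C1cat[OF in_hom(1) G]
  note F1 = cmp_hom_C1cat[OF in_hom(2) F] and G1 = cmp_hom_C1cat[OF in_hom(2) G]
  have "cmp (C1cat K) F in0 = cmp (C1cat K) G in0"
    using fld_eq[OF F0 G0] fob_cmp_C1cat[OF in_hom(1) pt] eq by (simp add: s0_def)
  moreover have "cmp (C1cat K) F in1 = cmp (C1cat K) G in1"
    using fld_eq[OF F1 G1] fob_cmp_C1cat[OF in_hom(2) pt] eq by (simp add: s1_def)
  ultimately show ?thesis using coproduct_universal[OF F0 F1] F G by metis
qed

lemma one_obj: "obj One = {x0, x1}" "x0 \<noteq> x1" and a: "a \<in> hom One x0 x1" "nrm One a \<le> 1"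
  using one by (simp_all add: universal_contraction_def)

lemma a_arr: "a \<in> arr One" using a by (simp add: hom_def)

lemma one_ex:
  assumes B: "cstar_category K B" and b: "b \<in> hom B x y" "nrm B b \<le> 1"
  shows "\<exists>F \<in> hom (C1cat K) One B. far F a = b"
proof -
  have "b \<in> arr B" using b by (simp add: hom_def)
  then show ?thesis using one B b(2) unfolding universal_contraction_def by blast
qed

lemma nrm_far_le:
  assumes F: "F \<in> hom (C1cat K) A B" and c: "c \<in> hom A x y" "nrm A c \<le> 1"
  shows "nrm B (far F c) \<le> 1"
  using star_functor_contractive[OF homD_functor[OF F] reals, of c x y] homD_src[OF F] homD_tgt[OF F]
    c by simp

text \<open>The uniqueness clause speaks of target arrows of norm at most 1; contractivity shows
  that \<open>far F a\<close> is one of them.\<close>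

lemma one_eq:
  assumes F: "F \<in> hom (C1cat K) One B" and G: "G \<in> hom (C1cat K) One B" and eq: "far F a = far G a"
  shows "F = G"
proof -
  have "\<exists>!H. H \<in> hom (C1cat K) One B \<and> far H a = far F a"
    using one homD_tgtcat[OF F] homD_arr[OF F a_arr] nrm_far_le[OF F a]
      unfolding universal_contraction_def by blast
  then show ?thesis using F G eq by metis
qed

lemma one_fob:
  assumes "F \<in> hom (C1cat K) One B" "far F a \<in> hom B x y"
  shows "fob F x0 = x" "fob F x1 = y"
  using homD_far[OF assms(1) a(1)] assms(2) by (simp_all add: hom_def)

lemma j: "j0 \<in> hom (C1cat K) One P" "j1 \<in> hom (C1cat K) One P"
  and jV: "cmp (C1cat K) j0 V = cmp (C1cat K) j1 V"
  using P V(1) unfolding is_pushout_def by (auto simp: hom_C1cat arr_C1cat src_C1cat tgt_C1cat)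

lemma pushout_universal:
  assumes s: "s \<in> hom (C1cat K) One B" "s' \<in> hom (C1cat K) One B"
    "cmp (C1cat K) s V = cmp (C1cat K) s' V"
  shows "\<exists>!h. h \<in> hom (C1cat K) P B \<and> cmp (C1cat K) h j0 = s \<and> cmp (C1cat K) h j1 = s'"
proof -
  have "tgt (C1cat K) V = One" using homD_tgt[OF V(1)] by (simp add: tgt_C1cat)
  moreover have "\<forall>z \<in> obj (C1cat K). \<forall>s \<in> hom (C1cat K) (tgt (C1cat K) V) z. \<forall>t \<in> hom (C1cat K)
    (tgt (C1cat K) V) z.
      cmp (C1cat K) s V = cmp (C1cat K) t V \<longrightarrow>
      (\<exists>!h. h \<in> hom (C1cat K) P z \<and> cmp (C1cat K) h j0 = s \<and> cmp (C1cat K) h j1 = t)"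
    using P(1) unfolding is_pushout_def P(2)[symmetric] by blast
  moreover have "B \<in> obj (C1cat K)" using homD_tgtcat[OF s(1)] by (simp add: obj_C1cat)
  ultimately show ?thesis using s by simp
qed

definition "p0 = far j0 a"
definition "p1 = far j1 a"
definition "q0 = fob j0 x0"
definition "q1 = fob j0 x1"

lemma p: "p0 \<in> hom P q0 q1" "p1 \<in> hom P q0 q1" "nrm P p0 \<le> 1" "nrm P p1 \<le> 1"
proof -
  have "fob j0 x0 = fob j1 x0" "fob j0 x1 = fob j1 x1"
    using fob_cmp_C1cat[OF V(1) s_obj(1)] fob_cmp_C1cat[OF V(1) s_obj(2)] jV V_s by metis+
  then show "p0 \<in> hom P q0 q1" "p1 \<in> hom P q0 q1"
    using homD_far[OF j(1) a(1)] homD_far[OF j(2) a(1)] by (simp_all add: p0_def p1_def q0_def q1_def)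
  show "nrm P p0 \<le> 1" "nrm P p1 \<le> 1"
    using nrm_far_le[OF j(1) a] nrm_far_le[OF j(2) a] by (simp_all add: p0_def p1_def)
qed

lemma p_arr: "p0 \<in> arr P" "p1 \<in> arr P"
  using p by (simp_all add: hom_def)

text \<open>Functors out of \<open>Sum\<close> are determined by two objects, so the compatibility
  condition of the pushout just says that the two contractions are parallel.\<close>

lemma p_ex:
  assumes B: "cstar_category K B" and b: "b \<in> hom B x y" "nrm B b \<le> 1"
    and c: "c \<in> hom B x y" "nrm B c \<le> 1"
  shows "\<exists>F \<in> hom (C1cat K) P B. far F p0 = b \<and> far F p1 = c"
proof -
  obtain s where s: "s \<in> hom (C1cat K) One B" "far s a = b" using one_ex[OF B b] by blast
  obtain s' where s': "s' \<in> hom (C1cat K) One B" "far s' a = c" using one_ex[OF B c] by blast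
  have "cmp (C1cat K) s V = cmp (C1cat K) s' V"
    by (rule sum_eq[OF cmp_hom_C1cat[OF V(1) s(1)] cmp_hom_C1cat[OF V(1) s'(1)]])
      (use one_fob[OF s(1)] one_fob[OF s'(1)] s s' b c in
        \<open>simp_all add: fob_cmp_C1cat[OF V(1) s_obj(1)] fob_cmp_C1cat[OF V(1) s_obj(2)] V_s\<close>)
  from pushout_universal[OF s(1) s'(1) this] obtain h where
    h: "h \<in> hom (C1cat K) P B" "cmp (C1cat K) h j0 = s" "cmp (C1cat K) h j1 = s'" by blast
  then show ?thesis
    using far_cmp_C1cat[OF j(1) a_arr, of h] far_cmp_C1cat[OF j(2) a_arr, of h] s s'
    by (intro bexI[of _ h]) (simp_all add: p0_def p1_def)
qed

lemma p_eq:
  assumes F: "F \<in> hom (C1cat K) P B" and G: "G \<in> hom (C1cat K) P B"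
    and eq: "far F p0 = far G p0" "far F p1 = far G p1"
  shows "F = G"
proof -
  note F0 = cmp_hom_C1cat[OF j(1) F] and G0 = cmp_hom_C1cat[OF j(1) G]
  note F1 = cmp_hom_C1cat[OF j(2) F] and G1 = cmp_hom_C1cat[OF j(2) G]
  have e: "cmp (C1cat K) F j0 = cmp (C1cat K) G j0" "cmp (C1cat K) F j1 = cmp (C1cat K) G j1"
    using one_eq[OF F0 G0] one_eq[OF F1 G1] far_cmp_C1cat[OF j(1) a_arr] far_cmp_C1cat[OF j(2) a_arr]
      eq
    by (simp_all add: p0_def p1_def)
  have "cmp (C1cat K) (cmp (C1cat K) F j0) V = cmp (C1cat K) (cmp (C1cat K) F j1) V"
    using CC.cmp_assoc[OF V(1) j(1) F] CC.cmp_assoc[OF V(1) j(2) F] jV by simp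
  from pushout_universal[OF F0 F1 this] show ?thesis using F G e by metis
qed

lemma W_p: "far W p0 = a" "far W p1 = a"
  using far_cmp_C1cat[OF j(1) a_arr, of W] far_cmp_C1cat[OF j(2) a_arr, of W] W(2,3)
    far_ide_C1cat[OF a_arr, of K]
  by (simp_all add: p0_def p1_def)

lemma rlp_generating_cofibrations: "rlp (C1cat K) {U, V, W} = {F. surj_equiv K F (fsrc F) (ftgt F)}"
proof (intro set_eqI iffI)
  fix F :: "'u sfun"
  let ?A = "fsrc F" and ?B = "ftgt F"
  assume F: "F \<in> {F. surj_equiv K F (fsrc F) (ftgt F)}"
  then interpret surj_equiv K F ?A ?B by simp
  show "F \<in> rlp (C1cat K) {U, V, W}"
    unfolding rlp_def src_C1cat tgt_C1cat
  proof (intro CollectI conjI ballI impI)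
    show "F \<in> arr (C1cat K)" using homD_functor[OF F] by (simp add: arr_C1cat)
    fix i f g
    assume i: "i \<in> {U, V, W}" and f: "f \<in> hom (C1cat K) (fsrc i) ?A"
      and g: "g \<in> hom (C1cat K) (ftgt i) ?B"
      and sq: "cmp (C1cat K) F f = cmp (C1cat K) g i"
    consider (U) "i = U" | (V) "i = V" | (W) "i = W" using i by blast
    then show "\<exists>h \<in> hom (C1cat K) (ftgt i) ?A. cmp (C1cat K) h i = f \<and> cmp (C1cat K) F h = g"
    proof cases
      case U: U
      have Fld: "ftgt i = Fld" "fsrc i = Emp"
        using homD_tgt homD_src generating_maps.U[OF generating_maps_axioms] U by auto
      obtain x where x: "x \<in> obj ?A" "fob F x = fob g pt"
        using surj homD_fob[OF g] pt Fld by metis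
      obtain h where h: "h \<in> hom (C1cat K) Fld ?A" "fob h pt = x"
        using fld_ex[OF A.cstar_category_axioms x(1)] by blast
      have "cmp (C1cat K) h i = f"
        by (rule empty_functor_eq[OF empty(2)])
          (use cmp_hom_C1cat[OF generating_maps.U[OF generating_maps_axioms] h(1)] f Fld U in
            simp_all)
      moreover have "cmp (C1cat K) F h = g"
        by (rule fld_eq[OF cmp_hom_C1cat[OF h(1) F] g[unfolded Fld]])
          (simp add: fob_cmp_C1cat[OF h(1) pt] h x)
      ultimately show ?thesis using h(1) Fld by auto
    next
      case V: V
      note Vh = generating_maps.V(1)[OF generating_maps_axioms]
      have ft: "ftgt i = One" "fsrc i = Sum" using homD_tgt[OF Vh] homD_src[OF Vh] V by auto
      note f = f[unfolded ft] and g = g[unfolded ft]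
      \<comment> \<open>Lifting against \<open>V\<close>: \<open>f\<close> dictates the lift of
        \<open>g\<close> on the two objects, and \<open>lift_functor\<close> does the rest.\<close>
      define \<phi> where "\<phi> z = (if z = x0 then fob f s0 else fob f s1)" for z
      have sqo: "fob F (fob f s) = fob g (fob V s)" if "s \<in> obj Sum" for s
        using fob_cmp_C1cat[OF f that, of F] fob_cmp_C1cat[OF Vh that, of g] sq V by metis
      obtain h where h: "h \<in> hom (C1cat K) One ?A" "cmp (C1cat K) F h = g"
        "\<And>x. x \<in> obj One \<Longrightarrow> fob h x = \<phi> x"
      proof (rule lift_functor[OF g, of \<phi>])
        fix z assume z: "z \<in> obj One"
        then show "\<phi> z \<in> obj ?A" using homD_fob[OF f s_obj(1)] homD_fob[OF f s_obj(2)]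
          by (simp add: \<phi>_def)
        show "fob F (\<phi> z) = fob g z"
          using z one_obj sqo[OF s_obj(1)] sqo[OF s_obj(2)] V_s by (auto simp: \<phi>_def)
      qed blast
      have "cmp (C1cat K) h V = f"
        by (rule sum_eq[OF cmp_hom_C1cat[OF Vh h(1)] f])
          (use h(3) one_obj in \<open>auto simp: fob_cmp_C1cat[OF Vh s_obj(1)] fob_cmp_C1cat[OF Vh s_obj(2)]
            V_s \<phi>_def\<close>)
      then show ?thesis using h V ft by auto
    next
      case W: W
      note Wh = generating_maps.W(1)[OF generating_maps_axioms]
      have ft: "ftgt i = One" "fsrc i = P" using homD_tgt[OF Wh] homD_src[OF Wh] W by auto
      note f = f[unfolded ft] and g = g[unfolded ft]
      have sqa: "far F (far f c) = far g (far W c)" if "c \<in> arr P" for c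
        using far_cmp_C1cat[OF f that, of F] far_cmp_C1cat[OF Wh that, of g] sq W by metis
      \<comment> \<open>Both arrows chosen by \<open>f\<close> lie over the same arrow of the
        target, so faithfulness makes \<open>f\<close> factor through \<open>W\<close>.\<close>
      have eq: "far f p0 = far f p1"
        by (rule faithful[OF homD_far[OF f p(1)] homD_far[OF f p(2)]]) (simp add: sqa p_arr W_p)
      define h where "h = cmp (C1cat K) f j0"
      have h: "h \<in> hom (C1cat K) One ?A" unfolding h_def by (rule cmp_hom_C1cat[OF j(1) f])
      have ha: "far h a = far f p0" unfolding h_def p0_def by (rule far_cmp_C1cat[OF j(1) a_arr])
      have "cmp (C1cat K) h W = f"
        by (rule p_eq[OF cmp_hom_C1cat[OF Wh h] f])
          (simp_all add: far_cmp_C1cat[OF Wh p_arr(1)] far_cmp_C1cat[OF Wh p_arr(2)] W_p ha eq)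
      moreover have "cmp (C1cat K) F h = g"
        by (rule one_eq[OF cmp_hom_C1cat[OF h F] g])
          (simp add: far_cmp_C1cat[OF h a_arr] ha sqa p_arr W_p)
      ultimately show ?thesis using h W ft by auto
    qed
  qed
next
  fix F :: "'u sfun"
  let ?A = "fsrc F" and ?B = "ftgt F"
  assume "F \<in> rlp (C1cat K) {U, V, W}"
  then have sf: "star_functor K F" and lift: "\<And>i f g. i \<in> {U, V, W} \<Longrightarrow> f \<in> hom (C1cat K) (fsrc i) ?A \<Longrightarrow>
      g \<in> hom (C1cat K) (ftgt i) ?B \<Longrightarrow> cmp (C1cat K) F f = cmp (C1cat K) g i \<Longrightarrow>
      \<exists>h \<in> hom (C1cat K) (ftgt i) ?A. cmp (C1cat K) h i = f \<and> cmp (C1cat K) F h = g"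
    by (auto simp: rlp_def arr_C1cat src_C1cat tgt_C1cat)
  have F: "F \<in> hom (C1cat K) ?A ?B" using sf by (simp add: hom_C1cat)
  interpret A: real_cstar_category K ?A by (rule real_cstar_categoryI[OF homD_srccat[OF F] reals])
  interpret B: real_cstar_category K ?B by (rule real_cstar_categoryI[OF homD_tgtcat[OF F] reals])
  have surj: "\<exists>x \<in> obj ?A. fob F x = y" if y: "y \<in> obj ?B" for y
  proof -
    obtain g where g: "g \<in> hom (C1cat K) Fld ?B" "fob g pt = y"
      using fld_ex[OF B.cstar_category_axioms y] by blast
    have "cstar_category K Emp" using empty(1) by (simp add: obj_C1cat)
    then obtain f where f: "f \<in> hom (C1cat K) Emp ?A"
      using empty_functor[OF _ empty(2) A.cstar_category_axioms] by blast
    have "cmp (C1cat K) F f = cmp (C1cat K) g U"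
      by (rule empty_functor_eq[OF empty(2) cmp_hom_C1cat[OF f F] cmp_hom_C1cat[OF U g(1)]])
    then obtain h where h: "h \<in> hom (C1cat K) Fld ?A" "cmp (C1cat K) F h = g"
      using lift[of U f g] f g(1) homD_src[OF U] homD_tgt[OF U] by auto
    then have "fob F (fob h pt) = y" using fob_cmp_C1cat[OF h(1) pt, of F] g(2) by simp
    then show ?thesis using homD_fob[OF h(1) pt] by blast
  qed
  have faithful: "c = c'" if c: "c \<in> hom ?A x y" "c' \<in> hom ?A x y" and eq: "far F c = far F c'"
    for c c' x y
  proof -
    \<comment> \<open>One factor for both arrows, since equality must be recovered after rescaling;
      the summand 1 keeps the denominator positive.\<close>
    define e where "e = 1 / (1 + nrm ?A c + nrm ?A c')"
    have e: "0 < e" "e * nrm ?A c \<le> 1" "e * nrm ?A c' \<le> 1"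
      using A.nrm_nonneg[OF c(1)] A.nrm_nonneg[OF c(2)] by (simp_all add: e_def divide_le_eq)
    note sc = A.scale_contraction[OF c(1) e(1,2)] and sc' = A.scale_contraction[OF c(2) e(1,3)]
    obtain f where f: "f \<in> hom (C1cat K) P ?A" "far f p0 = scale ?A (of_real e) c"
      "far f p1 = scale ?A (of_real e) c'"
      using p_ex[OF A.cstar_category_axioms sc(1,2) sc'(1,2)] by blast
    have eqs: "far F (scale ?A (of_real e) c) = far F (scale ?A (of_real e) c')"
      using star_functor.far_scale[OF sf A.of_real_K] c eq by metis
    \<comment> \<open>The rescaled arrows define \<open>f\<close> on \<open>P\<close>, and
      \<open>F f\<close> factors through \<open>W\<close> as \<open>g\<close> since their images
      agree. A lift makes \<open>f\<close> itself factor through \<open>W\<close>, which identifies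
      the arrows.\<close>
    define g where "g = cmp (C1cat K) F (cmp (C1cat K) f j0)"
    note fj = cmp_hom_C1cat[OF j(1) f(1)]
    have g: "g \<in> hom (C1cat K) One ?B" unfolding g_def by (rule cmp_hom_C1cat[OF fj F])
    have ga: "far g a = far F (far f p0)"
      unfolding g_def p0_def using far_cmp_C1cat[OF fj a_arr] far_cmp_C1cat[OF j(1) a_arr] by simp
    have "cmp (C1cat K) F f = cmp (C1cat K) g W"
      by (rule p_eq[OF cmp_hom_C1cat[OF f(1) F] cmp_hom_C1cat[OF W(1) g]])
        (simp_all add: far_cmp_C1cat[OF f(1) p_arr(1)] far_cmp_C1cat[OF f(1) p_arr(2)]
          far_cmp_C1cat[OF W(1) p_arr(1)] far_cmp_C1cat[OF W(1) p_arr(2)] W_p ga f eqs)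
    then obtain h where h: "cmp (C1cat K) h W = f"
      using lift[of W f g] f(1) g homD_src[OF W(1)] homD_tgt[OF W(1)] by auto
    have "far f p0 = far f p1"
      using far_cmp_C1cat[OF W(1) p_arr(1), of h] far_cmp_C1cat[OF W(1) p_arr(2), of h] W_p h by simp
    then show "c = c'" using f sc(3) sc'(3) by simp
  qed
  have full: "\<exists>c \<in> hom ?A x y. far F c = b"
    if x: "x \<in> obj ?A" and y: "y \<in> obj ?A" and b: "b \<in> hom ?B (fob F x) (fob F y)" for x y b
  proof -
    define e where "e = 1 / (1 + nrm ?B b)"
    have e: "0 < e" "e * nrm ?B b \<le> 1"
      using B.nrm_nonneg[OF b] by (simp_all add: e_def divide_le_eq)
    note sc = B.scale_contraction[OF b e]
    obtain g where g: "g \<in> hom (C1cat K) One ?B" "far g a = scale ?B (of_real e) b"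
      using one_ex[OF B.cstar_category_axioms sc(1,2)] by blast
    obtain f where f: "f \<in> hom (C1cat K) Sum ?A" "fob f s0 = x" "fob f s1 = y"
      using sum_ex[OF A.cstar_category_axioms x y] by blast
    have gx: "fob g x0 = fob F x" "fob g x1 = fob F y" using one_fob[OF g(1)] g(2) sc(1) by simp_all
    have "cmp (C1cat K) F f = cmp (C1cat K) g V"
      by (rule sum_eq[OF cmp_hom_C1cat[OF f(1) F] cmp_hom_C1cat[OF V(1) g(1)]])
        (simp_all add: fob_cmp_C1cat[OF f(1) s_obj(1)] fob_cmp_C1cat[OF f(1) s_obj(2)]
          fob_cmp_C1cat[OF V(1) s_obj(1)] fob_cmp_C1cat[OF V(1) s_obj(2)] V_s gx f)
    then obtain h where h: "h \<in> hom (C1cat K) One ?A" "cmp (C1cat K) h V = f" "cmp (C1cat K) F h = g"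
      using lift[of V f g] f(1) g(1) homD_src[OF V(1)] homD_tgt[OF V(1)] by auto
    have "fob h x0 = x" "fob h x1 = y"
      using fob_cmp_C1cat[OF V(1) s_obj(1), of h] fob_cmp_C1cat[OF V(1) s_obj(2), of h] V_s h(2) f
        by simp_all
    then have ha: "far h a \<in> hom ?A x y" using homD_far[OF h(1) a(1)] by simp
    have "far F (far h a) = scale ?B (of_real e) b"
      using far_cmp_C1cat[OF h(1) a_arr, of F] h(3) g(2) by simp
    then have "far F (scale ?A (of_real (1 / e)) (far h a)) = b"
      using star_functor.far_scale[OF sf A.of_real_K ha, of "1 / e"] sc(3) by simp
    then show ?thesis using A.scale_hom[OF A.of_real_K ha] by blast
  qed
  have "surj_equiv K F ?A ?B"
    by (rule surj_equiv.intro[OF F surj faithful full])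
  then show "F \<in> {F. surj_equiv K F (fsrc F) (ftgt F)}" by (rule CollectI)
qed

section \<open>Lifting against the interval\<close>

lemma interval_facts: "cstar_category K Iv" "u \<in> hom Iv y0 y1" "unitary_arrow Iv u"
  using interval by (simp_all add: universal_unitary_def)

lemma u_arr: "u \<in> arr Iv" using interval_facts(2) by (simp add: hom_def)

lemma interval_universal: "cstar_category K B \<Longrightarrow> unitary_arrow B v \<Longrightarrow> \<exists>!F. F \<in> hom (C1cat K) Iv B \<and>
  far F u = v"
  using interval by (simp add: universal_unitary_def)

lemma interval_eq:
  assumes F: "F \<in> hom (C1cat K) Iv B" and G: "G \<in> hom (C1cat K) Iv B" and eq: "far F u = far G u"
  shows "F = G"
  using interval_universal[OF homD_tgtcat[OF F] functor_unitary[OF F interval_facts(3)]] F G eq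
    by metis

text \<open>A lifting problem against \<open>Z\<close> is an object of the source of
  \<open>F\<close> together with a unitary starting at its image; a solution is a unitary over it
  that starts at the object.\<close>

lemma rlp_generating_trivial_cofibrations: "rlp (C1cat K) {Z} = {F. unitary_fibration K F}"
proof (intro set_eqI iffI)
  fix F :: "'u sfun"
  let ?A = "fsrc F" and ?B = "ftgt F"
  assume "F \<in> {F. unitary_fibration K F}"
  then have sf: "star_functor K F" and fib: "\<And>x y v. x \<in> obj ?A \<Longrightarrow> y \<in> obj ?B \<Longrightarrow>
    v \<in> hom ?B (fob F x) y \<Longrightarrow>
      unitary_arrow ?B v \<Longrightarrow> \<exists>x' \<in> obj ?A. \<exists>u \<in> hom ?A x x'. unitary_arrow ?A u \<and> far F u = v"
    by (auto simp: unitary_fibration_def)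
  have F: "F \<in> hom (C1cat K) ?A ?B" using sf by (simp add: hom_C1cat)
  interpret B: cstar_category K ?B by (rule homD_tgtcat[OF F])
  have Zs: "fsrc Z = Fld" "ftgt Z = Iv" using homD_src[OF Z(1)] homD_tgt[OF Z(1)] by simp_all
  show "F \<in> rlp (C1cat K) {Z}"
    unfolding rlp_def src_C1cat tgt_C1cat
  proof (intro CollectI conjI ballI impI)
    show "F \<in> arr (C1cat K)" using sf by (simp add: arr_C1cat)
    fix i f g assume i: "i \<in> {Z}" and f: "f \<in> hom (C1cat K) (fsrc i) ?A"
      and g: "g \<in> hom (C1cat K) (ftgt i) ?B"
      and sq: "cmp (C1cat K) F f = cmp (C1cat K) g i"
    have f: "f \<in> hom (C1cat K) Fld ?A" and g: "g \<in> hom (C1cat K) Iv ?B" using f g i Zs by auto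
    have "fob F (fob f pt) = fob g y0"
      using fob_cmp_C1cat[OF f pt, of F] fob_cmp_C1cat[OF Z(1) pt, of g] sq i Z(2) by simp
    then have v: "far g u \<in> hom ?B (fob F (fob f pt)) (fob g y1)"
      using homD_far[OF g interval_facts(2)] by simp
    obtain x' w where w: "w \<in> hom ?A (fob f pt) x'" "unitary_arrow ?A w" "far F w = far g u"
      using fib[OF homD_fob[OF f pt] B.hom_obj(2)[OF v] v functor_unitary[OF g interval_facts(3)]]
        by blast
    obtain h where h: "h \<in> hom (C1cat K) Iv ?A" "far h u = w"
      using interval_universal[OF homD_srccat[OF F] w(2)] by blast
    have "fob h y0 = fob f pt" using homD_far[OF h(1) interval_facts(2)] w(1) h(2)
      by (simp add: hom_def)
    then have "cmp (C1cat K) h Z = f"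
      using fld_eq[OF cmp_hom_C1cat[OF Z(1) h(1)] f] fob_cmp_C1cat[OF Z(1) pt, of h] Z(2) by simp
    moreover have "cmp (C1cat K) F h = g"
      using interval_eq[OF cmp_hom_C1cat[OF h(1) F] g] far_cmp_C1cat[OF h(1) u_arr, of F] h(2) w(3)
        by simp
    ultimately show "\<exists>h \<in> hom (C1cat K) (ftgt i) ?A. cmp (C1cat K) h i = f \<and> cmp (C1cat K) F h = g"
      using h(1) i Zs by auto
  qed
next
  fix F :: "'u sfun"
  let ?A = "fsrc F" and ?B = "ftgt F"
  assume "F \<in> rlp (C1cat K) {Z}"
  then have sf: "star_functor K F" and lift: "\<And>f g. f \<in> hom (C1cat K) Fld ?A \<Longrightarrow>
      g \<in> hom (C1cat K) Iv ?B \<Longrightarrow> cmp (C1cat K) F f = cmp (C1cat K) g Z \<Longrightarrow>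
      \<exists>h \<in> hom (C1cat K) Iv ?A. cmp (C1cat K) h Z = f \<and> cmp (C1cat K) F h = g"
    using homD_src[OF Z(1)] homD_tgt[OF Z(1)] by (auto simp: rlp_def arr_C1cat src_C1cat tgt_C1cat)
  have F: "F \<in> hom (C1cat K) ?A ?B" using sf by (simp add: hom_C1cat)
  interpret A: cstar_category K ?A by (rule homD_srccat[OF F])
  have "\<exists>x' \<in> obj ?A. \<exists>w \<in> hom ?A x x'. unitary_arrow ?A w \<and> far F w = v"
    if x: "x \<in> obj ?A" and v: "v \<in> hom ?B (fob F x) y" "unitary_arrow ?B v" for x y v
  proof -
    obtain f where f: "f \<in> hom (C1cat K) Fld ?A" "fob f pt = x" using fld_ex[OF homD_srccat[OF F] x]
      by blast
    obtain g where g: "g \<in> hom (C1cat K) Iv ?B" "far g u = v"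
      using interval_universal[OF homD_tgtcat[OF F] v(2)] by blast
    have "fob g y0 = fob F x" using homD_far[OF g(1) interval_facts(2)] v(1) g(2)
      by (simp add: hom_def)
    then have "cmp (C1cat K) F f = cmp (C1cat K) g Z"
      using fld_eq[OF cmp_hom_C1cat[OF f(1) F] cmp_hom_C1cat[OF Z(1) g(1)]]
        fob_cmp_C1cat[OF Z(1) pt, of g] fob_cmp_C1cat[OF f(1) pt, of F] Z(2) f(2) by simp
    from lift[OF f(1) g(1) this] obtain h where h: "h \<in> hom (C1cat K) Iv ?A" "cmp (C1cat K) h Z = f"
      "cmp (C1cat K) F h = g"
      by blast
    have "fob h y0 = x" using fob_cmp_C1cat[OF Z(1) pt, of h] Z(2) h(2) f(2) by simp
    then have hu: "far h u \<in> hom ?A x (fob h y1)" using homD_far[OF h(1) interval_facts(2)] by simp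
    moreover have "far F (far h u) = v" using far_cmp_C1cat[OF h(1) u_arr, of F] h(3) g(2) by simp
    ultimately show ?thesis using functor_unitary[OF h(1) interval_facts(3)] A.hom_obj(2)[OF hu]
      by blast
  qed
  then show "F \<in> {F. unitary_fibration K F}" using sf by (simp add: unitary_fibration_def)
qed

section \<open>Smallness of the domains\<close>

context
  fixes k :: "'u rel"
  assumes k: "(card_of (UNIV :: nat set), k) \<in> ordLeq"
begin

lemma small_empty: "k_small_rel (C1cat K) k D Emp"
proof (rule k_small_relI[OF scalars enc k])
  fix r :: "'u rel" and X t L m f
  assume "countably_filtered_colimit K r X t L m enc" and "Field r \<noteq> {}"
    and f: "f \<in> hom (C1cat K) Emp L"
  then interpret countably_filtered_colimit K r X t L m enc by simp
  obtain b where b: "b \<in> Field r" using \<open>Field r \<noteq> {}\<close> by blast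
  obtain g where g: "g \<in> hom (C1cat K) Emp (X b)"
    using empty_functor[OF _ empty(2) S.X_cs[OF b]] empty(1) by (auto simp: obj_C1cat)
  show "\<exists>b \<in> Field r. \<exists>g \<in> hom (C1cat K) Emp (X b). cmp (C1cat K) (m b) g = f"
    using b g empty_functor_eq[OF empty(2) cmp_hom_C1cat[OF g m[OF b]] f] by blast
next
  fix r :: "'u rel" and X t L m b g g'
  assume "countably_filtered_colimit K r X t L m enc" and b: "b \<in> Field r"
    and g: "g \<in> hom (C1cat K) Emp (X b)" "g' \<in> hom (C1cat K) Emp (X b)"
  then interpret countably_filtered_colimit K r X t L m enc by simp
  show "\<exists>d. (b, d) \<in> r \<and> cmp (C1cat K) (t b d) g = cmp (C1cat K) (t b d) g'"
    using S.r_refl[OF b] empty_functor_eq[OF empty(2) g] by blast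
qed

lemma small_field: "k_small_rel (C1cat K) k D Fld"
proof (rule k_small_relI[OF scalars enc k])
  fix r :: "'u rel" and X t L m f
  assume "countably_filtered_colimit K r X t L m enc" and f: "f \<in> hom (C1cat K) Fld L"
  then interpret countably_filtered_colimit K r X t L m enc by simp
  obtain b x where b: "b \<in> Field r" "x \<in> obj (X b)" "fob (m b) x = fob f pt"
    using colimit_obj_lift[OF homD_fob[OF f pt] homD_fob[OF f pt]] by blast
  obtain g where g: "g \<in> hom (C1cat K) Fld (X b)" "fob g pt = x" using fld_ex[OF S.X_cs[OF b(1)] b(2)]
    by blast
  have "cmp (C1cat K) (m b) g = f"
    using fld_eq[OF cmp_hom_C1cat[OF g(1) m[OF b(1)]] f] fob_cmp_C1cat[OF g(1) pt, of "m b"] g(2) b(3)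
      by simp
  then show "\<exists>b \<in> Field r. \<exists>g \<in> hom (C1cat K) Fld (X b). cmp (C1cat K) (m b) g = f" using b g by blast
next
  fix r :: "'u rel" and X t L m b g g'
  assume "countably_filtered_colimit K r X t L m enc" and b: "b \<in> Field r"
    and g: "g \<in> hom (C1cat K) Fld (X b)" "g' \<in> hom (C1cat K) Fld (X b)"
    and eq: "cmp (C1cat K) (m b) g = cmp (C1cat K) (m b) g'"
  then interpret countably_filtered_colimit K r X t L m enc by simp
  have "fob (m b) (fob g pt) = fob (m b) (fob g' pt)"
    using fob_cmp_C1cat[OF g(1) pt, of "m b"] fob_cmp_C1cat[OF g(2) pt, of "m b"] eq by simp
  then obtain d where d: "(b, d) \<in> r" "fob (t b d) (fob g pt) = fob (t b d) (fob g' pt)"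
    using colimit_eq2_obj[OF b homD_fob[OF g(1) pt] homD_fob[OF g(2) pt] homD_fob[OF g(1) pt]
      homD_fob[OF g(2) pt]] by blast
  have "cmp (C1cat K) (t b d) g = cmp (C1cat K) (t b d) g'"
    using fld_eq[OF cmp_hom_C1cat[OF g(1) t[OF d(1)]] cmp_hom_C1cat[OF g(2) t[OF d(1)]]]
      fob_cmp_C1cat[OF g(1) pt, of "t b d"] fob_cmp_C1cat[OF g(2) pt, of "t b d"] d(2) by simp
  then show "\<exists>d. (b, d) \<in> r \<and> cmp (C1cat K) (t b d) g = cmp (C1cat K) (t b d) g'" using d(1) by blast
qed

lemma small_sum: "k_small_rel (C1cat K) k D Sum"
proof (rule k_small_relI[OF scalars enc k])
  fix r :: "'u rel" and X t L m f
  assume "countably_filtered_colimit K r X t L m enc" and f: "f \<in> hom (C1cat K) Sum L"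
  then interpret countably_filtered_colimit K r X t L m enc by simp
  obtain b x y where b: "b \<in> Field r" "x \<in> obj (X b)" "y \<in> obj (X b)" "fob (m b) x = fob f s0"
    "fob (m b) y = fob f s1"
    using colimit_obj_lift[OF homD_fob[OF f s_obj(1)] homD_fob[OF f s_obj(2)]] by blast
  obtain g where g: "g \<in> hom (C1cat K) Sum (X b)" "fob g s0 = x" "fob g s1 = y"
    using sum_ex[OF S.X_cs[OF b(1)] b(2,3)] by blast
  have "cmp (C1cat K) (m b) g = f"
    using sum_eq[OF cmp_hom_C1cat[OF g(1) m[OF b(1)]] f] fob_cmp_C1cat[OF g(1) s_obj(1), of "m b"]
      fob_cmp_C1cat[OF g(1) s_obj(2), of "m b"] g(2,3) b(4,5) by simp
  then show "\<exists>b \<in> Field r. \<exists>g \<in> hom (C1cat K) Sum (X b). cmp (C1cat K) (m b) g = f" using b g by blast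
next
  fix r :: "'u rel" and X t L m b g g'
  assume "countably_filtered_colimit K r X t L m enc" and b: "b \<in> Field r"
    and g: "g \<in> hom (C1cat K) Sum (X b)" "g' \<in> hom (C1cat K) Sum (X b)"
    and eq: "cmp (C1cat K) (m b) g = cmp (C1cat K) (m b) g'"
  then interpret countably_filtered_colimit K r X t L m enc by simp
  have "fob (m b) (fob g s) = fob (m b) (fob g' s)" if "s \<in> obj Sum" for s
    using fob_cmp_C1cat[OF g(1) that, of "m b"] fob_cmp_C1cat[OF g(2) that, of "m b"] eq by simp
  from colimit_eq2_obj[OF b homD_fob[OF g(1) s_obj(1)] homD_fob[OF g(2) s_obj(1)]
      homD_fob[OF g(1) s_obj(2)] homD_fob[OF g(2) s_obj(2)] this[OF s_obj(1)] this[OF s_obj(2)]]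
  obtain d where d: "(b, d) \<in> r" "fob (t b d) (fob g s0) = fob (t b d) (fob g' s0)"
    "fob (t b d) (fob g s1) = fob (t b d) (fob g' s1)" by blast
  have "cmp (C1cat K) (t b d) g = cmp (C1cat K) (t b d) g'"
    by (rule sum_eq[OF cmp_hom_C1cat[OF g(1) t[OF d(1)]] cmp_hom_C1cat[OF g(2) t[OF d(1)]]])
      (simp_all add: fob_cmp_C1cat[OF g(1) s_obj(1)] fob_cmp_C1cat[OF g(2) s_obj(1)]
        fob_cmp_C1cat[OF g(1) s_obj(2)] fob_cmp_C1cat[OF g(2) s_obj(2)] d)
  then show "\<exists>d. (b, d) \<in> r \<and> cmp (C1cat K) (t b d) g = cmp (C1cat K) (t b d) g'" using d(1) by blast
qed

text \<open>A map out of \<open>P\<close> is a parallel pair of contractions. Both lift to one stage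
  with their norms bounded as before, so the lifts again define a map out of
  \<open>P\<close>.\<close>

lemma small_pushout: "k_small_rel (C1cat K) k D P"
proof (rule k_small_relI[OF scalars enc k])
  fix r :: "'u rel" and X t L m f
  assume "countably_filtered_colimit K r X t L m enc" and f: "f \<in> hom (C1cat K) P L"
  then interpret countably_filtered_colimit K r X t L m enc by simp
  obtain b \<sigma> \<alpha> \<beta> where b: "b \<in> Field r" and \<alpha>: "\<alpha> \<in> hom (X b) (\<sigma> (fob f q0)) (\<sigma> (fob f q1))"
    and \<beta>: "\<beta> \<in> hom (X b) (\<sigma> (fob f q0)) (\<sigma> (fob f q1))"
      and e: "far (m b) \<alpha> = far f p0" "far (m b) \<beta> = far f p1"
    and n: "nrm (X b) \<alpha> \<le> nrm L (far f p0)" "nrm (X b) \<beta> \<le> nrm L (far f p1)"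
    using colimit_lift[OF homD_far[OF f p(1)] homD_far[OF f p(2)]] by blast
  have "nrm (X b) \<alpha> \<le> 1" "nrm (X b) \<beta> \<le> 1"
    using n nrm_far_le[OF f p(1,3)] nrm_far_le[OF f p(2,4)] by simp_all
  then obtain g where g: "g \<in> hom (C1cat K) P (X b)" "far g p0 = \<alpha>" "far g p1 = \<beta>"
    using p_ex[OF S.X_cs[OF b] \<alpha> _ \<beta>] by blast
  have "cmp (C1cat K) (m b) g = f"
    using p_eq[OF cmp_hom_C1cat[OF g(1) m[OF b]] f] far_cmp_C1cat[OF g(1) p_arr(1), of "m b"]
      far_cmp_C1cat[OF g(1) p_arr(2), of "m b"] g(2,3) e by simp
  then show "\<exists>b \<in> Field r. \<exists>g \<in> hom (C1cat K) P (X b). cmp (C1cat K) (m b) g = f" using b g by blast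
next
  fix r :: "'u rel" and X t L m b g g'
  assume "countably_filtered_colimit K r X t L m enc" and b: "b \<in> Field r"
    and g: "g \<in> hom (C1cat K) P (X b)" "g' \<in> hom (C1cat K) P (X b)"
    and eq: "cmp (C1cat K) (m b) g = cmp (C1cat K) (m b) g'"
  then interpret countably_filtered_colimit K r X t L m enc by simp
  have "far (m b) (far g c) = far (m b) (far g' c)" if "c \<in> arr P" for c
    using far_cmp_C1cat[OF g(1) that, of "m b"] far_cmp_C1cat[OF g(2) that, of "m b"] eq by simp
  from colimit_eq2[OF b homD_arr[OF g(1) p_arr(1)] homD_arr[OF g(2) p_arr(1)]
      homD_arr[OF g(1) p_arr(2)] homD_arr[OF g(2) p_arr(2)] this[OF p_arr(1)] this[OF p_arr(2)]]
  obtain d where d: "(b, d) \<in> r" "far (t b d) (far g p0) = far (t b d) (far g' p0)"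
    "far (t b d) (far g p1) = far (t b d) (far g' p1)" by blast
  have "cmp (C1cat K) (t b d) g = cmp (C1cat K) (t b d) g'"
    by (rule p_eq[OF cmp_hom_C1cat[OF g(1) t[OF d(1)]] cmp_hom_C1cat[OF g(2) t[OF d(1)]]])
      (simp_all add: far_cmp_C1cat[OF g(1) p_arr(1)] far_cmp_C1cat[OF g(2) p_arr(1)]
        far_cmp_C1cat[OF g(1) p_arr(2)] far_cmp_C1cat[OF g(2) p_arr(2)] d)
  then show "\<exists>d. (b, d) \<in> r \<and> cmp (C1cat K) (t b d) g = cmp (C1cat K) (t b d) g'" using d(1) by blast
qed

end

end

text \<open>Cantor's theorem: subsets of the naturals embed in \<open>'u\<close> through their
  characteristic sequences with two values \<open>p\<close> and \<open>q\<close>, so a countably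
  infinite subset of \<open>'u\<close> has strictly smaller cardinality.\<close>

lemma countable_cardinal:
  assumes e: "inj (e :: (nat \<Rightarrow> 'u) \<Rightarrow> 'u)" and inf: "infinite (UNIV :: 'u set)"
  shows "\<exists>k :: 'u rel. Card_order k \<and> (k, card_of (UNIV :: 'u set)) \<in> ordLess \<and>
    (card_of (UNIV :: nat set), k) \<in> ordLeq"
proof -
  obtain f :: "nat \<Rightarrow> 'u" where f: "inj f" using infinite_countable_subset[OF inf] by blast
  obtain p q :: 'u where pq: "p \<noteq> q" using ex_new_if_finite[OF inf, of "{undefined}"] by blast
  let ?k = "card_of (range f)"
  have 1: "(card_of (UNIV :: nat set), ?k) \<in> ordLeq" using f card_of_ordLeq by (metis subset_refl)
  have "(card_of (Pow (UNIV :: nat set)), card_of (UNIV :: 'u set)) \<in> ordLeq"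
  proof (rule card_of_ordLeqI)
    show "inj_on (\<lambda>S. e (\<lambda>n. if n \<in> S then p else q)) (Pow UNIV)"
    proof (rule inj_onI)
      fix S T :: "nat set"
      assume "e (\<lambda>n. if n \<in> S then p else q) = e (\<lambda>n. if n \<in> T then p else q)"
      from injD[OF e, OF this] have "n \<in> S \<longleftrightarrow> n \<in> T" for n
        using pq by (auto dest: fun_cong[of _ _ n] split: if_splits)
      then show "S = T" by blast
    qed
  qed simp
  then have "(card_of (UNIV :: nat set), card_of (UNIV :: 'u set)) \<in> ordLess"
    using ordLess_ordLeq_trans[OF card_of_Pow] by blast
  then have "(?k, card_of (UNIV :: 'u set)) \<in> ordLess"
    using ordLeq_ordLess_trans[OF card_of_image] by blast
  then show ?thesis using 1 card_of_Card_order by blast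
qed

theorem proposition4p15:
  fixes K :: "complex set"
    and Emp Fld Sum One P Iv :: "'u small_star_cat"
    and U V W Z in0 in1 j0 j1 :: "'u sfun"
    and pt x0 x1 a y0 y1 u :: 'u
  assumes scalars: "K = \<real> \<or> K = UNIV"
    and universe: "infinite (UNIV :: 'u set)" "\<exists>e :: (nat \<Rightarrow> 'u) \<Rightarrow> 'u. inj e"
    and empty: "Emp \<in> obj (C1cat K)" "obj Emp = {}"
    and field: "is_scalar_cat K Fld pt"
    and coproduct: "is_coproduct (C1cat K) Fld Fld Sum in0 in1"
    and one: "universal_contraction K One x0 x1 a"
    and interval: "universal_unitary K Iv y0 y1 u"
    and U: "U \<in> hom (C1cat K) Emp Fld"
    and V: "V \<in> hom (C1cat K) Sum One"
      "fob (cmp (C1cat K) V in0) pt = x0" "fob (cmp (C1cat K) V in1) pt = x1"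
    and P: "is_pushout (C1cat K) V V j0 j1" "P = tgt (C1cat K) j0"
    and W: "W \<in> hom (C1cat K) P One"
      "cmp (C1cat K) W j0 = ide (C1cat K) One" "cmp (C1cat K) W j1 = ide (C1cat K) One"
    and Z: "Z \<in> hom (C1cat K) Fld Iv" "fob Z pt = y0"
  shows "finite {U, V, W} \<and> finite {Z} \<and>
    cofibrantly_generated TYPE('u) (C1cat K) (unitary_model_structure K) {U, V, W} {Z}"
proof -
  obtain e :: "(nat \<Rightarrow> 'u) \<Rightarrow> 'u" where e: "inj e" using universe(2) by blast
  \<comment> \<open>A pair is coded by the sequence that starts with its first component and is
    constant at the second from index 1 on.\<close>
  define enc :: "'u \<times> 'u \<Rightarrow> 'u" where "enc p = e (\<lambda>n. if n = 0 then fst p else snd p)" for p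
  have enc: "inj enc"
  proof (rule injI)
    fix p q assume "enc p = enc q"
    then have "(\<lambda>n::nat. if n = 0 then fst p else snd p) = (\<lambda>n. if n = 0 then fst q else snd q)"
      using injD[OF e] by (simp add: enc_def)
    from fun_cong[OF this, of 0] fun_cong[OF this, of 1] show "p = q" by (simp add: prod_eq_iff)
  qed
  interpret generating_maps K Emp Fld Sum One P Iv U V W Z in0 in1 j0 j1 pt x0 x1 a y0 y1 u enc
    using assms enc by unfold_locales
  obtain k :: "'u rel" where k: "Card_order k" "(k, card_of (UNIV :: 'u set)) \<in> ordLess"
    "(card_of (UNIV :: nat set), k) \<in> ordLeq" using countable_cardinal[OF e universe(1)] by blast
  have small: "small_rel TYPE('u) (C1cat K) D A" if "k_small_rel (C1cat K) k D A" for D A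
    using k that unfolding small_rel_def by blast
  have "{U, V, W} \<subseteq> arr (C1cat K)" "{Z} \<subseteq> arr (C1cat K)"
    using homD_functor[OF U] homD_functor[OF V(1)] homD_functor[OF W(1)] homD_functor[OF Z(1)]
      by (simp_all add: arr_C1cat)
  moreover have "\<forall>i \<in> {U, V, W}. small_rel TYPE('u) (C1cat K) D (src (C1cat K) i)" for D
    using small[OF small_empty[OF k(3)]] small[OF small_sum[OF k(3)]] small[OF small_pushout[OF k(3)]]
      homD_src[OF U] homD_src[OF V(1)] homD_src[OF W(1)] by (simp add: src_C1cat)
  moreover have "\<forall>i \<in> {Z}. small_rel TYPE('u) (C1cat K) D (src (C1cat K) i)" for D
    using small[OF small_field[OF k(3)]] homD_src[OF Z(1)] by (simp add: src_C1cat)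
  moreover have "fib (unitary_model_structure K) = rlp (C1cat K) {Z}"
    by (simp add: unitary_model_structure_def rlp_generating_trivial_cofibrations)
  moreover have "fib (unitary_model_structure K) \<inter> weq (unitary_model_structure K) = rlp (C1cat K)
    {U, V, W}"
    using trivial_fibration_iff[OF reals] unfolding rlp_generating_cofibrations
    by (auto simp: unitary_model_structure_def)
  ultimately show ?thesis unfolding cofibrantly_generated_def by simp
qed

end
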